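(* For any set $X\subset\mathbb{Z}+\tfrac12$, the sequence $\{Z\,\rho(X-n)\}_{n\in\mathbb{Z}}$ of functions of $t=(t_1,t_2,\dots)$ and $t'=(t_1',t_2',\dots)$ is a sequence of $\tau$-functions for the Toda lattice hierarchy. That is, $\tau_n(t,t')=Z\,\rho(X-n)$ satisfies, for all $m,l\in\mathbb{Z}$ and all sequences $s=(s_1,s_2,\dots)$, $s'=(s'_1,s'_2,\dots)$, $$[z^{l-m}]\;\gamma\big(\tfrac1z,-2s'\big)\,\tau_{m+1}\big(t+s,\,t'+s'+\{z\}\big)\,\tau_l\big(t-s,\,t'-s'-\{z\}\big)$$ $$=[z^{m-l}]\;\gamma\big(\tfrac1z,2s\big)\,\tau_m\big(t+s-\{z\},\,t'+s'\big)\,\tau_{l+1}\big(t-s+\{z\},\,t'-s'\big).$$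
   Context: For a partition $\lambda$ let $s_\lambda$ be the Schur function, regarded as a polynomial in the parameters $t_k=\frac1k\sum_ix_i^k$ (for $s_\lambda(x)$), respectively $t'_k=\frac1k\sum_iy_i^k$ (for $s_\lambda(y)$), which are treated as independent variables. Put $Z=\sum_\lambda s_\lambda(x)s_\lambda(y)=\exp\big(\sum_{k\ge1}k\,t_kt'_k\big)$ and $\mathfrak{M}(\lambda)=\frac1Zs_\lambda(x)s_\lambda(y)$ (the Schur measure). Put $\mathfrak{S}(\lambda)=\{\lambda_i-i+\frac12:i\ge1\}\subset\mathbb{Z}+\frac12$, and for $X\subset\mathbb{Z}+\frac12$ let $\rho(X)=\mathfrak{M}(\{\lambda:X\subset\mathfrak{S}(\lambda)\})$, so that $Z\rho(X)=\sum_{\lambda:\,X\subset\mathfrak{S}(\lambda)}s_\lambda(x)s_\lambda(y)$, a formal power series in the $t_k,t_k'$. For $n\in\mathbb{Z}$, $X-n=\{a-n:a\in X\}$. Toda lattice hierarchy. A sequence $\{\tau_n(t,t')\}_{n\in\mathbb{Z}}$ is a sequence of $\tau$-functions of the Toda lattice hierarchy (of Ueno and Takasaki, up to the change of sign $t\to-t$) if it satisfies the displayed Hirota bilinear equations. Notation there: $[z^k]$ denotes the coefficient of $z^k$; $\gamma(z,u)=\exp\big(\sum_{n\ge1}u_nz^n\big)$ for a sequence $u=(u_1,u_2,\dots)$; $\{z\}=(z,\frac{z^2}{2},\frac{z^3}{3},\dots)$; sequences are added and scaled termwise. All identities are in formal power series in $t,t',s,s'$. *)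

theory Defs
  imports Complex_Main "HOL-Library.Poly_Mapping" "Jordan_Normal_Form.Determinant"
begin

section \<open>Formal power series in arbitrarily many variables\<close>

text \<open>A monomial in the variables \<^typ>\<open>'v\<close> is an element of \<^typ>\<open>'v \<Rightarrow>\<^sub>0 nat\<close>.\<close>

typedef ('v, 'a) mps = "UNIV :: (('v \<Rightarrow>\<^sub>0 nat) \<Rightarrow> 'a) set"
  morphisms mcoeff mps
  by simp

setup_lifting type_definition_mps

lemma mps_eqI: "(\<And>M. mcoeff f M = mcoeff g M) \<Longrightarrow> f = g"
  by (metis mcoeff_inject ext)

lemma mcoeff_mps [simp]: "mcoeff (mps f) M = f M"
  by (simp add: mps_inverse)

abbreviation splits :: "('v \<Rightarrow>\<^sub>0 nat) \<Rightarrow> (('v \<Rightarrow>\<^sub>0 nat) \<times> ('v \<Rightarrow>\<^sub>0 nat)) set" where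
  "splits M \<equiv> {(a, b). a + b = M}"

lemma finite_splits [simp]: "finite (splits M)"
proof -
  let ?F = "{f. \<forall>x. (x \<in> Poly_Mapping.keys M \<longrightarrow> f x \<in> {..Max (Poly_Mapping.lookup M ` Poly_Mapping.keys M)}) \<and> (x \<notin> Poly_Mapping.keys M \<longrightarrow> f x = (0::nat))}"
  have fin: "finite ?F" by (rule finite_set_of_finite_funs) auto
  have sub: "Poly_Mapping.lookup ` {a. \<exists>b. a + b = M} \<subseteq> ?F"
  proof (clarsimp, intro allI conjI impI)
    fix a b x assume "M = a + b" "x \<in> Poly_Mapping.keys (a + b)"
    have "Poly_Mapping.lookup a x \<le> Poly_Mapping.lookup (a + b) x" by (simp add: lookup_add)
    also have "\<dots> \<le> Max (Poly_Mapping.lookup (a + b) ` Poly_Mapping.keys (a + b))"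
      using \<open>x \<in> Poly_Mapping.keys (a + b)\<close> by (intro Max_ge) auto
    finally show "Poly_Mapping.lookup a x \<le> Max (Poly_Mapping.lookup (a + b) ` Poly_Mapping.keys (a + b))" .
  next
    fix a b :: "'a \<Rightarrow>\<^sub>0 nat" and x assume "x \<notin> Poly_Mapping.keys (a + b)"
    then show "Poly_Mapping.lookup a x = 0" by (simp add: in_keys_iff lookup_add)
  qed
  have "finite {a. \<exists>b. a + b = M}"
    using finite_imageD[OF finite_subset[OF sub fin]] by (simp add: inj_on_def)
  moreover have "splits M \<subseteq> (\<lambda>a. (a, M - a)) ` {a. \<exists>b. a + b = M}"
    by auto
  ultimately show ?thesis by (meson finite_imageI finite_subset)
qed

instantiation mps :: (type, comm_ring_1) comm_ring_1
begin

lift_definition zero_mps :: "('a, 'b) mps" is "\<lambda>_. 0" .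
lift_definition one_mps :: "('a, 'b) mps" is "\<lambda>M. if M = 0 then 1 else 0" .
lift_definition plus_mps :: "('a, 'b) mps \<Rightarrow> ('a, 'b) mps \<Rightarrow> ('a, 'b) mps" is "\<lambda>f g M. f M + g M" .
lift_definition minus_mps :: "('a, 'b) mps \<Rightarrow> ('a, 'b) mps \<Rightarrow> ('a, 'b) mps" is "\<lambda>f g M. f M - g M" .
lift_definition uminus_mps :: "('a, 'b) mps \<Rightarrow> ('a, 'b) mps" is "\<lambda>f M. - f M" .
lift_definition times_mps :: "('a, 'b) mps \<Rightarrow> ('a, 'b) mps \<Rightarrow> ('a, 'b) mps"
  is "\<lambda>f g M. \<Sum>(a, b) \<in> splits M. f a * g b" .

instance
proof
  fix f g h :: "('a, 'b) mps"
  show "f + g + h = f + (g + h)" by transfer (simp add: add.assoc)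
  show "f + g = g + f" by transfer (simp add: add.commute)
  show "0 + f = f" by transfer simp
  show "- f + f = 0" by transfer simp
  show "f - g = f + - g" by transfer simp
  show "(0 :: ('a, 'b) mps) \<noteq> 1" by transfer (metis zero_neq_one)
  show "f * g = g * f"
    by transfer (rule ext, rule sum.reindex_bij_witness[where i = prod.swap and j = prod.swap],
        auto simp: ac_simps)
  show "(f + g) * h = f * h + g * h"
    by transfer (simp add: sum.distrib distrib_right case_prod_unfold)
  show "1 * f = f"
  proof (transfer, rule ext)
    fix f :: "('a \<Rightarrow>\<^sub>0 nat) \<Rightarrow> 'b" and M
    have "(\<Sum>(a, b)\<in>splits M. (if a = 0 then 1 else 0) * f b) = (\<Sum>(a :: 'a \<Rightarrow>\<^sub>0 nat, b)\<in>{(0, M)}. f b)"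
      by (rule sum.mono_neutral_cong_right) (auto split: if_splits)
    then show "(\<Sum>(a, b)\<in>splits M. (if a = 0 then 1 else 0) * f b) = f M" by simp
  qed
  show "f * g * h = f * (g * h)"
  proof (transfer, rule ext)
    fix f g h :: "('a \<Rightarrow>\<^sub>0 nat) \<Rightarrow> 'b" and M
    have "(\<Sum>(a, b)\<in>splits M. (\<Sum>(c, d)\<in>splits a. f c * g d) * h b)
        = (\<Sum>p\<in>splits M. \<Sum>q\<in>splits (fst p). f (fst q) * g (snd q) * h (snd p))"
      by (simp add: sum_distrib_right case_prod_unfold)
    also have "\<dots> = (\<Sum>(p, q)\<in>Sigma (splits M) (\<lambda>p. splits (fst p)). f (fst q) * g (snd q) * h (snd p))"
      by (subst sum.Sigma) auto
    also have "\<dots> = (\<Sum>(p, q)\<in>Sigma (splits M) (\<lambda>p. splits (snd p)). f (fst p) * (g (fst q) * h (snd q)))"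
      by (rule sum.reindex_bij_witness
          [where j = "\<lambda>((a, b), (c, d)). ((c, d + b), (d, b))"
             and i = "\<lambda>((a, b), (c, d)). ((a + c, d), (a, c))"]) (auto simp: ac_simps)
    also have "\<dots> = (\<Sum>p\<in>splits M. \<Sum>q\<in>splits (snd p). f (fst p) * (g (fst q) * h (snd q)))"
      by (subst sum.Sigma) auto
    also have "\<dots> = (\<Sum>(a, b)\<in>splits M. f a * (\<Sum>(c, d)\<in>splits b. g c * h d))"
      by (simp add: sum_distrib_left case_prod_unfold)
    finally show "(\<Sum>(a, b)\<in>splits M. (\<Sum>(c, d)\<in>splits a. f c * g d) * h b) = \<dots>" .
  qed
qed

end

definition var :: "'v \<Rightarrow> ('v, 'a::comm_ring_1) mps" where
  "var v = mps (\<lambda>M. if M = Poly_Mapping.single v 1 then 1 else 0)"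

definition const :: "'a \<Rightarrow> ('v, 'a::comm_ring_1) mps" where
  "const c = mps (\<lambda>M. if M = 0 then c else 0)"

definition msummable :: "('i \<Rightarrow> ('v, 'a::comm_ring_1) mps) \<Rightarrow> 'i set \<Rightarrow> bool" where
  "msummable f A \<longleftrightarrow> (\<forall>M. finite {i \<in> A. mcoeff (f i) M \<noteq> 0})"

text \<open>The sum of a possibly infinite family; meaningful if \<^const>\<open>msummable\<close> holds.\<close>

definition msum :: "('i \<Rightarrow> ('v, 'a::comm_ring_1) mps) \<Rightarrow> 'i set \<Rightarrow> ('v, 'a) mps" where
  "msum f A = mps (\<lambda>M. \<Sum>i | i \<in> A \<and> mcoeff (f i) M \<noteq> 0. mcoeff (f i) M)"

definition recip :: "('v, 'a::comm_ring_1) mps \<Rightarrow> ('v, 'a) mps" where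
  "recip f = (THE g. f * g = 1)"


section \<open>The auxiliary variable \<open>z\<close>\<close>

text \<open>
  Laurent polynomials in \<open>z\<close> are elements of \<^typ>\<open>int \<Rightarrow>\<^sub>0 rat\<close>. All the products occurring
  below, including those with infinitely many powers of \<open>z\<close> and \<open>1/z\<close>, live in
  the ring of power series (in \<open>t, t', s, s'\<close>) over the Laurent polynomials: each monomial in
  \<open>t, t', s, s'\<close> comes with finitely many powers of \<open>z\<close> only.
\<close>

type_synonym laurent = "int \<Rightarrow>\<^sub>0 rat"

definition scalar :: "rat \<Rightarrow> ('v, laurent) mps" where
  "scalar c = const (Poly_Mapping.single 0 c)"

definition zpow :: "int \<Rightarrow> ('v, laurent) mps" where
  "zpow k = const (Poly_Mapping.single k 1)"

abbreviation zvar :: "('v, laurent) mps" where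
  "zvar \<equiv> zpow 1"

definition zcoeff :: "int \<Rightarrow> ('v, laurent) mps \<Rightarrow> ('v, rat) mps" where
  "zcoeff k f = mps (\<lambda>M. Poly_Mapping.lookup (mcoeff f M) k)"

definition mexp :: "('v, laurent) mps \<Rightarrow> ('v, laurent) mps" where
  "mexp f = msum (\<lambda>n. scalar (1 / fact n) * f ^ n) UNIV"

text \<open>A sequence \<open>u\<^sub>1, u\<^sub>2, \<dots>\<close> is a function on \<^typ>\<open>nat\<close> whose value at \<open>0\<close> is ignored.\<close>

definition gamma :: "('v, laurent) mps \<Rightarrow> (nat \<Rightarrow> ('v, laurent) mps) \<Rightarrow> ('v, laurent) mps" where
  "gamma w u = mexp (msum (\<lambda>n. u n * w ^ n) {1..})"

definition zseq :: "nat \<Rightarrow> ('v, laurent) mps" where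
  "zseq k = scalar (1 / of_nat k) * zvar ^ k"

text \<open>
  Substitution of a series for each variable. Variables may be replaced by series with a
  nonzero constant term, so that this is meaningful only if \<^term>\<open>substitutable f \<sigma>\<close> holds.
\<close>

definition subst_term :: "('v, rat) mps \<Rightarrow> ('v \<Rightarrow> ('w, laurent) mps) \<Rightarrow> ('v \<Rightarrow>\<^sub>0 nat) \<Rightarrow> ('w, laurent) mps" where
  "subst_term f \<sigma> M = scalar (mcoeff f M) * (\<Prod>v \<in> Poly_Mapping.keys M. \<sigma> v ^ Poly_Mapping.lookup M v)"

definition substitutable :: "('v, rat) mps \<Rightarrow> ('v \<Rightarrow> ('w, laurent) mps) \<Rightarrow> bool" where
  "substitutable f \<sigma> \<longleftrightarrow> msummable (subst_term f \<sigma>) UNIV"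

definition subst :: "('v, rat) mps \<Rightarrow> ('v \<Rightarrow> ('w, laurent) mps) \<Rightarrow> ('w, laurent) mps" where
  "subst f \<sigma> = msum (subst_term f \<sigma>) UNIV"


section \<open>Schur functions\<close>

text \<open>A partition \<open>\<lambda>\<^sub>1 \<ge> \<lambda>\<^sub>2 \<ge> \<dots>\<close> is the function \<open>l\<close> with \<open>l i = \<lambda>\<^sub>i\<^sub>+\<^sub>1\<close>.\<close>

definition partitions :: "(nat \<Rightarrow> nat) set" where
  "partitions = {l. antimono l \<and> finite {i. l i \<noteq> 0}}"

definition num_parts :: "(nat \<Rightarrow> nat) \<Rightarrow> nat" where
  "num_parts l = card {i. l i \<noteq> 0}"

text \<open>
  \<open>hfun u n\<close> is the complete symmetric function \<open>h\<^sub>n\<close>, with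
  \<open>\<Sum>\<^sub>n h\<^sub>n z\<^sup>n = exp (\<Sum>\<^sub>k u\<^sub>k z\<^sup>k)\<close> where \<open>u\<^sub>k = p\<^sub>k / k\<close>; it vanishes for \<open>n < 0\<close>.
  \<open>schur\<close> is the Jacobi--Trudi determinant. For \<open>u\<^sub>k = (x\<^sub>1\<^sup>k + \<dots> + x\<^sub>n\<^sup>k) / k\<close> it is the quotient of
  alternants defining the Schur polynomial: see \<open>schur_bialternant\<close> below.
\<close>

definition hfun :: "(nat \<Rightarrow> ('v, laurent) mps) \<Rightarrow> int \<Rightarrow> ('v, rat) mps" where
  "hfun u n = zcoeff n (gamma zvar u)"

definition schur :: "(nat \<Rightarrow> ('v, laurent) mps) \<Rightarrow> (nat \<Rightarrow> nat) \<Rightarrow> ('v, rat) mps" where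
  "schur u l = det (mat (num_parts l) (num_parts l) (\<lambda>(i, j). hfun u (int (l i) - int i + int j)))"


section \<open>The Schur measure\<close>

datatype tvar = T nat | T' nat

abbreviation schur_x :: "(nat \<Rightarrow> nat) \<Rightarrow> (tvar, rat) mps" where
  "schur_x \<equiv> schur (\<lambda>k. var (T k))"

abbreviation schur_y :: "(nat \<Rightarrow> nat) \<Rightarrow> (tvar, rat) mps" where
  "schur_y \<equiv> schur (\<lambda>k. var (T' k))"

definition Z :: "(tvar, rat) mps" where
  "Z = msum (\<lambda>l. schur_x l * schur_y l) partitions"

definition schur_weight :: "(nat \<Rightarrow> nat) \<Rightarrow> (tvar, rat) mps" where
  "schur_weight l = recip Z * (schur_x l * schur_y l)"

definition schur_measure :: "(nat \<Rightarrow> nat) set \<Rightarrow> (tvar, rat) mps" where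
  "schur_measure A = msum schur_weight A"

definition half_ints :: "rat set" where
  "half_ints = range (\<lambda>k::int. of_int k + 1 / 2)"

definition maya :: "(nat \<Rightarrow> nat) \<Rightarrow> rat set" where
  "maya l = {of_nat (l i) - of_nat (i + 1) + 1 / 2 | i. True}"

definition rho :: "rat set \<Rightarrow> (tvar, rat) mps" where
  "rho X = schur_measure {l \<in> partitions. X \<subseteq> maya l}"

definition shift :: "rat set \<Rightarrow> int \<Rightarrow> rat set" where
  "shift X n = (\<lambda>a. a - of_int n) ` X"


section \<open>The Toda lattice hierarchy\<close>

text \<open>\<open>Base\<close> embeds the variables \<open>t\<^sub>k, t'\<^sub>k\<close>; \<open>Shift\<close> gives the independent \<open>s\<^sub>k, s'\<^sub>k\<close>.\<close>

datatype hvar = Base tvar | Shift tvar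

definition args :: "(nat \<Rightarrow> ('v, laurent) mps) \<Rightarrow> (nat \<Rightarrow> ('v, laurent) mps) \<Rightarrow> tvar \<Rightarrow> ('v, laurent) mps" where
  "args a b v = (case v of T k \<Rightarrow> a k | T' k \<Rightarrow> b k)"

text \<open>
  The substitutions of \<open>z\<close>-dependent arguments with nonzero constant term are required to be meaningful.
\<close>

definition toda_tau :: "(int \<Rightarrow> (tvar, rat) mps) \<Rightarrow> bool" where
  "toda_tau \<tau> \<longleftrightarrow> (\<forall>m l.
     let t = \<lambda>k. var (Base (T k)); t' = \<lambda>k. var (Base (T' k));
         s = \<lambda>k. var (Shift (T k)); s' = \<lambda>k. var (Shift (T' k));
         L1 = args (\<lambda>k. t k + s k) (\<lambda>k. t' k + s' k + zseq k);
         L2 = args (\<lambda>k. t k - s k) (\<lambda>k. t' k - s' k - zseq k);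
         R1 = args (\<lambda>k. t k + s k - zseq k) (\<lambda>k. t' k + s' k);
         R2 = args (\<lambda>k. t k - s k + zseq k) (\<lambda>k. t' k - s' k)
     in substitutable (\<tau> (m + 1)) L1 \<and> substitutable (\<tau> l) L2 \<and>
        substitutable (\<tau> m) R1 \<and> substitutable (\<tau> (l + 1)) R2 \<and>
        zcoeff (l - m) (gamma (zpow (- 1)) (\<lambda>k. - 2 * s' k) * subst (\<tau> (m + 1)) L1 * subst (\<tau> l) L2)
        = zcoeff (m - l) (gamma (zpow (- 1)) (\<lambda>k. 2 * s k) * subst (\<tau> m) R1 * subst (\<tau> (l + 1)) R2))"


section \<open>Reciprocals, and Schur functions as quotients of alternants\<close>


lemma mcoeff_0 [simp]: "mcoeff 0 M = 0" by (simp add: zero_mps.rep_eq)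
lemma mcoeff_1: "mcoeff 1 M = (if M = 0 then 1 else 0)" by (simp add: one_mps.rep_eq)
lemma mcoeff_add [simp]: "mcoeff (f + g) M = mcoeff f M + mcoeff g M" by (simp add: plus_mps.rep_eq)
lemma mcoeff_minus [simp]: "mcoeff (f - g) M = mcoeff f M - mcoeff g M" by (simp add: minus_mps.rep_eq)
lemma mcoeff_uminus [simp]: "mcoeff (- f) M = - mcoeff f M" by (simp add: uminus_mps.rep_eq)
lemma mcoeff_mult: "mcoeff (f * g) M = (\<Sum>(a, b)\<in>splits M. mcoeff f a * mcoeff g b)" unfolding times_mps.rep_eq by (rule refl)
lemma mcoeff_sum: "mcoeff (sum f A) M = (\<Sum>i\<in>A. mcoeff (f i) M)"
  by (induction A rule: infinite_finite_induct) auto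

lemma mcoeff_const_mult [simp]:
  fixes f :: "('v, 'a::comm_ring_1) mps"
  shows "mcoeff (const c * f) M = c * mcoeff f M"
proof -
  have "(\<Sum>(a, b)\<in>splits M. mcoeff (const c) a * mcoeff f b) = (\<Sum>(a :: 'v \<Rightarrow>\<^sub>0 nat, b)\<in>{(0, M)}. c * mcoeff f b)"
    by (rule sum.mono_neutral_cong_right) (auto simp: const_def split: if_splits)
  then show ?thesis by (simp add: mcoeff_mult)
qed

lemma const_0 [simp]: "const 0 = 0" and const_1 [simp]: "const 1 = 1"
  by (auto intro!: mps_eqI simp: const_def mcoeff_1)
lemma const_mult: "const (a * b) = const a * const b"
  by (auto intro!: mps_eqI simp: const_def[of b] const_def[of "a * b"])
lemma zpow_add: "zpow (a + b) = zpow a * zpow b"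
  by (simp add: zpow_def const_mult[symmetric] mult_single)
lemma zpow_0 [simp]: "zpow 0 = 1" by (simp add: zpow_def)
lemma zpow_power: "zpow 1 ^ n = zpow (int n)"
  by (induction n) (simp_all add: zpow_add)
lemma scalar_mult: "scalar (a * b) = scalar a * scalar b"
  by (simp add: scalar_def const_mult[symmetric] mult_single)
lemma scalar_1 [simp]: "scalar 1 = 1" by (simp add: scalar_def)
lemma scalar_add: "scalar (a + b) = scalar a + scalar b"
  by (auto intro!: mps_eqI simp: scalar_def const_def single_add)
lemma scalar_of_nat: "scalar (of_nat n) = of_nat n"
proof (induction n)
  case 0 then show ?case by (simp add: scalar_def)
next
  case (Suc n)
  then show ?case by (simp add: scalar_add)
qed

definition mdeg :: "('v \<Rightarrow>\<^sub>0 nat) \<Rightarrow> nat" where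
  "mdeg M = (\<Sum>v\<in>Poly_Mapping.keys M. Poly_Mapping.lookup M v)"

lemma mdeg_superset: "finite A \<Longrightarrow> Poly_Mapping.keys M \<subseteq> A \<Longrightarrow> mdeg M = (\<Sum>v\<in>A. Poly_Mapping.lookup M v)"
  unfolding mdeg_def by (rule sum.mono_neutral_left) (auto simp: in_keys_iff)

lemma mdeg_0 [simp]: "mdeg 0 = 0" by (simp add: mdeg_def)
lemma mdeg_single [simp]: "mdeg (Poly_Mapping.single v n) = n" by (simp add: mdeg_def)
lemma mdeg_eq_0: "mdeg M = 0 \<longleftrightarrow> M = 0"
  by (auto simp: mdeg_def in_keys_iff intro!: poly_mapping_eqI)
lemma mdeg_add: "mdeg (a + b) = mdeg a + mdeg b"
proof -
  let ?A = "Poly_Mapping.keys a \<union> Poly_Mapping.keys b"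
  have "mdeg (a + b) = (\<Sum>v\<in>?A. Poly_Mapping.lookup (a + b) v)"
    by (rule mdeg_superset) (auto simp: in_keys_iff lookup_add)
  also have "\<dots> = mdeg a + mdeg b"
    by (simp add: lookup_add sum.distrib mdeg_superset[of ?A])
  finally show ?thesis .
qed

lemma mcoeff_msum:
  assumes "finite B" "B \<subseteq> A" "\<And>i. i \<in> A - B \<Longrightarrow> mcoeff (f i) M = 0"
  shows "mcoeff (msum f A) M = (\<Sum>i\<in>B. mcoeff (f i) M)"
  unfolding msum_def mcoeff_mps by (rule sum.mono_neutral_left) (use assms in auto)

definition homog :: "nat \<Rightarrow> ('v, laurent) mps \<Rightarrow> bool" where
  "homog n f \<longleftrightarrow> (\<forall>M. mcoeff f M \<noteq> 0 \<longrightarrow> mdeg M = n)"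

definition euler :: "('v, laurent) mps \<Rightarrow> ('v, laurent) mps" where
  "euler f = mps (\<lambda>M. of_nat (mdeg M) * mcoeff f M)"

lemma mcoeff_euler [simp]: "mcoeff (euler f) M = of_nat (mdeg M) * mcoeff f M"
  by (simp add: euler_def)

lemma ring_aux: "(x + y) * (p * q) = (x * p) * q + p * (y * q)" for x y p q :: "'a::comm_ring_1"
  by (simp add: algebra_simps)

lemma euler_mult:
  fixes f g :: "('a, laurent) mps"
  shows "euler (f * g) = euler f * g + f * euler g"
proof (rule mps_eqI)
  fix M
  have "of_nat (mdeg M) * (\<Sum>(a, b)\<in>splits M. mcoeff f a * mcoeff g b)
      = (\<Sum>(a, b)\<in>splits M. (of_nat (mdeg a) * mcoeff f a) * mcoeff g b + mcoeff f a * (of_nat (mdeg b) * mcoeff g b))"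
    unfolding sum_distrib_left
  proof (rule sum.cong[OF refl], clarify)
    fix a b :: "'a \<Rightarrow>\<^sub>0 nat"
    show "of_nat (mdeg (a + b)) * (mcoeff f a * mcoeff g b)
        = (of_nat (mdeg a) * mcoeff f a) * mcoeff g b + mcoeff f a * (of_nat (mdeg b) * mcoeff g b)"
      unfolding mdeg_add of_nat_add by (rule ring_aux)
  qed
  also have "\<dots> = mcoeff (euler f * g) M + mcoeff (f * euler g) M"
    unfolding mcoeff_mult mcoeff_euler case_prod_unfold by (rule sum.distrib)
  finally show "mcoeff (euler (f * g)) M = mcoeff (euler f * g + f * euler g) M"
    unfolding mcoeff_euler mcoeff_add mcoeff_mult[of f g] .
qed

lemma euler_add: "euler (f + g) = euler f + euler g"
  by (rule mps_eqI) (simp add: algebra_simps)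
lemma euler_diff: "euler (f - g) = euler f - euler g"
  by (rule mps_eqI) (simp add: algebra_simps)
lemma euler_const [simp]: "euler (const c) = 0"
  by (rule mps_eqI) (simp add: const_def)
lemma euler_1 [simp]: "euler 1 = 0" by (metis const_1 euler_const)
lemma euler_scalar_mult: "euler (scalar c * f) = scalar c * euler f"
  by (simp add: scalar_def euler_mult)
lemma euler_power: "euler (f ^ Suc n) = of_nat (Suc n) * f ^ n * euler f"
proof (induction n)
  case (Suc n)
  have "euler (f ^ Suc (Suc n)) = euler f * f ^ Suc n + f * (of_nat (Suc n) * f ^ n * euler f)"
    by (simp only: power_Suc[of f "Suc n"] euler_mult Suc)
  also have "\<dots> = (1 + of_nat (Suc n)) * f ^ Suc n * euler f"
    by (simp add: ring_distribs ac_simps del: of_nat_Suc)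
  finally show ?case by (simp only: of_nat_Suc)
qed simp

lemma euler_eq_0: assumes "euler f = 0" shows "f = const (mcoeff f 0)"
proof (rule mps_eqI)
  fix M
  have "of_nat (mdeg M) * mcoeff f M = 0" using assms by (metis mcoeff_euler mcoeff_0)
  then show "mcoeff f M = mcoeff (const (mcoeff f 0)) M"
    by (auto simp: const_def mdeg_eq_0)
qed

lemma mcoeff_mult_0:
  fixes f g :: "('v, 'a::comm_ring_1) mps"
  shows "mcoeff (f * g) 0 = mcoeff f 0 * mcoeff g 0"
proof -
  have "a = 0 \<and> b = 0" if "a + b = 0" for a b :: "'v \<Rightarrow>\<^sub>0 nat"
  proof -
    have "mdeg (a + b) = 0" using that by simp
    then show ?thesis by (simp only: mdeg_add add_is_0 mdeg_eq_0 simp_thms)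
  qed
  then have "splits (0 :: 'v \<Rightarrow>\<^sub>0 nat) \<subseteq> {(0, 0)}" by blast
  moreover have "(0, 0) \<in> splits (0 :: 'v \<Rightarrow>\<^sub>0 nat)" by simp
  ultimately have "splits (0 :: 'v \<Rightarrow>\<^sub>0 nat) = {(0, 0)}" by blast
  then show ?thesis unfolding mcoeff_mult by simp
qed

lemma mcoeff_power_low: fixes f :: "('v, 'a::comm_ring_1) mps" assumes "mcoeff f 0 = 0" shows "mdeg M < n \<Longrightarrow> mcoeff (f ^ n) M = 0"
proof (induction n arbitrary: M)
  case (Suc n)
  have "mcoeff f a * mcoeff (f ^ n) b = 0" if "(a, b) \<in> splits M" for a b
  proof (cases "a = 0")
    case False
    then have "mdeg b < n" using Suc.prems that mdeg_eq_0[of a] by (auto simp: mdeg_add)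
    then show ?thesis using Suc.IH by simp
  qed (use assms in auto)
  then show ?case by (auto simp: mcoeff_mult intro!: sum.neutral)
qed simp

lemma mcoeff_mexp: assumes "mcoeff f 0 = 0" "mdeg M \<le> K"
  shows "mcoeff (mexp f) M = mcoeff (\<Sum>n\<le>K. scalar (1 / fact n) * f ^ n) M"
  unfolding mexp_def
  by (subst mcoeff_msum[of "{..K}"]) (use assms in \<open>auto simp: mcoeff_sum scalar_def mcoeff_power_low\<close>)

lemma mcoeff_mult_cong:
  assumes "\<And>b. mdeg b \<le> mdeg M \<Longrightarrow> mcoeff g b = mcoeff h b"
  shows "mcoeff (f * g) M = mcoeff (f * h) M"
  unfolding mcoeff_mult by (rule sum.cong) (use assms in \<open>auto simp: mdeg_add\<close>)

lemma mexp_0: assumes "mcoeff f 0 = 0" shows "mcoeff (mexp f) 0 = 1"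
  by (simp add: mcoeff_mexp[OF assms, of 0 0] mcoeff_1)

lemma euler_sum: "euler (sum f A) = (\<Sum>i\<in>A. euler (f i))"
  by (rule mps_eqI) (simp add: mcoeff_sum sum_distrib_left)

lemma euler_mexp:
  fixes f :: "('a, laurent) mps"
  assumes "mcoeff f 0 = 0"
  shows "euler (mexp f) = euler f * mexp f"
proof (rule mps_eqI)
  fix M :: "'a \<Rightarrow>\<^sub>0 nat"
  let ?E = "\<lambda>K. \<Sum>n\<le>K. scalar (1 / fact n) * f ^ n"
  have sc: "scalar (1 / fact (Suc n)) * of_nat (Suc n) = (scalar (1 / fact n) :: ('a, laurent) mps)" for n
  proof -
    have "(1 / fact (Suc n) * of_nat (Suc n) :: rat) = 1 / fact n"
      unfolding fact_Suc by (simp del: of_nat_Suc)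
    then show ?thesis by (metis scalar_mult scalar_of_nat)
  qed
  have tm: "euler (scalar (1 / fact (Suc n)) * f ^ Suc n) = euler f * (scalar (1 / fact n) * f ^ n)" for n
  proof -
    have "euler (scalar (1 / fact (Suc n)) * f ^ Suc n) = (scalar (1 / fact (Suc n)) * of_nat (Suc n)) * f ^ n * euler f"
      unfolding euler_scalar_mult euler_power by (simp only: mult.assoc)
    then show ?thesis unfolding sc by (simp only: ac_simps)
  qed
  have t0: "euler (scalar (1 / fact 0) * f ^ 0) = 0"
    by simp
  have e: "euler (?E (Suc K)) = euler f * ?E K" for K
    unfolding sum.atMost_Suc_shift euler_add euler_sum tm t0 sum_distrib_left by simp
  let ?K = "mdeg M"
  have "mcoeff (euler (mexp f)) M = mcoeff (euler (?E (Suc ?K))) M"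
    unfolding mcoeff_euler by (subst mcoeff_mexp[OF assms, of _ "Suc ?K"]) auto
  also have "\<dots> = mcoeff (euler f * ?E ?K) M" by (simp only: e)
  also have "\<dots> = mcoeff (euler f * mexp f) M"
    by (rule mcoeff_mult_cong) (simp add: mcoeff_mexp[OF assms, of _ ?K])
  finally show "mcoeff (euler (mexp f)) M = mcoeff (euler f * mexp f) M" .
qed

definition geo :: "('v, 'a::comm_ring_1) mps \<Rightarrow> ('v, 'a) mps" where
  "geo y = msum (\<lambda>n. y ^ n) UNIV"

lemma mcoeff_geo: assumes "mcoeff f 0 = 0" "mdeg M \<le> K"
  shows "mcoeff (geo f) M = mcoeff (\<Sum>n\<le>K. f ^ n) M"
  unfolding geo_def
  by (subst mcoeff_msum[of "{..K}"]) (use assms in \<open>auto simp: mcoeff_sum mcoeff_power_low\<close>)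

lemma geo:
  fixes f :: "('a, 'b::comm_ring_1) mps"
  assumes "mcoeff f 0 = 0"
  shows "geo f * (1 - f) = 1"
proof (rule mps_eqI)
  fix M :: "'a \<Rightarrow>\<^sub>0 nat"
  let ?E = "\<Sum>n\<le>mdeg M. f ^ n"
  have "mcoeff ((1 - f) * geo f) M = mcoeff ((1 - f) * ?E) M"
    by (rule mcoeff_mult_cong) (rule mcoeff_geo[OF assms])
  also have "(1 - f) * ?E = 1 - f ^ Suc (mdeg M)"
    using sum_gp_basic[of f "mdeg M"] by simp
  also have "mcoeff \<dots> M = mcoeff 1 M" by (simp del: power_Suc add: mcoeff_power_low[OF assms])
  finally show "mcoeff (geo f * (1 - f)) M = mcoeff 1 M" by (simp add: mult.commute)
qed


lemma recip:
  assumes "mcoeff f 0 = 1"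
  shows "f * recip f = 1"
proof -
  have "mcoeff (1 - f) 0 = 0" using assms by (simp add: mcoeff_1)
  from geo[OF this] have g: "f * geo (1 - f) = 1" by (simp add: mult.commute)
  have "g = geo (1 - f)" if "f * g = 1" for g
  proof -
    have "g = g * (f * geo (1 - f))" by (simp only: \<open>f * geo (1 - f) = 1\<close> mult_1_right)
    also have "\<dots> = (f * g) * geo (1 - f)" by (simp only: ac_simps)
    finally show ?thesis by (simp only: that mult_1_left)
  qed
  with g show ?thesis unfolding recip_def by (rule theI)
qed

lemma homog_mult: assumes "homog m f" "homog n g" shows "homog (m + n) (f * g)"
  unfolding homog_def
proof (intro allI impI)
  fix M assume "mcoeff (f * g) M \<noteq> 0"
  then obtain a b where "(a, b) \<in> splits M" "mcoeff f a * mcoeff g b \<noteq> 0"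
    unfolding mcoeff_mult by (metis (no_types, lifting) case_prod_beta' prod.exhaust_sel sum.not_neutral_contains_not_neutral)
  then have "mcoeff f a \<noteq> 0" "mcoeff g b \<noteq> 0" "M = a + b" by auto
  then show "mdeg M = m + n" using assms by (simp add: homog_def mdeg_add)
qed

lemma homog_const: "homog 0 (const c)"
  by (simp add: homog_def const_def)
lemma homog_var: "homog 1 (var v)"
  by (auto simp: homog_def var_def split: if_splits)
lemma homog_power: "homog m f \<Longrightarrow> homog (n * m) (f ^ n)"
proof (induction n)
  case 0
  show ?case using homog_const[of 1] by simp
next
  case (Suc n)
  then show ?case using homog_mult[of m f "n * m" "f ^ n"] by simp
qed
lemma homog_sum: "(\<And>i. i \<in> A \<Longrightarrow> homog n (f i)) \<Longrightarrow> homog n (sum f A)"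
  unfolding homog_def mcoeff_sum by (metis (no_types, lifting) sum.not_neutral_contains_not_neutral)

lemma mcoeff_msum_homog:
  assumes "\<And>n. n \<in> A \<Longrightarrow> homog n (f n)"
  shows "mcoeff (msum f A) M = (if mdeg M \<in> A then mcoeff (f (mdeg M)) M else 0)"
proof -
  have "mcoeff (msum f A) M = (\<Sum>i\<in>A \<inter> {mdeg M}. mcoeff (f i) M)"
    by (rule mcoeff_msum) (use assms in \<open>auto simp: homog_def\<close>)
  then show ?thesis by (auto simp: Int_insert_right)
qed

lemma euler_homog: assumes "homog n f" shows "euler f = of_nat n * f"
proof (rule mps_eqI)
  fix M
  have "of_nat n * f = const (of_nat n) * f"
    by (simp add: scalar_of_nat[symmetric] scalar_def single_of_nat)
  then show "mcoeff (euler f) M = mcoeff (of_nat n * f) M"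
    using assms by (cases "mcoeff f M = 0") (auto simp: homog_def)
qed

abbreviation xz :: "nat \<Rightarrow> (nat, laurent) mps" where "xz i \<equiv> var i * zvar"

definition linprod :: "nat set \<Rightarrow> (nat, laurent) mps" where "linprod J = (\<Prod>i\<in>J. 1 - xz i)"

lemma homog_xz: "homog 1 (xz i)"
  using homog_mult[OF homog_var homog_const[of "Poly_Mapping.single 1 1"], of i] by (simp add: zpow_def)

lemma xz_0: "mcoeff (xz i) 0 = 0"
  using homog_xz[of i] by (auto simp: homog_def)

lemma euler_xz: "euler (xz i) = xz i"
  using euler_homog[OF homog_xz[of i]] by simp

lemma mcoeff_geo_xz: "mcoeff (geo (xz i)) M = mcoeff (xz i ^ mdeg M) M"
  unfolding geo_def
  by (subst mcoeff_msum_homog) (use homog_power[OF homog_xz] in simp_all)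

definition psums :: "nat \<Rightarrow> nat \<Rightarrow> (nat, laurent) mps" where
  "psums n k = scalar (1 / of_nat k) * (\<Sum>i<n. var i ^ k)"

lemma psums_term: "psums n k * zvar ^ k = scalar (1 / of_nat k) * (\<Sum>i<n. xz i ^ k)"
  by (simp add: psums_def power_mult_distrib sum_distrib_right mult.assoc)

lemma homog_psums_term: "homog k (psums n k * zvar ^ k)"
proof -
  have "homog k (\<Sum>i<n. xz i ^ k)"
    by (rule homog_sum) (use homog_power[OF homog_xz, of k] in simp)
  then show ?thesis
    unfolding psums_term scalar_def using homog_mult[OF homog_const] by fastforce
qed

definition psums_log :: "nat \<Rightarrow> (nat, laurent) mps" where
  "psums_log n = msum (\<lambda>k. psums n k * zvar ^ k) {1..}"

lemma mcoeff_psums_log: "mcoeff (psums_log n) M = (if mdeg M = 0 then 0 else mcoeff (psums n (mdeg M) * zvar ^ mdeg M) M)"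
  unfolding psums_log_def by (subst mcoeff_msum_homog[OF homog_psums_term]) auto

lemma euler_psums_log: "euler (psums_log n) = (\<Sum>i<n. geo (xz i) - 1)"
proof (rule mps_eqI)
  fix M :: "nat \<Rightarrow>\<^sub>0 nat"
  show "mcoeff (euler (psums_log n)) M = mcoeff (\<Sum>i<n. geo (xz i) - 1) M"
  proof (cases "mdeg M = 0")
    case True
    then show ?thesis by (simp add: mcoeff_sum mcoeff_geo_xz mcoeff_psums_log)
  next
    case False
    then have "M \<noteq> 0" by auto
    let ?k = "mdeg M"
    have "mcoeff (euler (psums_log n)) M = of_nat ?k * mcoeff (psums n ?k * zvar ^ ?k) M"
      using False by (simp add: mcoeff_psums_log)
    also have "\<dots> = (of_nat ?k * Poly_Mapping.single 0 (1 / of_nat ?k)) * mcoeff (\<Sum>i<n. xz i ^ ?k) M"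
      unfolding psums_term scalar_def mcoeff_const_mult by (simp only: mult.assoc)
    also have "of_nat ?k * Poly_Mapping.single 0 (1 / of_nat ?k) = (1 :: laurent)"
      using False by (simp flip: single_of_nat single_one add: mult_single)
    finally show ?thesis using \<open>M \<noteq> 0\<close> by (simp add: mcoeff_sum mcoeff_geo_xz mcoeff_1)
  qed
qed

lemma lin_insert: "finite J \<Longrightarrow> i \<notin> J \<Longrightarrow> linprod (insert i J) = (1 - xz i) * linprod J"
  by (simp add: linprod_def)

lemma geo_xz: "geo (xz i) * (1 - xz i) = 1"
  by (rule geo[OF xz_0])

lemma euler_lin: "finite J \<Longrightarrow> (\<Sum>i\<in>J. geo (xz i) - 1) * linprod J = - euler (linprod J)"
proof (induction J rule: finite_induct)
  case empty
  show ?case by (simp add: linprod_def)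
next
  case (insert i J)
  let ?S = "\<Sum>i\<in>J. geo (xz i) - 1"
  have "(\<Sum>i\<in>insert i J. geo (xz i) - 1) * linprod (insert i J)
      = (geo (xz i) * (1 - xz i) - (1 - xz i)) * linprod J + (1 - xz i) * (?S * linprod J)"
    using insert.hyps by (simp add: lin_insert algebra_simps)
  also have "\<dots> = xz i * linprod J - (1 - xz i) * euler (linprod J)"
    unfolding insert.IH geo_xz by simp
  also have "\<dots> = - euler (linprod (insert i J))"
    unfolding lin_insert[OF insert.hyps] euler_mult[of "1 - xz i"] euler_diff euler_xz euler_1 by simp
  finally show ?case .
qed

lemma lin_0: "finite J \<Longrightarrow> mcoeff (linprod J) 0 = 1"
proof (induction J rule: finite_induct)
  case (insert i J)
  then show ?case
    unfolding lin_insert[OF insert.hyps] mcoeff_mult_0[of "1 - xz i"] mcoeff_minus xz_0 by (simp add: mcoeff_1)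
qed (simp add: linprod_def mcoeff_1)

definition psums_gamma :: "nat \<Rightarrow> (nat, laurent) mps" where "psums_gamma n = gamma zvar (psums n)"

lemma psums_gamma_lin: "psums_gamma n * linprod {..<n} = 1"
proof -
  have psums_gamma: "psums_gamma n = mexp (psums_log n)" by (simp add: psums_gamma_def gamma_def psums_log_def)
  have 0: "mcoeff (psums_log n) 0 = 0" by (simp add: mcoeff_psums_log)
  have "euler (psums_gamma n * linprod {..<n}) = psums_gamma n * (euler (psums_log n) * linprod {..<n} + euler (linprod {..<n}))"
    unfolding euler_mult psums_gamma euler_mexp[OF 0] by (simp add: algebra_simps)
  also have "\<dots> = 0"
    unfolding euler_psums_log euler_lin[OF finite_lessThan] by simp
  finally have "psums_gamma n * linprod {..<n} = const (mcoeff (psums_gamma n * linprod {..<n}) 0)"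
    by (rule euler_eq_0)
  also have "mcoeff (psums_gamma n * linprod {..<n}) 0 = 1"
    by (simp add: mcoeff_mult_0 psums_gamma mexp_0[OF 0] lin_0)
  finally show ?thesis by simp
qed

lemma psums_gamma_geo: "psums_gamma n = (\<Prod>i<n. geo (xz i))"
proof -
  have "(\<Prod>i<n. geo (xz i)) * linprod {..<n} = 1"
    unfolding linprod_def prod.distrib[symmetric] geo_xz by simp
  then have "psums_gamma n * linprod {..<n} * (\<Prod>i<n. geo (xz i)) = psums_gamma n"
    by (simp add: ac_simps)
  then show ?thesis by (simp add: psums_gamma_lin)
qed


lemma lookup_single_mult:
  "Poly_Mapping.lookup (Poly_Mapping.single r c * p) k = c * Poly_Mapping.lookup (p :: laurent) (k - r)"
proof -
  have "(k = r + q) = (q = k - r)" for q by auto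
  then show ?thesis
    by (simp add: lookup_mult lookup_single when_mult)
qed

lemma mcoeff_zcoeff [simp]: "mcoeff (zcoeff k f) M = Poly_Mapping.lookup (mcoeff f M) k"
  by (simp add: zcoeff_def)

lemma zcoeff_diff: "zcoeff k (f - g) = zcoeff k f - zcoeff k g"
  by (rule mps_eqI) (simp add: lookup_minus)

lemma zcoeff_1: "zcoeff k 1 = (if k = 0 then 1 else 0)"
  by (rule mps_eqI) (auto simp: mcoeff_1 lookup_one when_def)

lemma zcoeff_zpow_mult: "zcoeff k (zpow r * f) = zcoeff (k - r) f"
  by (rule mps_eqI) (simp add: zpow_def lookup_single_mult)

lemma lookup_sum': "Poly_Mapping.lookup (sum f A) k = (\<Sum>i\<in>A. Poly_Mapping.lookup (f i) k)"
  by (induction A rule: infinite_finite_induct) (auto simp: lookup_add)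

lemma zcoeff_var_mult: "zcoeff k (var i * f) = var i * zcoeff k f"
  by (rule mps_eqI)
    (auto simp: mcoeff_mult lookup_sum' var_def intro!: sum.cong)

lemma zcoeff_lin_mult: "zcoeff k (f * (1 - xz i)) = zcoeff k f - var i * zcoeff (k - 1) f"
proof -
  have "f * (1 - xz i) = f - var i * (zvar * f)" by (simp add: algebra_simps)
  then show ?thesis by (simp add: zcoeff_diff zcoeff_var_mult zcoeff_zpow_mult)
qed

lemma zcoeff_mult_lin:
  "finite J \<Longrightarrow> \<exists>e. \<forall>f k. zcoeff k (f * linprod J) = (\<Sum>r\<le>card J. e r * zcoeff (k - int r) f)"
proof (induction J rule: finite_induct)
  case empty
  show ?case by (rule exI[of _ "\<lambda>_. 1"]) (simp add: linprod_def)
next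
  case (insert i J)
  then obtain e where e: "\<And>f k. zcoeff k (f * linprod J) = (\<Sum>r\<le>card J. e r * zcoeff (k - int r) f)"
    by blast
  let ?e = "\<lambda>r. (if r \<le> card J then e r else 0) - (case r of 0 \<Rightarrow> 0 | Suc q \<Rightarrow> var i * e q)"
  have "zcoeff k (f * linprod (insert i J)) = (\<Sum>r\<le>card (insert i J). ?e r * zcoeff (k - int r) f)" for f k
  proof -
    have "zcoeff k (f * linprod (insert i J)) = zcoeff k ((f * (1 - xz i)) * linprod J)"
      by (simp add: lin_insert insert.hyps mult.assoc)
    also have "\<dots> = (\<Sum>r\<le>card J. e r * (zcoeff (k - int r) f - var i * zcoeff (k - int r - 1) f))"
      unfolding e zcoeff_lin_mult ..
    also have "\<dots> = (\<Sum>r\<le>card J. e r * zcoeff (k - int r) f)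
        - (\<Sum>r\<le>card J. var i * e r * zcoeff (k - int (Suc r)) f)"
      unfolding right_diff_distrib sum_subtractf
      by (intro arg_cong2[where f = "(-)"] sum.cong refl) (simp add: algebra_simps)
    also have "(\<Sum>r\<le>card J. e r * zcoeff (k - int r) f)
        = (\<Sum>r\<le>Suc (card J). (if r \<le> card J then e r else 0) * zcoeff (k - int r) f)"
      by (simp add: if_distrib)
    also have "(\<Sum>r\<le>card J. var i * e r * zcoeff (k - int (Suc r)) f)
        = (\<Sum>r\<le>Suc (card J). (case r of 0 \<Rightarrow> 0 | Suc q \<Rightarrow> var i * e q) * zcoeff (k - int r) f)"
      unfolding sum.atMost_Suc_shift by simp
    also have "(\<Sum>r\<le>Suc (card J). (if r \<le> card J then e r else 0) * zcoeff (k - int r) f) - \<dots>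
        = (\<Sum>r\<le>Suc (card J). ?e r * zcoeff (k - int r) f)"
      unfolding left_diff_distrib sum_subtractf ..
    finally show ?thesis using insert.hyps by simp
  qed
  then show ?case by (intro exI[of _ ?e] allI)
qed

definition zhom :: "('v, laurent) mps \<Rightarrow> bool" where
  "zhom f \<longleftrightarrow> (\<forall>M k. int (mdeg M) \<noteq> k \<longrightarrow> Poly_Mapping.lookup (mcoeff f M) k = 0)"

lemma zhom_single: "zhom f \<Longrightarrow> mcoeff f M = Poly_Mapping.single (int (mdeg M)) (Poly_Mapping.lookup (mcoeff f M) (int (mdeg M)))"
  by (rule poly_mapping_eqI) (auto simp: zhom_def lookup_single when_def)

lemma zhom_mult:
  fixes f g :: "('v, laurent) mps"
  assumes "zhom f" "zhom g"
  shows "zhom (f * g)"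
  unfolding zhom_def
proof (intro allI impI)
  fix M :: "'v \<Rightarrow>\<^sub>0 nat" and k assume k: "int (mdeg M) \<noteq> k"
  have "Poly_Mapping.lookup (mcoeff f a * mcoeff g b) k = 0" if "M = a + b" for a b :: "'v \<Rightarrow>\<^sub>0 nat"
  proof -
    have "Poly_Mapping.lookup (mcoeff g b) (k - int (mdeg a)) = 0"
      using assms(2) k that by (auto simp: zhom_def mdeg_add)
    then show ?thesis by (subst zhom_single[OF assms(1)]) (simp add: lookup_single_mult)
  qed
  then show "Poly_Mapping.lookup (mcoeff (f * g) M) k = 0"
    unfolding mcoeff_mult lookup_sum' by (intro sum.neutral) auto
qed

lemma zhom_1: "zhom 1"
  by (auto simp: zhom_def mcoeff_1 lookup_one when_def)
lemma zhom_prod: "(\<And>i. i \<in> A \<Longrightarrow> zhom (f i)) \<Longrightarrow> zhom (prod f A)"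
  by (induction A rule: infinite_finite_induct) (auto simp: zhom_1 zhom_mult)

lemma zhom_xz: "zhom (xz i)"
proof -
  have "mcoeff (xz i) M = Poly_Mapping.single 1 1 * mcoeff (var i) M" for M
    by (subst mult.commute) (simp add: zpow_def)
  then show ?thesis
    by (auto simp: zhom_def lookup_single_mult var_def lookup_one when_def)
qed

lemma zhom_geo: "zhom (geo (xz i))"
proof -
  have "zhom (xz i ^ n)" for n by (induction n) (simp_all add: zhom_1 zhom_mult zhom_xz)
  then show ?thesis by (simp add: zhom_def mcoeff_geo_xz)
qed

lemma zhom_psums_gamma: "zhom (psums_gamma n)"
  unfolding psums_gamma_geo by (rule zhom_prod) (rule zhom_geo)

lemma zcoeff_zhom_neg: "zhom f \<Longrightarrow> k < 0 \<Longrightarrow> zcoeff k f = 0"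
  by (rule mps_eqI) (simp add: zhom_def)

lemma zcoeff_geo: "zcoeff (int m) (geo (xz i)) = var i ^ m"
proof -
  have *: "zcoeff k (geo (xz i)) = var i * zcoeff (k - 1) (geo (xz i)) + (if k = 0 then 1 else 0)" for k
    using zcoeff_lin_mult[of k "geo (xz i)" i] unfolding geo_xz zcoeff_1 by (simp add: algebra_simps)
  show ?thesis
  proof (induction m)
    case 0
    show ?case using *[of 0] zcoeff_zhom_neg[OF zhom_geo, of "-1" i] by simp
  next
    case (Suc m)
    then show ?case using *[of "int (Suc m)"] by simp
  qed
qed

abbreviation hpsums :: "nat \<Rightarrow> int \<Rightarrow> (nat, rat) mps" where "hpsums n \<equiv> hfun (psums n)"

lemma hs_neg: "k < 0 \<Longrightarrow> hpsums n k = 0"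
  using zcoeff_zhom_neg[OF zhom_psums_gamma] by (simp add: hfun_def psums_gamma_def)

lemma hs_0: "hpsums n 0 = 1"
proof (rule mps_eqI)
  fix M :: "nat \<Rightarrow>\<^sub>0 nat"
  have "mcoeff (psums_gamma n) 0 * mcoeff (linprod {..<n}) 0 = 1"
    using psums_gamma_lin[of n] mcoeff_mult_0[of "psums_gamma n" "linprod {..<n}"] by (simp add: mcoeff_1)
  then have "mcoeff (psums_gamma n) 0 = 1" by (simp add: lin_0)
  moreover have "Poly_Mapping.lookup (mcoeff (psums_gamma n) M) 0 = 0" if "M \<noteq> 0"
    using zhom_psums_gamma[of n] that by (simp add: zhom_def mdeg_eq_0)
  ultimately show "mcoeff (hpsums n 0) M = mcoeff 1 M"
    by (cases "M = 0") (simp_all add: hfun_def psums_gamma_def mcoeff_1)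
qed

lemma power_eq_hs:
  assumes "i < n"
  shows "\<exists>e. \<forall>m. var i ^ m = (\<Sum>r<n. e r * hpsums n (int m - int r))"
proof -
  let ?J = "{..<n} - {i}"
  have "linprod {..<n} = (1 - xz i) * linprod ?J"
    using lin_insert[of ?J i] assms by (simp add: insert_absorb)
  then have "geo (xz i) * (psums_gamma n * linprod {..<n}) = (geo (xz i) * (1 - xz i)) * (psums_gamma n * linprod ?J)"
    by (simp only: ac_simps)
  then have geo: "geo (xz i) = psums_gamma n * linprod ?J"
    unfolding psums_gamma_lin geo_xz by simp
  obtain e where e: "\<And>f k. zcoeff k (f * linprod ?J) = (\<Sum>r\<le>card ?J. e r * zcoeff (k - int r) f)"
    using zcoeff_mult_lin[of ?J] by auto
  have "{..card ?J} = {..<n}" using assms by auto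
  then have "var i ^ m = (\<Sum>r<n. e r * hpsums n (int m - int r))" for m
    unfolding zcoeff_geo[symmetric] geo e hfun_def psums_gamma_def by simp
  then show ?thesis by blast
qed

definition Hmat :: "nat \<Rightarrow> nat \<Rightarrow> (nat \<Rightarrow> nat) \<Rightarrow> (nat, rat) mps mat" where
  "Hmat n m l = mat m m (\<lambda>(i, j). hpsums n (int (l i) - int i + int j))"

lemma det_Hmat_Suc: assumes "l m = 0" shows "det (Hmat n (Suc m) l) = det (Hmat n m l)"
proof -
  let ?A = "Hmat n (Suc m) l"
  have "det ?A = (\<Sum>j<Suc m. ?A $$ (m, j) * cofactor ?A m j)"
    by (rule laplace_expansion_row) (auto simp: Hmat_def)
  also have "\<dots> = ?A $$ (m, m) * cofactor ?A m m"
    using assms by (simp add: Hmat_def hs_neg)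
  also have "\<dots> = cofactor ?A m m"
    using assms by (simp add: Hmat_def hs_0)
  also have "mat_delete ?A m m = Hmat n m l"
    by (rule eq_matI) (auto simp: Hmat_def mat_delete_def)
  then have "cofactor ?A m m = det (Hmat n m l)"
    by (simp add: cofactor_def)
  finally show ?thesis .
qed

lemma det_Hmat: assumes "\<And>i. k \<le> i \<Longrightarrow> l i = 0" shows "det (Hmat n (k + d) l) = det (Hmat n k l)"
  by (induction d) (use assms in \<open>simp_all add: det_Hmat_Suc\<close>)

lemma partition_zero: assumes "l \<in> partitions" "num_parts l \<le> i" shows "l i = 0"
proof (rule ccontr)
  assume "l i \<noteq> 0"
  then have "l j \<noteq> 0" if "j \<le> i" for j
    using assms(1) antimonoD[of l j i] that by (auto simp: partitions_def)
  then have "{..i} \<subseteq> {i. l i \<noteq> 0}" by auto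
  then have "card {..i} \<le> num_parts l"
    unfolding num_parts_def using assms(1) by (intro card_mono) (auto simp: partitions_def)
  then show False using assms(2) by simp
qed

theorem schur_bialternant:
  assumes "l \<in> partitions" "num_parts l \<le> n"
  shows "schur (psums n) l * det (mat n n (\<lambda>(i, j). var i ^ (n - 1 - j)))
       = det (mat n n (\<lambda>(i, j). var i ^ (l j + (n - 1 - j))))"
proof -
  obtain e where e: "\<And>i m. i < n \<Longrightarrow> var i ^ m = (\<Sum>r<n. e i r * hpsums n (int m - int r))"
    using power_eq_hs[of _ n] by metis
  define E where "E = mat n n (\<lambda>(i, k). e i (n - Suc k))"
  have E: "E \<in> carrier_mat n n" by (simp add: E_def)
  have H: "Hmat n n l \<in> carrier_mat n n" for l by (simp add: Hmat_def)
  have A: "mat n n (\<lambda>(i, j). var i ^ (l j + (n - 1 - j))) = E * transpose_mat (Hmat n n l)" for l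
  proof (rule eq_matI)
    fix i j assume "i < dim_row (E * transpose_mat (Hmat n n l))" "j < dim_col (E * transpose_mat (Hmat n n l))"
    then have ij: "i < n" "j < n" by (simp_all add: E_def Hmat_def)
    have "var i ^ (l j + (n - 1 - j)) = (\<Sum>k<n. e i (n - Suc k) * hpsums n (int (l j + (n - 1 - j)) - int (n - Suc k)))"
      unfolding e[OF ij(1)] by (rule sum.nat_diff_reindex[symmetric])
    also have "\<dots> = (\<Sum>k<n. e i (n - Suc k) * hpsums n (int (l j) - int j + int k))"
    proof (rule sum.cong[OF refl])
      fix k assume "k \<in> {..<n}"
      then have "int (l j + (n - 1 - j)) - int (n - Suc k) = int (l j) - int j + int k"
        using ij by (simp add: of_nat_diff)
      then show "e i (n - Suc k) * hpsums n (int (l j + (n - 1 - j)) - int (n - Suc k))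
          = e i (n - Suc k) * hpsums n (int (l j) - int j + int k)" by (simp only:)
    qed
    also have "\<dots> = (E * transpose_mat (Hmat n n l)) $$ (i, j)"
      using ij by (simp add: E_def Hmat_def scalar_prod_def lessThan_atLeast0)
    finally show "mat n n (\<lambda>(i, j). var i ^ (l j + (n - 1 - j))) $$ (i, j) = (E * transpose_mat (Hmat n n l)) $$ (i, j)"
      using ij by simp
  qed (simp_all add: E_def Hmat_def)
  have D: "det (mat n n (\<lambda>(i, j). var i ^ (l j + (n - 1 - j)))) = det E * det (Hmat n n l)" for l
    unfolding A by (subst det_mult[OF E]) (simp_all add: H det_transpose[OF H])
  have "det (Hmat n n (\<lambda>_. 0)) = 1"
    using det_Hmat[where k = 0 and l = "\<lambda>_. 0" and n = n and d = n] by (simp add: Hmat_def)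
  then have "det (mat n n (\<lambda>(i, j). var i ^ (n - 1 - j))) = det E"
    using D[of "\<lambda>_. 0"] by simp
  moreover have "det (Hmat n (num_parts l + (n - num_parts l)) l) = det (Hmat n (num_parts l) l)"
    by (rule det_Hmat) (rule partition_zero[OF assms(1)])
  then have "det (Hmat n n l) = schur (psums n) l"
    using assms(2) by (simp add: schur_def Hmat_def)
  ultimately show ?thesis unfolding D by (simp add: mult.commute)
qed


end

theory Submission
  imports Defs
begin

text \<open>
  Write \<open>P = t + s\<close>, \<open>Q = t - s\<close>, \<open>U = t' + s'\<close>, \<open>V = t' - s'\<close> and let \<open>l \<setminus> i\<close> be the partition whose Maya
  diagram is that of \<open>l\<close> without its \<open>i\<close>-th point \<open>l\<^sub>i - i\<close>. Column operations in the Jacobi--Trudi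
  determinant give the two vertex operator identities
  \<open>\<gamma>(1/z, V) s\<^sub>m(V - {z}) = \<Sum> (-1)\<^sup>i z\<^bsup>i - l\<^sub>i\<^esup> s\<^sub>l(V)\<close>, summed over the pairs \<open>(l, i)\<close> with \<open>l \<setminus> i = m\<close>, and
  \<open>\<gamma>(1/z, -U) s\<^sub>l(U + {z}) = \<Sum>\<^sub>i (-1)\<^sup>i z\<^bsup>l\<^sub>i - i\<^esup> s\<^bsub>l \<setminus> i\<^esub>(U)\<close>.
  Since \<open>\<gamma>(1/z, -2s') = \<gamma>(1/z, V) \<gamma>(1/z, -U)\<close> and \<open>\<gamma>(1/z, 2s) = \<gamma>(1/z, P) \<gamma>(1/z, -Q)\<close>, both sides of the
  Hirota equation become sums over pairs \<open>(l, i)\<close>, \<open>(k, j)\<close> of the same terms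
  \<open>\<plusminus> s\<^sub>l(P) s\<^bsub>l \<setminus> i\<^esub>(U) s\<^bsub>k \<setminus> j\<^esub>(Q) s\<^sub>k(V)\<close>, where taking the coefficient of the power of \<open>z\<close> forces the removed points
  of the two Maya diagrams to coincide. On the left the Maya diagrams of \<open>l\<close> and \<open>k \<setminus> j\<close> have to contain \<open>X\<close>,
  on the right those of \<open>l \<setminus> i\<close> and \<open>k\<close>: as the removed point is the same, both say that \<open>X\<close> lies in both
  diagrams and avoids that point.
\<close>

section \<open>Newton's recursion\<close>

text \<open>Newton's identities for complete functions with power sums \<open>k * u k\<close>: the
  logarithmic derivative of \<open>\<Sum> h n X^n = exp (\<Sum> u k X^k)\<close>. Unlike the
  exponential they make sense in every commutative ring, hence also for arguments such as
  \<open>embed (u k) + zseq k\<close>, where the constant term is not zero.\<close>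

definition newton :: "(nat \<Rightarrow> 'a::comm_ring_1) \<Rightarrow> (int \<Rightarrow> 'a) \<Rightarrow> bool" where
  "newton u h \<longleftrightarrow> (\<forall>k<0. h k = 0) \<and> h 0 = 1 \<and>
     (\<forall>n>0. of_nat n * h (int n) = (\<Sum>k=1..n. of_nat k * u k * h (int n - int k)))"

lemma newtonD:
  assumes "newton u h"
  shows "k < 0 \<Longrightarrow> h k = 0" "h 0 = 1"
    "n > 0 \<Longrightarrow> of_nat n * h (int n) = (\<Sum>k=1..n. of_nat k * u k * h (int n - int k))"
  using assms by (auto simp: newton_def)

lemma of_nat_mult_mps:
  fixes f :: "('v, 'a::comm_ring_1) mps"
  shows "mcoeff (of_nat n * f) M = of_nat n * mcoeff f M"
proof -
  have "of_nat n = (const (of_nat n) :: ('v, 'a::comm_ring_1) mps)"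
    by (induction n) (auto intro!: mps_eqI simp: const_def mcoeff_1)
  then show ?thesis by simp
qed

lemma of_nat_mps_cancel:
  fixes f g :: "('v, 'a::{comm_ring_1, semiring_char_0, semiring_no_zero_divisors}) mps"
  assumes "of_nat (Suc n) * f = of_nat (Suc n) * g"
  shows "f = g"
proof (rule mps_eqI)
  fix M
  have "of_nat (Suc n) * mcoeff (f - g) M = 0"
    using arg_cong[OF assms, of "\<lambda>f. mcoeff f M"]
    by (simp only: of_nat_mult_mps mcoeff_minus right_diff_distrib) simp
  then show "mcoeff f M = mcoeff g M"
    by (simp del: of_nat_Suc)
qed

text \<open>Strong induction: the recursion fixes \<open>n * h n\<close> from smaller indices, and n
  cancels in characteristic zero. This is how different descriptions of the same complete functions
  are identified.\<close>

lemma newton_unique: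
  fixes u :: "nat \<Rightarrow> ('v, 'a::{comm_ring_1, semiring_char_0, semiring_no_zero_divisors}) mps"
  assumes "newton u h" "newton u h'"
  shows "h = h'"
proof
  have *: "h (int n) = h' (int n)" for n
  proof (induction n rule: less_induct)
    case (less n)
    show ?case
    proof (cases n)
      case 0
      then show ?thesis using assms by (simp add: newtonD(2))
    next
      case (Suc m)
      have "h (int n - int k) = h' (int n - int k)" if "k \<in> {1..n}" for k
        using less[of "n - k"] that by (simp add: of_nat_diff)
      then have "of_nat n * h (int n) = of_nat n * h' (int n)"
        using assms Suc by (simp add: newtonD(3) del: of_nat_Suc)
      then show ?thesis unfolding Suc by (rule of_nat_mps_cancel)
    qed
  qed
  fix k
  show "h k = h' k"
    using *[of "nat k"] assms by (cases "k < 0") (simp_all add: newtonD(1))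
qed

text \<open>Multiplying the generating function by \<open>1 - w X\<close> subtracts the power sums of one variable \<open>w\<close>.\<close>

lemma newton_diff_geo:
  assumes h: "newton u h" and v: "\<And>k. k > 0 \<Longrightarrow> of_nat k * v k = w ^ k"
  shows "newton (\<lambda>k. u k - v k) (\<lambda>n. h n - w * h (n - 1))"
  unfolding newton_def
proof (intro conjI allI impI)
  fix n :: nat assume n: "0 < n"
  let ?g = "\<lambda>n. h n - w * h (n - 1)"
  \<comment> \<open>Telescoping: the second part of each summand cancels the first part of the next
    one.\<close>
  have tel: "(\<Sum>k=1..m. w ^ k * ?g (int n - int k)) = w * h (int n - 1) - w ^ Suc m * h (int n - int m - 1)" for m
  proof (induction m)
    case (Suc m)
    then show ?case by (simp add: algebra_simps)
  qed simp
  have z: "h (- 1) = 0" using newtonD(1)[OF h] by simp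
  \<comment> \<open>The recursion at n - 1, times w; the extra \<open>w * h (n - 1)\<close> turns
    the factor n - 1 into n. The recursion holds at positive indices only, hence the separate case n
    = 1.\<close>
  have e: "w * (of_nat n * h (int n - 1)) = w * (\<Sum>k=1..n. of_nat k * u k * h (int n - int k - 1)) + w * h (int n - 1)"
  proof (cases "n = 1")
    case False
    then obtain m where m: "n = Suc m" "m > 0" using n by (cases n) auto
    have "of_nat m * h (int m) = (\<Sum>k=1..n. of_nat k * u k * h (int n - int k - 1))"
      using newtonD(3)[OF h m(2)] z by (simp add: m(1) algebra_simps)
    then show ?thesis by (simp add: m(1) algebra_simps)
  qed (use z in simp)
  have "of_nat n * ?g (int n) = of_nat n * h (int n) - w * (of_nat n * h (int n - 1))"
    by (simp add: algebra_simps)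
  also have "\<dots> = (\<Sum>k=1..n. of_nat k * u k * ?g (int n - int k)) - w * h (int n - 1)"
    unfolding e newtonD(3)[OF h n] by (simp add: algebra_simps sum_distrib_left sum_subtractf)
  finally have E: "of_nat n * ?g (int n) = (\<Sum>k=1..n. of_nat k * u k * ?g (int n - int k)) - w * h (int n - 1)" .
  have v': "w * h (int n - 1) = (\<Sum>k=1..n. of_nat k * v k * ?g (int n - int k))"
  proof -
    have "(\<Sum>k=1..n. of_nat k * v k * ?g (int n - int k)) = (\<Sum>k=1..n. w ^ k * ?g (int n - int k))"
      by (rule sum.cong) (use v in auto)
    then show ?thesis unfolding tel using z by simp
  qed
  show "of_nat n * ?g (int n) = (\<Sum>k=1..n. of_nat k * (u k - v k) * ?g (int n - int k))"
    unfolding E unfolding v' unfolding sum_subtractf[symmetric] by (rule sum.cong) (simp_all add: algebra_simps)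
qed (use h in \<open>auto simp: newtonD\<close>)

section \<open>Series without \<open>z\<close>\<close>

definition embed :: "('v, rat) mps \<Rightarrow> ('v, laurent) mps" where
  "embed f = mps (\<lambda>M. Poly_Mapping.single 0 (mcoeff f M))"

lemma mcoeff_embed [simp]: "mcoeff (embed f) M = Poly_Mapping.single 0 (mcoeff f M)"
  by (simp add: embed_def)

lemma single_sum: "Poly_Mapping.single k (sum f A) = (\<Sum>i\<in>A. Poly_Mapping.single k (f i))"
  by (induction A rule: infinite_finite_induct) (auto simp: single_add)

interpretation embed: comm_ring_hom embed
proof
  fix f g :: "('v, rat) mps"
  show "embed (f + g) = embed f + embed g" by (rule mps_eqI) (simp add: single_add)
  show "embed (f * g) = embed f * embed g"
    by (rule mps_eqI) (auto simp: mcoeff_mult single_sum mult_single intro!: sum.cong)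
  show "embed 0 = 0" "embed 1 = 1" by (auto intro!: mps_eqI simp: mcoeff_1)
qed

lemma embed_var [simp]: "embed (var v) = var v"
  by (rule mps_eqI) (simp add: var_def)

lemma zcoeff_embed_mult: "zcoeff k (embed f * F) = f * zcoeff k F"
  by (rule mps_eqI)
    (auto simp: mcoeff_mult lookup_sum' lookup_single_mult intro!: sum.cong)

lemma zcoeff_embed: "zcoeff k (embed f) = (if k = 0 then f else 0)"
  using zcoeff_embed_mult[of k f 1] by (simp add: zcoeff_1)

lemma newton_embed: "newton u h \<Longrightarrow> newton (\<lambda>k. embed (u k)) (\<lambda>n. embed (h n))"
  unfolding newton_def
  by (auto simp flip: embed.hom_mult embed.hom_sum embed.hom_of_nat)

section \<open>The exponential\<close>

text \<open>The derivation z d/dz on the Laurent coefficients. Applied to an exponential in z it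
  produces Newton's recursion.\<close>

definition theta :: "('v, laurent) mps \<Rightarrow> ('v, laurent) mps" where
  "theta f = mps (\<lambda>M. Poly_Mapping.mapp (\<lambda>k c. of_int k * c) (mcoeff f M))"

lemma lookup_theta: "Poly_Mapping.lookup (mcoeff (theta f) M) k = of_int k * Poly_Mapping.lookup (mcoeff f M) k"
  by (auto simp: theta_def lookup_mapp when_def in_keys_iff)

lemma lookup_eqI:
  assumes "\<And>M k. Poly_Mapping.lookup (mcoeff f M) k = Poly_Mapping.lookup (mcoeff g M) k"
  shows "f = g"
  by (intro mps_eqI poly_mapping_eqI assms)

lemma lookup_laurent_mult:
  fixes p q :: laurent
  assumes "finite A" "Poly_Mapping.keys p \<subseteq> A"
  shows "Poly_Mapping.lookup (p * q) k = (\<Sum>a\<in>A. Poly_Mapping.lookup p a * Poly_Mapping.lookup q (k - a))"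
proof -
  have "p = (\<Sum>a\<in>A. Poly_Mapping.single a (Poly_Mapping.lookup p a))"
    using assms by (intro poly_mapping_eqI)
      (auto simp: lookup_sum' lookup_single when_def in_keys_iff)
  then have "Poly_Mapping.lookup (p * q) k
      = Poly_Mapping.lookup ((\<Sum>a\<in>A. Poly_Mapping.single a (Poly_Mapping.lookup p a)) * q) k"
    by simp
  then show ?thesis
    by (simp only: sum_distrib_right lookup_sum' lookup_single_mult)
qed

lemma theta_mult: "theta (f * g) = theta f * g + f * theta g"
proof (rule lookup_eqI)
  fix M k
  have "of_int k * Poly_Mapping.lookup (mcoeff f a * mcoeff g b) k
      = Poly_Mapping.lookup (mcoeff (theta f) a * mcoeff g b) k + Poly_Mapping.lookup (mcoeff f a * mcoeff (theta g) b) k" for a b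
  proof -
    let ?A = "Poly_Mapping.keys (mcoeff f a)"
    have k: "Poly_Mapping.keys (mcoeff (theta f) a) \<subseteq> ?A"
      by (auto simp: in_keys_iff lookup_theta)
    show ?thesis
      unfolding lookup_laurent_mult[OF finite_keys k] lookup_laurent_mult[OF finite_keys[of "mcoeff f a"] order_refl]
        lookup_theta sum_distrib_left sum.distrib[symmetric]
      by (rule sum.cong) (simp_all add: algebra_simps)
  qed
  then show "Poly_Mapping.lookup (mcoeff (theta (f * g)) M) k = Poly_Mapping.lookup (mcoeff (theta f * g + f * theta g) M) k"
    by (simp only: lookup_theta mcoeff_mult mcoeff_add lookup_add lookup_sum' sum_distrib_left
      case_prod_unfold sum.distrib[symmetric])
qed

lemma theta_sum: "theta (sum f A) = (\<Sum>i\<in>A. theta (f i))"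
  by (rule lookup_eqI) (simp add: lookup_theta mcoeff_sum lookup_sum' sum_distrib_left)

lemma theta_const0: "theta (const (Poly_Mapping.single 0 c)) = 0"
  by (rule lookup_eqI) (auto simp: lookup_theta const_def lookup_single when_def)

lemma theta_1: "theta 1 = 0"
  using theta_const0[of 1] by simp

lemma theta_power: "theta (f ^ Suc n) = of_nat (Suc n) * f ^ n * theta f"
proof (induction n)
  case 0
  show ?case by (simp add: theta_mult theta_1)
next
  case (Suc n)
  have "theta (f ^ Suc (Suc n)) = theta f * f ^ Suc n + f * (of_nat (Suc n) * f ^ n * theta f)"
    by (simp only: power_Suc[of f "Suc n"] theta_mult Suc)
  also have "\<dots> = (1 + of_nat (Suc n)) * f ^ Suc n * theta f"
    by (simp add: ring_distribs ac_simps del: of_nat_Suc)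
  finally show ?case by (simp only: of_nat_Suc)
qed

text \<open>Chain rule on partial sums: \<open>theta\<close> sends the sum up to K + 1 to
  \<open>theta f\<close> times the sum up to K, and as f has no constant term, powers beyond the
  degree of M do not reach the coefficient of M.\<close>

lemma theta_mexp:
  fixes f :: "('v, laurent) mps"
  assumes "mcoeff f 0 = 0"
  shows "theta (mexp f) = theta f * mexp f"
proof (rule mps_eqI)
  fix M :: "'v \<Rightarrow>\<^sub>0 nat"
  let ?E = "\<lambda>K. \<Sum>n\<le>K. scalar (1 / fact n) * f ^ n"
  have tm: "theta (scalar (1 / fact (Suc n)) * f ^ Suc n) = theta f * (scalar (1 / fact n) * f ^ n)" for n
  proof -
    have "theta (scalar (1 / fact (Suc n)) * f ^ Suc n) = (scalar (1 / fact (Suc n)) * of_nat (Suc n)) * f ^ n * theta f"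
      unfolding theta_mult scalar_def theta_const0 theta_power by (simp only: ac_simps mult_zero_left add_0_left)
    also have "scalar (1 / fact (Suc n)) * of_nat (Suc n) = (scalar (1 / fact n) :: ('v, laurent) mps)"
      unfolding scalar_of_nat[symmetric] scalar_mult[symmetric] fact_Suc by (simp del: of_nat_Suc)
    finally show ?thesis by (simp only: ac_simps)
  qed
  have t0: "theta (scalar (1 / fact 0) * f ^ 0) = 0"
    using theta_const0[of 1] by (simp add: scalar_def)
  have e: "theta (?E (Suc K)) = theta f * ?E K" for K
    unfolding theta_sum unfolding sum.atMost_Suc_shift tm t0 sum_distrib_left by simp
  let ?K = "mdeg M"
  have "mcoeff (theta (mexp f)) M = mcoeff (theta (?E (Suc ?K))) M"
    unfolding theta_def mcoeff_mps by (subst mcoeff_mexp[OF assms, of _ "Suc ?K"]) auto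
  also have "\<dots> = mcoeff (theta f * ?E ?K) M" by (simp only: e)
  also have "\<dots> = mcoeff (theta f * mexp f) M"
    by (rule mcoeff_mult_cong) (simp add: mcoeff_mexp[OF assms, of _ ?K])
  finally show "mcoeff (theta (mexp f)) M = mcoeff (theta f * mexp f) M" .
qed

text \<open>The equation is linear of first order: for a solution G with constant term 1, the
  product \<open>G * mexp (- f)\<close> is annihilated by \<open>euler\<close> and so equals 1. This
  applies to F and to \<open>mexp f\<close> alike.\<close>

lemma mexp_unique:
  assumes "mcoeff f 0 = 0" "euler F = euler f * F" "mcoeff F 0 = 1"
  shows "F = mexp f"
proof -
  have c: "mcoeff (- f) 0 = 0" using assms(1) by simp
  have inv: "G * mexp (- f) = 1" if "euler G = euler f * G" "mcoeff G 0 = 1" for G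
  proof -
    have m: "euler (- f) = - euler f" by (rule mps_eqI) simp
    have "euler (G * mexp (- f)) = 0"
      unfolding euler_mult euler_mexp[OF c] m that(1) by (simp add: algebra_simps)
    then have "G * mexp (- f) = const (mcoeff (G * mexp (- f)) 0)" by (rule euler_eq_0)
    then show ?thesis by (simp add: mcoeff_mult_0 mexp_0[OF c] that(2))
  qed
  have "F = F * (mexp f * mexp (- f))"
    by (simp add: inv[OF euler_mexp[OF assms(1)] mexp_0[OF assms(1)]])
  also have "\<dots> = (F * mexp (- f)) * mexp f" by (simp only: ac_simps)
  finally show ?thesis by (simp add: inv[OF assms(2,3)])
qed

lemma mexp_add:
  assumes "mcoeff f 0 = 0" "mcoeff g 0 = 0"
  shows "mexp (f + g) = mexp f * mexp g"
  by (rule sym, rule mexp_unique)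
    (simp_all add: assms euler_mult euler_mexp euler_add mcoeff_mult_0 mexp_0 algebra_simps)

lemma zcoeff_theta: "zcoeff k (theta f) = of_int k * zcoeff k f"
proof -
  have c: "of_int k = (const (of_int k) :: ('v, rat) mps)"
    by (rule sym, cases k) (auto simp: const_def mcoeff_1 of_nat_mult_mps[of _ 1, simplified] intro!: mps_eqI)
  show ?thesis unfolding c by (rule mps_eqI) (simp add: lookup_theta)
qed

section \<open>Weights\<close>

definition wdeg :: "('v \<Rightarrow> nat) \<Rightarrow> ('v \<Rightarrow>\<^sub>0 nat) \<Rightarrow> nat" where
  "wdeg \<omega> M = (\<Sum>v\<in>Poly_Mapping.keys M. \<omega> v * Poly_Mapping.lookup M v)"

text \<open>The filtration by weighted order, which replaces convergence: identities between
  infinite sums are checked modulo terms of high order. Powers of z sit in the coefficients and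
  carry no weight; variables of weight 0 are allowed.\<close>

definition vanishes_below :: "('v \<Rightarrow> nat) \<Rightarrow> nat \<Rightarrow> ('v, 'a::comm_ring_1) mps \<Rightarrow> bool" where
  "vanishes_below \<omega> N f \<longleftrightarrow> (\<forall>M. wdeg \<omega> M < N \<longrightarrow> mcoeff f M = 0)"

lemma wdeg_superset:
  "finite A \<Longrightarrow> Poly_Mapping.keys M \<subseteq> A \<Longrightarrow> wdeg \<omega> M = (\<Sum>v\<in>A. \<omega> v * Poly_Mapping.lookup M v)"
  unfolding wdeg_def by (rule sum.mono_neutral_left) (auto simp: in_keys_iff)

lemma wdeg_0 [simp]: "wdeg \<omega> 0 = 0"
  by (simp add: wdeg_def)

lemma wdeg_single [simp]: "wdeg \<omega> (Poly_Mapping.single v n) = \<omega> v * n"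
  by (simp add: wdeg_def)

lemma wdeg_add: "wdeg \<omega> (a + b) = wdeg \<omega> a + wdeg \<omega> b"
proof -
  let ?A = "Poly_Mapping.keys a \<union> Poly_Mapping.keys b"
  have "wdeg \<omega> (a + b) = (\<Sum>v\<in>?A. \<omega> v * Poly_Mapping.lookup (a + b) v)"
    by (rule wdeg_superset) (auto simp: in_keys_iff lookup_add)
  also have "\<dots> = wdeg \<omega> a + wdeg \<omega> b"
    by (simp add: lookup_add sum.distrib distrib_left wdeg_superset[of ?A])
  finally show ?thesis .
qed

lemma vanishes_below_mult:
  assumes "vanishes_below \<omega> m f" "vanishes_below \<omega> n g"
  shows "vanishes_below \<omega> (m + n) (f * g)"
  unfolding vanishes_below_def mcoeff_mult
proof (intro allI impI sum.neutral ballI)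
  fix M x assume "wdeg \<omega> M < m + n" "x \<in> splits M"
  then have "wdeg \<omega> (fst x) < m \<or> wdeg \<omega> (snd x) < n" by (auto simp: wdeg_add)
  then show "(case x of (a, b) \<Rightarrow> mcoeff f a * mcoeff g b) = 0"
    using assms by (auto simp: vanishes_below_def case_prod_unfold)
qed

lemma vanishes_below_mono: "vanishes_below \<omega> m f \<Longrightarrow> n \<le> m \<Longrightarrow> vanishes_below \<omega> n f"
  by (auto simp: vanishes_below_def)

lemma vanishes_below_any [simp]: "vanishes_below \<omega> 0 f"
  by (simp add: vanishes_below_def)

lemma vanishes_below_0 [simp]: "vanishes_below \<omega> n 0"
  by (simp add: vanishes_below_def)

lemma vanishes_below_add:
  "vanishes_below \<omega> n f \<Longrightarrow> vanishes_below \<omega> n g \<Longrightarrow> vanishes_below \<omega> n (f + g)"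
  by (simp add: vanishes_below_def)

lemma vanishes_below_diff:
  "vanishes_below \<omega> n f \<Longrightarrow> vanishes_below \<omega> n g \<Longrightarrow> vanishes_below \<omega> n (f - g)"
  by (simp add: vanishes_below_def)

lemma vanishes_below_uminus [simp]: "vanishes_below \<omega> n (- f) \<longleftrightarrow> vanishes_below \<omega> n f"
  by (simp add: vanishes_below_def)

lemma vanishes_below_diffD: "vanishes_below \<omega> n (f - g) \<Longrightarrow> wdeg \<omega> M < n \<Longrightarrow> mcoeff f M = mcoeff g M"
  by (auto simp: vanishes_below_def)

lemma vanishes_below_sum:
  "(\<And>i. i \<in> A \<Longrightarrow> vanishes_below \<omega> n (f i)) \<Longrightarrow> vanishes_below \<omega> n (sum f A)"
  by (induction A rule: infinite_finite_induct) (auto simp: vanishes_below_add)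

lemma vanishes_below_mult_left: "vanishes_below \<omega> n g \<Longrightarrow> vanishes_below \<omega> n (f * g)"
  using vanishes_below_mult[OF vanishes_below_any, of \<omega> n g f] by simp

lemma vanishes_below_mult_right: "vanishes_below \<omega> n f \<Longrightarrow> vanishes_below \<omega> n (f * g)"
  using vanishes_below_mult[OF _ vanishes_below_any, of \<omega> n f g] by simp

lemma vanishes_below_power: "vanishes_below \<omega> n f \<Longrightarrow> vanishes_below \<omega> (k * n) (f ^ k)"
  by (induction k) (auto intro: vanishes_below_mult)

lemma vanishes_below_prod:
  "(\<And>i. i \<in> A \<Longrightarrow> vanishes_below \<omega> (n i) (f i)) \<Longrightarrow> vanishes_below \<omega> (sum n A) (prod f A)"
  by (induction A rule: infinite_finite_induct) (auto intro: vanishes_below_mult)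

lemma vanishes_below_var: "n \<le> \<omega> v \<Longrightarrow> vanishes_below \<omega> n (var v)"
  by (auto simp: vanishes_below_def var_def)

lemma vanishes_below_embed [simp]: "vanishes_below \<omega> n (embed f) \<longleftrightarrow> vanishes_below \<omega> n f"
  by (metis lookup_single_eq mcoeff_embed single_zero vanishes_below_def)

section \<open>The coefficients of \<open>gamma\<close>\<close>

text \<open>In all uses \<open>e * e = 1\<close>, so this is the order in z or in 1/z, and one
  argument serves \<open>gamma\<close> at both.\<close>

definition zorder_ge :: "int \<Rightarrow> int \<Rightarrow> ('v, laurent) mps \<Rightarrow> bool" where
  "zorder_ge e n f \<longleftrightarrow> (\<forall>k<n. zcoeff (e * k) f = 0)"

lemma zorder_ge_iff: "zorder_ge e n f \<longleftrightarrow> (\<forall>k<n. \<forall>M. Poly_Mapping.lookup (mcoeff f M) (e * k) = 0)"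
  unfolding zorder_ge_def by (metis mcoeff_zcoeff mcoeff_0 mps_eqI)

lemma zorder_ge_mult:
  fixes f g :: "('v, laurent) mps"
  assumes e: "e * e = 1" and "zorder_ge e m f" "zorder_ge e n g"
  shows "zorder_ge e (m + n) (f * g)"
  unfolding zorder_ge_iff mcoeff_mult lookup_sum'
proof (intro allI impI sum.neutral ballI)
  fix k and M :: "'v \<Rightarrow>\<^sub>0 nat" and x assume k: "k < m + n" and "x \<in> splits M"
  show "Poly_Mapping.lookup (case x of (a, b) \<Rightarrow> mcoeff f a * mcoeff g b) (e * k) = 0"
    unfolding case_prod_unfold lookup_laurent_mult[OF finite_keys order_refl]
  proof (rule sum.neutral, rule ballI)
    fix j
    have j: "j = e * (e * j)" using e by (simp flip: mult.assoc)
    then have kj: "e * k - j = e * (k - e * j)" by (simp add: right_diff_distrib)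
    show "Poly_Mapping.lookup (mcoeff f (fst x)) j * Poly_Mapping.lookup (mcoeff g (snd x)) (e * k - j) = 0"
    proof (cases "e * j < m")
      case True
      then show ?thesis using assms(2) j by (metis zorder_ge_iff mult_zero_left)
    next
      case False
      then have "k - e * j < n" using k by simp
      then show ?thesis using assms(3) unfolding kj zorder_ge_iff by simp
    qed
  qed
qed

lemma zorder_ge_1: "e * e = 1 \<Longrightarrow> zorder_ge e 0 1"
  by (auto simp: zorder_ge_def zcoeff_1)

lemma zorder_ge_power: "e * e = 1 \<Longrightarrow> zorder_ge e 1 f \<Longrightarrow> zorder_ge e (int n) (f ^ n)"
  by (induction n) (auto simp: zorder_ge_1 dest: zorder_ge_mult)

text \<open>The Cauchy product in z. Exponents range over all integers; J collects those that occur
  in f at the divisors of M and so makes the sum finite.\<close>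

lemma zcoeff_mult_finite:
  assumes "finite J" "\<And>a b. a + b = M \<Longrightarrow> Poly_Mapping.keys (mcoeff f a) \<subseteq> J"
  shows "mcoeff (zcoeff k (f * g)) M = (\<Sum>x\<in>J. mcoeff (zcoeff x f * zcoeff (k - x) g) M)"
proof -
  have "mcoeff (zcoeff k (f * g)) M = (\<Sum>(a, b)\<in>splits M. \<Sum>x\<in>J.
      mcoeff (zcoeff x f) a * mcoeff (zcoeff (k - x) g) b)"
    unfolding mcoeff_zcoeff mcoeff_mult lookup_sum'
    by (rule sum.cong) (auto simp: lookup_laurent_mult[OF assms(1,2)])
  then show ?thesis
    unfolding mcoeff_mult by (subst (asm) case_prod_unfold, subst (asm) sum.swap) (simp add: case_prod_unfold)
qed

lemma zcoeff_embed_zpow: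
  fixes f :: "('v, rat) mps"
  shows "zcoeff k (embed f * zpow j) = (if k = j then f else 0)"
proof -
  have "zcoeff k (zpow j) = (zcoeff (k - j) 1 :: ('v, rat) mps)"
    using zcoeff_zpow_mult[of k j 1] by simp
  then show ?thesis by (simp add: zcoeff_embed_mult zcoeff_1)
qed

lemma zpow_pow: "zpow e ^ n = zpow (e * int n)"
  by (induction n) (simp_all add: zpow_add[symmetric] algebra_simps)

context
  fixes e :: int and \<omega> :: "'v \<Rightarrow> nat" and v :: "nat \<Rightarrow> ('v, rat) mps"
  assumes e: "e * e = 1" and v: "\<And>k. vanishes_below \<omega> k (v k)"
begin

text \<open>The exponent in \<open>gamma\<close>. As \<open>v n\<close> has order at least n, only
  the n up to the weight of M contribute to the coefficient of M.\<close>

definition gamma_log :: "('v, laurent) mps" where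
  "gamma_log = msum (\<lambda>n. embed (v n) * zpow e ^ n) {1..}"

lemma mcoeff_gamma_log:
  "mcoeff gamma_log M = (\<Sum>n=1..wdeg \<omega> M. mcoeff (embed (v n) * zpow e ^ n) M)"
  unfolding gamma_log_def
proof (rule mcoeff_msum)
  fix n assume "n \<in> {1..} - {1..wdeg \<omega> M}"
  then have n: "wdeg \<omega> M < n" by auto
  have "vanishes_below \<omega> n (embed (v n))"
    using v by (simp add: vanishes_below_def)
  from vanishes_below_mult_right[OF this, of "zpow e ^ n"] n
  show "mcoeff (embed (v n) * zpow e ^ n) M = 0"
    by (simp add: vanishes_below_def)
qed auto

lemma zcoeff_gamma_log:
  "zcoeff (e * k) gamma_log = (if k > 0 then v (nat k) else 0)"
proof (rule mps_eqI)
  fix M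
  have *: "Poly_Mapping.lookup (mcoeff (embed (v n) * zpow e ^ n) M) (e * k)
    = (if k = int n then mcoeff (v n) M else 0)" for n
  proof -
    have "(e * k = e * int n) = (k = int n)" using e by auto
    then show ?thesis
      unfolding mcoeff_zcoeff[symmetric] zpow_pow zcoeff_embed_zpow by simp
  qed
  have "mcoeff (zcoeff (e * k) gamma_log) M = (\<Sum>n=1..wdeg \<omega> M. if k = int n then mcoeff (v n) M else 0)"
    unfolding mcoeff_zcoeff mcoeff_gamma_log lookup_sum' * ..
  also have "\<dots> = (\<Sum>n=1..wdeg \<omega> M. if n = nat k then mcoeff (v n) M else 0)"
    by (rule sum.cong) auto
  also have "\<dots> = mcoeff (if k > 0 then v (nat k) else 0) M"
    using v[of "nat k"] by (auto simp: vanishes_below_def not_le Suc_le_eq)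
  finally show "mcoeff (zcoeff (e * k) gamma_log) M = \<dots>" .
qed

lemma keys_gamma_log: "Poly_Mapping.keys (mcoeff gamma_log M) \<subseteq> (\<lambda>n. e * int n) ` {1..wdeg \<omega> M}"
proof
  fix j assume "j \<in> Poly_Mapping.keys (mcoeff gamma_log M)"
  then have nz: "mcoeff (zcoeff (e * (e * j)) gamma_log) M \<noteq> 0"
    using e by (simp add: in_keys_iff flip: mult.assoc)
  then have "e * j > 0" unfolding zcoeff_gamma_log by (auto split: if_splits)
  moreover from this nz have "mcoeff (v (nat (e * j))) M \<noteq> 0" unfolding zcoeff_gamma_log by simp
  then have "nat (e * j) \<le> wdeg \<omega> M" using v by (force simp: vanishes_below_def not_less)
  moreover have "j = e * int (nat (e * j))" using \<open>e * j > 0\<close> e by (simp flip: mult.assoc)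
  ultimately show "j \<in> (\<lambda>n. e * int n) ` {1..wdeg \<omega> M}"
    by (intro image_eqI[of _ _ "nat (e * j)"]) auto
qed

lemma gamma_log_0: "mcoeff gamma_log 0 = 0"
  unfolding mcoeff_gamma_log by simp

lemma zorder_gamma_log: "zorder_ge e 1 gamma_log"
  by (simp add: zorder_ge_def zcoeff_gamma_log)

text \<open>Apply z d/dz to the exponential: by \<open>theta_mexp\<close>, the coefficient of
  \<open>z^(e * n)\<close> gives e times the recursion at n, and the sign e cancels.\<close>

lemma newton_mexp: "newton v (\<lambda>k. zcoeff (e * k) (mexp gamma_log))"
  unfolding newton_def
proof (intro conjI allI impI)
  let ?c = "\<lambda>k. zcoeff (e * k) (mexp gamma_log)"
  \<comment> \<open>The power \<open>gamma_log ^ Suc n\<close> contains only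
    \<open>z^(e * k)\<close> with k > n, so for k \<le> 0 only the leading term 1 of the exponential
    is left.\<close>
  have low: "Poly_Mapping.lookup (mcoeff (mexp gamma_log) M) (e * k) = Poly_Mapping.lookup (mcoeff 1 M) (e * k)"
    if "k \<le> 0" for k M
  proof -
    have "Poly_Mapping.lookup (mcoeff (gamma_log ^ Suc n) M) (e * k) = 0" for n
      using zorder_ge_power[OF e zorder_gamma_log, of "Suc n"] that unfolding zorder_ge_iff by auto
    then have *: "Poly_Mapping.lookup (mcoeff (scalar (1 / fact (Suc n)) * gamma_log ^ Suc n) M) (e * k) = 0" for n
      unfolding scalar_def mcoeff_const_mult lookup_single_mult by simp
    show ?thesis
      unfolding mcoeff_mexp[OF gamma_log_0 le_SucI[OF order_refl]] sum.atMost_Suc_shift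
        mcoeff_add lookup_add mcoeff_sum lookup_sum' * by simp
  qed
  show neg: "?c k = 0" if "k < 0" for k
    using low[of k] that e by (intro mps_eqI) (auto simp flip: mcoeff_zcoeff simp: zcoeff_1)
  show "?c 0 = 1"
    using low[of 0] by (intro mps_eqI) (auto simp flip: mcoeff_zcoeff simp: zcoeff_1)
  fix n :: nat assume n: "0 < n"
  show "of_nat n * ?c (int n) = (\<Sum>k=1..n. of_nat k * v k * ?c (int n - int k))"
  proof (rule mps_eqI)
    fix M
    \<comment> \<open>The range has to cover the powers of z occurring at divisors of M as well as
      all k up to n; the surplus terms k > n vanish by \<open>neg\<close>.\<close>
    let ?K = "max n (wdeg \<omega> M)"
    have th: "zcoeff (e * int k) (theta gamma_log) = of_int e * (of_nat k * v k)" if "k > 0" for k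
      using that by (simp add: zcoeff_theta zcoeff_gamma_log)
    have inj: "inj_on (\<lambda>n. e * int n) S" for S using e by (auto simp: inj_on_def)
    have "of_int e * (of_nat n * ?c (int n)) = zcoeff (e * int n) (theta gamma_log * mexp gamma_log)"
      unfolding theta_mexp[OF gamma_log_0, symmetric] zcoeff_theta by simp
    then have "mcoeff (of_int e * (of_nat n * ?c (int n))) M
      = mcoeff (zcoeff (e * int n) (theta gamma_log * mexp gamma_log)) M" by simp
    also have "\<dots> = (\<Sum>x\<in>(\<lambda>n. e * int n) ` {1..?K}.
         mcoeff (zcoeff x (theta gamma_log) * zcoeff (e * int n - x) (mexp gamma_log)) M)"
    proof (rule zcoeff_mult_finite)
      fix a b assume "a + b = M"
      then have "wdeg \<omega> a \<le> ?K" by (auto simp: wdeg_add)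
      then show "Poly_Mapping.keys (mcoeff (theta gamma_log) a) \<subseteq> (\<lambda>n. e * int n) ` {1..?K}"
        using keys_gamma_log[of a] by (fastforce simp: in_keys_iff lookup_theta)
    qed simp
    also have "\<dots> = (\<Sum>k\<in>{1..?K}. mcoeff (of_int e * (of_nat k * v k * ?c (int n - int k))) M)"
      unfolding sum.reindex[OF inj] o_def
      by (rule sum.cong[OF refl], subst th) (auto simp: mult.assoc right_diff_distrib)
    also have "\<dots> = (\<Sum>k\<in>{1..n}. mcoeff (of_int e * (of_nat k * v k * ?c (int n - int k))) M)"
      by (rule sum.mono_neutral_right) (auto simp: neg)
    also have "\<dots> = mcoeff (of_int e * (\<Sum>k=1..n. of_nat k * v k * ?c (int n - int k))) M"
      by (simp add: mcoeff_sum sum_distrib_left)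
    finally have "mcoeff (of_int e * (of_nat n * ?c (int n))) M
      = mcoeff (of_int e * (\<Sum>k=1..n. of_nat k * v k * ?c (int n - int k))) M" .
    moreover have "e = 1 \<or> e = -1" using e by (metis pos_zmult_eq_1_iff_lemma)
    ultimately show "mcoeff (of_nat n * ?c (int n)) M = mcoeff (\<Sum>k=1..n. of_nat k * v k * ?c (int n - int k)) M"
      by auto
  qed
qed

end

lemma newton_gamma:
  assumes "e * e = 1" "\<And>k. vanishes_below \<omega> k (v k)"
  shows "newton v (\<lambda>k. zcoeff (e * k) (gamma (zpow e) (\<lambda>k. embed (v k))))"
  using newton_mexp[OF assms] unfolding gamma_log_def[OF assms] gamma_def .

section \<open>Jacobi--Trudi determinants\<close>

text \<open>The size N is free so that matrices for a partition and for the same partition with a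
  row removed can be compared; from the number of parts on, the determinant no longer depends on
  N.\<close>

definition jacobi_mat :: "(int \<Rightarrow> 'a::comm_ring_1) \<Rightarrow> nat \<Rightarrow> (nat \<Rightarrow> nat) \<Rightarrow> 'a mat" where
  "jacobi_mat h N l = mat N N (\<lambda>(i, j). h (int (l i) - int i + int j))"

definition jacobi :: "(int \<Rightarrow> 'a::comm_ring_1) \<Rightarrow> (nat \<Rightarrow> nat) \<Rightarrow> 'a" where
  "jacobi h l = det (jacobi_mat h (num_parts l) l)"

lemma schur_jacobi: "schur u = jacobi (hfun u)"
  by (rule ext) (simp add: schur_def jacobi_def jacobi_mat_def)

lemma jacobi_mat_carrier [simp]: "jacobi_mat h N l \<in> carrier_mat N N"
  by (simp add: jacobi_mat_def)

text \<open>The last row is (0, ..., 0, 1), as its entries are \<open>h (j - N)\<close>.\<close>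

lemma det_jacobi_mat_Suc:
  assumes "newton u h" "l N = 0"
  shows "det (jacobi_mat h (Suc N) l) = det (jacobi_mat h N l)"
proof -
  let ?A = "jacobi_mat h (Suc N) l"
  have "det ?A = (\<Sum>j<Suc N. ?A $$ (N, j) * cofactor ?A N j)"
    by (rule laplace_expansion_row) auto
  also have "\<dots> = cofactor ?A N N"
    using assms by (simp add: jacobi_mat_def newtonD)
  also have "mat_delete ?A N N = jacobi_mat h N l"
    by (rule eq_matI) (auto simp: jacobi_mat_def mat_delete_def)
  then have "cofactor ?A N N = det (jacobi_mat h N l)"
    by (simp add: cofactor_def)
  finally show ?thesis .
qed

lemma det_jacobi_mat:
  assumes "newton u h" "l \<in> partitions" "num_parts l \<le> N"
  shows "det (jacobi_mat h N l) = jacobi h l"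
  using assms(3)
proof (induction N rule: dec_induct)
  case (step n)
  then show ?case
    using det_jacobi_mat_Suc[of u h l n, OF assms(1)] partition_zero[OF assms(2) step.hyps(1)] by simp
qed (simp add: jacobi_def)

lemma (in comm_ring_hom) hom_jacobi: "hom (jacobi h l) = jacobi (\<lambda>n. hom (h n)) l"
  unfolding jacobi_def hom_det[symmetric]
  by (rule arg_cong[of _ _ det], rule eq_matI) (auto simp: jacobi_mat_def)

definition psize :: "(nat \<Rightarrow> nat) \<Rightarrow> nat" where
  "psize l = (\<Sum>i<num_parts l. l i)"

lemma psize_eq: "l \<in> partitions \<Longrightarrow> num_parts l \<le> N \<Longrightarrow> psize l = (\<Sum>i<N. l i)"
  unfolding psize_def by (rule sum.mono_neutral_left) (auto simp: partition_zero)

lemma num_parts_le: "(\<And>i. i \<ge> N \<Longrightarrow> l i = 0) \<Longrightarrow> num_parts l \<le> N"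
  unfolding num_parts_def
  by (rule order_trans[OF card_mono[of "{..<N}"]]) (simp, intro subsetI, rule ccontr, auto)

lemma partition_nonzero:
  assumes "l \<in> partitions" "i < num_parts l"
  shows "l i \<noteq> 0"
proof
  assume "l i = 0"
  then have "l j = 0" if "j \<ge> i" for j
    using assms(1) antimonoD[of l i j] that by (auto simp: partitions_def)
  then have "num_parts l \<le> i" by (rule num_parts_le)
  then show False using assms(2) by simp
qed

lemma num_parts_le_psize: "l \<in> partitions \<Longrightarrow> num_parts l \<le> psize l"
  unfolding psize_def
  using sum_mono[of "{..<num_parts l}" "\<lambda>_. 1::nat" l] partition_nonzero by (simp add: Suc_le_eq)

lemma le_psize: "l \<in> partitions \<Longrightarrow> l i \<le> psize l"
  using partition_zero[of l i] member_le_sum[of i "{..<num_parts l}" l]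
  by (cases "i < num_parts l") (auto simp: psize_def)

text \<open>A partition of size at most K has at most K nonzero parts, each of them at most
  K.\<close>

lemma finite_partitions: "finite {l \<in> partitions. psize l \<le> K}"
proof (rule finite_subset)
  show "{l \<in> partitions. psize l \<le> K}
      \<subseteq> {l. \<forall>i. (i \<in> {..<K} \<longrightarrow> l i \<in> {..K}) \<and> (i \<notin> {..<K} \<longrightarrow> l i = 0)}"
  proof clarify
    fix l i assume l: "l \<in> partitions" and K: "psize l \<le> K"
    show "(i \<in> {..<K} \<longrightarrow> l i \<in> {..K}) \<and> (i \<notin> {..<K} \<longrightarrow> l i = 0)"
      using le_psize[OF l, of i] num_parts_le_psize[OF l] partition_zero[OF l, of i] K by auto
  qed
  show "finite \<dots>" by (rule finite_set_of_finite_funs) auto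
qed

section \<open>Substitution into polynomials\<close>

text \<open>The polynomials. On them \<open>subst\<close> is a ring homomorphism for every choice of
  \<open>\<sigma>\<close>, whatever its constant terms.\<close>

definition finsupp :: "('v, 'a::comm_ring_1) mps \<Rightarrow> bool" where
  "finsupp f \<longleftrightarrow> finite {M. mcoeff f M \<noteq> 0}"

lemma finsupp_0: "finsupp 0" and finsupp_1: "finsupp 1" and finsupp_var: "finsupp (var v)"
  by (auto simp: finsupp_def mcoeff_1 var_def)

lemma finsupp_add: "finsupp f \<Longrightarrow> finsupp g \<Longrightarrow> finsupp (f + g)"
  unfolding finsupp_def by (rule finite_subset[of _ "{M. mcoeff f M \<noteq> 0} \<union> {M. mcoeff g M \<noteq> 0}"]) auto

lemma finsupp_uminus: "finsupp f \<Longrightarrow> finsupp (- f)"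
  by (simp add: finsupp_def)

lemma mcoeff_mult_nonzero:
  assumes "mcoeff (f * g) M \<noteq> 0"
  obtains a b where "a + b = M" "mcoeff f a \<noteq> 0" "mcoeff g b \<noteq> 0"
proof -
  from assms obtain x where "x \<in> splits M" "(case x of (a, b) \<Rightarrow> mcoeff f a * mcoeff g b) \<noteq> 0"
    unfolding mcoeff_mult by (rule sum.not_neutral_contains_not_neutral)
  then show ?thesis by (intro that[of "fst x" "snd x"]) auto
qed

lemma finsupp_mult: "finsupp f \<Longrightarrow> finsupp g \<Longrightarrow> finsupp (f * g)"
  unfolding finsupp_def
  by (rule finite_subset[of _ "(\<lambda>(a, b). a + b) ` ({M. mcoeff f M \<noteq> 0} \<times> {M. mcoeff g M \<noteq> 0})"])
    (auto elim!: mcoeff_mult_nonzero)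

lemma finsupp_sum: "(\<And>i. i \<in> A \<Longrightarrow> finsupp (f i)) \<Longrightarrow> finsupp (sum f A)"
  by (induction A rule: infinite_finite_induct) (auto intro: finsupp_0 finsupp_add)

lemma finsupp_prod: "(\<And>i. i \<in> A \<Longrightarrow> finsupp (f i)) \<Longrightarrow> finsupp (prod f A)"
  by (induction A rule: infinite_finite_induct) (auto intro: finsupp_1 finsupp_mult)

lemma finsupp_of_nat: "finsupp (of_nat n)"
  by (induction n) (auto intro: finsupp_0 finsupp_1 finsupp_add)

lemma finsupp_signof: "finsupp (signof p)"
  by (auto simp: sign_def finsupp_1 finsupp_uminus)

section \<open>Substitution as a ring homomorphism on polynomials\<close>

definition monom_subst :: "('v \<Rightarrow> ('w, laurent) mps) \<Rightarrow> ('v \<Rightarrow>\<^sub>0 nat) \<Rightarrow> ('w, laurent) mps" where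
  "monom_subst \<sigma> M = (\<Prod>v \<in> Poly_Mapping.keys M. \<sigma> v ^ Poly_Mapping.lookup M v)"

lemma subst_term_monom: "subst_term f \<sigma> M = scalar (mcoeff f M) * monom_subst \<sigma> M"
  by (simp add: subst_term_def monom_subst_def)

lemma mcoeff_subst_term: "mcoeff (subst_term f \<sigma> M) N = Poly_Mapping.single 0 (mcoeff f M) * mcoeff (monom_subst \<sigma> M) N"
  by (simp add: subst_term_monom scalar_def)

lemma monom_subst_superset:
  "finite A \<Longrightarrow> Poly_Mapping.keys M \<subseteq> A \<Longrightarrow> monom_subst \<sigma> M = (\<Prod>v\<in>A. \<sigma> v ^ Poly_Mapping.lookup M v)"
  unfolding monom_subst_def by (rule prod.mono_neutral_left) (auto simp: in_keys_iff)

lemma monom_subst_add: "monom_subst \<sigma> (a + b) = monom_subst \<sigma> a * monom_subst \<sigma> b"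
proof -
  let ?A = "Poly_Mapping.keys a \<union> Poly_Mapping.keys b"
  have "monom_subst \<sigma> (a + b) = (\<Prod>v\<in>?A. \<sigma> v ^ Poly_Mapping.lookup (a + b) v)"
    by (rule monom_subst_superset) (auto simp: in_keys_iff lookup_add)
  then show ?thesis
    by (simp add: lookup_add power_add prod.distrib monom_subst_superset[of ?A])
qed

lemma scalar_0 [simp]: "scalar 0 = 0"
  by (simp add: scalar_def)

lemma scalar_sum: "scalar (sum f A) = (\<Sum>i\<in>A. scalar (f i))"
  by (induction A rule: infinite_finite_induct) (auto simp: scalar_add)

lemma scalar_uminus: "scalar (- c) = - scalar c"
  using scalar_add[of c "- c"] by (simp add: eq_neg_iff_add_eq_0 add.commute)

lemma subst_finite:
  assumes "finite B" "\<And>M. M \<notin> B \<Longrightarrow> mcoeff f M = 0"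
  shows "subst f \<sigma> = (\<Sum>M\<in>B. scalar (mcoeff f M) * monom_subst \<sigma> M)"
proof (rule mps_eqI)
  fix N
  have "mcoeff (subst f \<sigma>) N = (\<Sum>M\<in>B. mcoeff (subst_term f \<sigma> M) N)"
    unfolding subst_def by (rule mcoeff_msum) (use assms in \<open>auto simp: mcoeff_subst_term\<close>)
  then show "mcoeff (subst f \<sigma>) N = mcoeff (\<Sum>M\<in>B. scalar (mcoeff f M) * monom_subst \<sigma> M) N"
    by (simp add: mcoeff_sum subst_term_monom)
qed

lemma subst_finsupp:
  "finsupp f \<Longrightarrow> subst f \<sigma> = (\<Sum>M | mcoeff f M \<noteq> 0. scalar (mcoeff f M) * monom_subst \<sigma> M)"
  by (rule subst_finite) (auto simp: finsupp_def)

lemma subst_0: "subst 0 \<sigma> = 0" and subst_1: "subst 1 \<sigma> = 1" and subst_var: "subst (var v) \<sigma> = \<sigma> v"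
proof -
  show "subst 0 \<sigma> = 0" by (subst subst_finite[of "{}"]) auto
  show "subst 1 \<sigma> = 1" by (subst subst_finite[of "{0}"]) (auto simp: mcoeff_1 monom_subst_def)
  show "subst (var v) \<sigma> = \<sigma> v"
    by (subst subst_finite[of "{Poly_Mapping.single v 1}"]) (auto simp: var_def monom_subst_def)
qed

lemma subst_add:
  assumes "finsupp f" "finsupp g"
  shows "subst (f + g) \<sigma> = subst f \<sigma> + subst g \<sigma>"
proof -
  let ?B = "{M. mcoeff f M \<noteq> 0} \<union> {M. mcoeff g M \<noteq> 0}"
  have fin: "finite ?B" using assms by (simp add: finsupp_def)
  have "subst F \<sigma> = (\<Sum>M\<in>?B. scalar (mcoeff F M) * monom_subst \<sigma> M)" if "F \<in> {f, g, f + g}" for F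
    by (rule subst_finite[OF fin]) (use that in auto)
  then show ?thesis
    by (simp add: scalar_add distrib_right sum.distrib)
qed

lemma subst_uminus: "finsupp f \<Longrightarrow> subst (- f) \<sigma> = - subst f \<sigma>"
  by (simp add: subst_finsupp finsupp_uminus scalar_uminus sum_negf)

lemma subst_sum: "(\<And>i. i \<in> A \<Longrightarrow> finsupp (f i)) \<Longrightarrow> subst (sum f A) \<sigma> = (\<Sum>i\<in>A. subst (f i) \<sigma>)"
  by (induction A rule: infinite_finite_induct) (auto simp: subst_0 subst_add finsupp_sum)

text \<open>Both sides are sums over pairs of exponents from the two supports; on the left the pairs
  are grouped by their sum.\<close>

lemma subst_mult:
  assumes f: "finsupp f" and g: "finsupp g"
  shows "subst (f * g) \<sigma> = subst f \<sigma> * subst g \<sigma>"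
proof -
  let ?A = "{M. mcoeff f M \<noteq> 0}" and ?B = "{M. mcoeff g M \<noteq> 0}"
  let ?C = "(\<lambda>(a, b). a + b) ` (?A \<times> ?B)"
  have fin: "finite (?A \<times> ?B)" using assms by (simp add: finsupp_def)
  have co: "mcoeff (f * g) M = (\<Sum>(a, b)\<in>{x \<in> ?A \<times> ?B. fst x + snd x = M}. mcoeff f a * mcoeff g b)" for M
    unfolding mcoeff_mult by (rule sum.mono_neutral_right) auto
  have "subst (f * g) \<sigma> = (\<Sum>M\<in>?C. scalar (mcoeff (f * g) M) * monom_subst \<sigma> M)"
  proof (rule subst_finite)
    fix M assume "M \<notin> ?C"
    then show "mcoeff (f * g) M = 0"
      by (rule contrapos_np) (auto elim!: mcoeff_mult_nonzero)
  qed (use fin in simp)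
  also have "\<dots> = (\<Sum>M\<in>?C. \<Sum>x\<in>{x \<in> ?A \<times> ?B. (case x of (a, b) \<Rightarrow> a + b) = M}.
      scalar (mcoeff f (fst x)) * monom_subst \<sigma> (fst x) * (scalar (mcoeff g (snd x)) * monom_subst \<sigma> (snd x)))"
    unfolding co scalar_sum sum_distrib_right
    by (intro sum.cong) (auto simp: scalar_mult monom_subst_add case_prod_unfold ac_simps)
  also have "\<dots> = (\<Sum>x\<in>?A \<times> ?B.
      scalar (mcoeff f (fst x)) * monom_subst \<sigma> (fst x) * (scalar (mcoeff g (snd x)) * monom_subst \<sigma> (snd x)))"
    by (rule sum.image_gen[OF fin, symmetric])
  also have "\<dots> = subst f \<sigma> * subst g \<sigma>"
    unfolding subst_finsupp[OF f] subst_finsupp[OF g] sum_product sum.cartesian_product by (simp add: case_prod_unfold)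
  finally show ?thesis .
qed

lemma subst_prod: "(\<And>i. i \<in> A \<Longrightarrow> finsupp (f i)) \<Longrightarrow> subst (prod f A) \<sigma> = (\<Prod>i\<in>A. subst (f i) \<sigma>)"
  by (induction A rule: infinite_finite_induct) (auto simp: subst_1 subst_mult finsupp_prod)

lemma subst_of_nat: "subst (of_nat n) \<sigma> = of_nat n"
  by (induction n) (auto simp: subst_0 subst_1 subst_add finsupp_1 finsupp_of_nat)

lemma subst_signof: "subst (signof p) \<sigma> = signof p"
  by (auto simp: sign_def subst_1 subst_uminus finsupp_1)

lemma finsupp_jacobi:
  assumes "\<And>n. finsupp (h n)"
  shows "finsupp (jacobi h l)"
  unfolding jacobi_def det_def'[OF jacobi_mat_carrier]
proof (rule finsupp_sum)
  fix p assume "p \<in> {p. p permutes {0..<num_parts l}}"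
  then have "p permutes {0..<num_parts l}" by simp
  from permutes_in_image[OF this]
  show "finsupp (signof p * (\<Prod>i = 0..<num_parts l. jacobi_mat h (num_parts l) l $$ (i, p i)))"
    by (intro finsupp_mult finsupp_signof finsupp_prod) (simp add: jacobi_mat_def assms)
qed

lemma subst_jacobi:
  assumes h: "\<And>n. finsupp (h n)"
  shows "subst (jacobi h l) \<sigma> = jacobi (\<lambda>n. subst (h n) \<sigma>) l"
proof -
  have "subst (signof p * (\<Prod>i = 0..<num_parts l. jacobi_mat h (num_parts l) l $$ (i, p i))) \<sigma>
     = signof p * (\<Prod>i = 0..<num_parts l. jacobi_mat (\<lambda>n. subst (h n) \<sigma>) (num_parts l) l $$ (i, p i))"
     "finsupp (signof p * (\<Prod>i = 0..<num_parts l. jacobi_mat h (num_parts l) l $$ (i, p i)))"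
    if "p permutes {0..<num_parts l}" for p
    using permutes_in_image[OF that]
    by (simp_all add: jacobi_mat_def subst_mult subst_prod subst_signof finsupp_mult finsupp_prod finsupp_signof h)
  then show ?thesis
    unfolding jacobi_def det_def'[OF jacobi_mat_carrier] by (subst subst_sum) auto
qed

text \<open>By the recursion \<open>m * h m\<close> is a polynomial, and dividing by the nonzero
  number m keeps the support.\<close>

lemma finsupp_newton:
  fixes u :: "nat \<Rightarrow> ('v, rat) mps"
  assumes h: "newton u h" and u: "\<And>k. finsupp (u k)"
  shows "finsupp (h n)"
proof -
  have "finsupp (h (int m))" for m
  proof (induction m rule: less_induct)
    case (less m)
    show ?case
    proof (cases "m = 0")
      case False
      have "finsupp (h (int m - int k))" if "k \<in> {1..m}" for k
        using less[of "m - k"] that by (simp add: of_nat_diff)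
      then have "finsupp (of_nat m * h (int m))"
        using newtonD(3)[OF h, of m] False
        by (auto intro!: finsupp_sum finsupp_mult finsupp_of_nat u)
      then show ?thesis using False by (simp add: finsupp_def of_nat_mult_mps)
    qed (simp add: newtonD(2)[OF h] finsupp_1)
  qed
  from this[of "nat n"] show ?thesis
    using newtonD(1)[OF h, of n] finsupp_0 by (cases "n < 0") auto
qed

text \<open>A ring homomorphism preserves the recursion. Together with \<open>newton_unique\<close>
  this evaluates complete functions at z-dependent arguments without summing an exponential.\<close>

lemma subst_newton:
  fixes u :: "nat \<Rightarrow> ('v, rat) mps"
  assumes h: "newton u h" and u: "\<And>k. finsupp (u k)"
  shows "newton (\<lambda>k. subst (u k) \<sigma>) (\<lambda>n. subst (h n) \<sigma>)"
  unfolding newton_def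
proof (intro conjI allI impI)
  fix n :: nat assume "0 < n"
  have s: "subst (of_nat k * f) \<sigma> = of_nat k * subst f \<sigma>" if "finsupp f" for k f
    using that by (simp add: subst_mult finsupp_of_nat subst_of_nat)
  note hf = finsupp_newton[OF h u]
  have "of_nat n * subst (h (int n)) \<sigma> = subst (of_nat n * h (int n)) \<sigma>"
    by (simp add: s hf)
  also have "\<dots> = (\<Sum>k=1..n. of_nat k * subst (u k) \<sigma> * subst (h (int n - int k)) \<sigma>)"
    unfolding newtonD(3)[OF h \<open>0 < n\<close>]
    by (subst subst_sum) (auto simp: subst_of_nat subst_mult finsupp_mult finsupp_of_nat u hf)
  finally show "of_nat n * subst (h (int n)) \<sigma> = \<dots>" .
qed (simp_all add: newtonD[OF h] subst_0 subst_1)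

section \<open>Homogeneity\<close>

text \<open>The degree is an integer so that \<open>h n\<close> can be given a degree proportional
  to n for negative n too, where it is 0 and homogeneous of every degree.\<close>

definition whomog :: "('v \<Rightarrow> nat) \<Rightarrow> int \<Rightarrow> ('v, 'a::comm_ring_1) mps \<Rightarrow> bool" where
  "whomog \<omega> n f \<longleftrightarrow> (\<forall>M. mcoeff f M \<noteq> 0 \<longrightarrow> int (wdeg \<omega> M) = n)"

lemma whomog_0: "whomog \<omega> n 0" and whomog_1: "whomog \<omega> 0 1"
  by (auto simp: whomog_def mcoeff_1)

lemma whomog_var: "n = int (\<omega> v) \<Longrightarrow> whomog \<omega> n (var v)"
  by (auto simp: whomog_def var_def)

lemma whomog_mult: "whomog \<omega> m f \<Longrightarrow> whomog \<omega> n g \<Longrightarrow> whomog \<omega> (m + n) (f * g)"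
  unfolding whomog_def by (auto elim!: mcoeff_mult_nonzero simp: wdeg_add)

lemma whomog_of_nat: "whomog \<omega> 0 (of_nat k :: ('v, 'a::comm_ring_1) mps)"
  using of_nat_mult_mps[of k "1 :: ('v, 'a) mps"] by (auto simp: whomog_def mcoeff_1 split: if_splits)

lemma whomog_signof: "whomog \<omega> 0 (signof p)"
  by (auto simp: whomog_def mcoeff_1 sign_def)

lemma whomog_sum: "(\<And>i. i \<in> A \<Longrightarrow> whomog \<omega> n (f i)) \<Longrightarrow> whomog \<omega> n (sum f A)"
  unfolding whomog_def mcoeff_sum by (metis (no_types, lifting) sum.not_neutral_contains_not_neutral)

lemma whomog_prod: "(\<And>i. i \<in> A \<Longrightarrow> whomog \<omega> (n i) (f i)) \<Longrightarrow> whomog \<omega> (sum n A) (prod f A)"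
  by (induction A rule: infinite_finite_induct) (auto intro: whomog_1 whomog_mult)

text \<open>The factor c is 1 for a weight that counts the variables in u, and 0 for one that
  ignores them. Index 0 is excluded because \<open>wt\<close> and \<open>wt'\<close> give weight 1
  to the variables \<open>T 0\<close> and \<open>T' 0\<close>.\<close>

lemma whomog_newton:
  fixes u :: "nat \<Rightarrow> ('v, rat) mps"
  assumes h: "newton u h" and u: "\<And>k. k > 0 \<Longrightarrow> whomog \<omega> (c * int k) (u k)"
  shows "whomog \<omega> (c * n) (h n)"
proof -
  have "whomog \<omega> (c * int m) (h (int m))" for m
  proof (induction m rule: less_induct)
    case (less m)
    show ?case
    proof (cases "m = 0")
      case False
      have "whomog \<omega> (0 + c * int k + c * (int m - int k)) (of_nat k * u k * h (int m - int k))" if "k \<in> {1..m}" for k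
        using less[of "m - k"] that
        by (intro whomog_mult whomog_of_nat u) (simp_all add: of_nat_diff)
      then have "whomog \<omega> (c * int m) (of_nat m * h (int m))"
        using newtonD(3)[OF h, of m] False by (auto intro!: whomog_sum simp: algebra_simps)
      then show ?thesis using False by (simp add: whomog_def of_nat_mult_mps)
    qed (simp add: newtonD(2)[OF h] whomog_1)
  qed
  from this[of "nat n"] show ?thesis
    using newtonD(1)[OF h, of n] whomog_0 by (cases "n < 0") auto
qed

lemma whomog_jacobi:
  assumes h: "\<And>n. whomog \<omega> (c * n) (h n)"
  shows "whomog \<omega> (c * int (psize l)) (jacobi h l)"
  unfolding jacobi_def det_def'[OF jacobi_mat_carrier]
proof (rule whomog_sum)
  fix p assume "p \<in> {p. p permutes {0..<num_parts l}}"
  then have p: "p permutes {0..<num_parts l}" by simp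
  \<comment> \<open>The term of the Leibniz formula for p has degree c times the sum of
    \<open>l i - i + p i\<close>; the index shifts cancel since p is a permutation.\<close>
  have "(\<Sum>i=0..<num_parts l. int (p i)) = (\<Sum>i=0..<num_parts l. int i)"
    by (rule sum.permute[OF p, of int, unfolded o_def, symmetric])
  then have s: "(\<Sum>i=0..<num_parts l. c * (int (l i) - int i + int (p i))) = c * int (psize l)"
    by (simp add: psize_def sum_distrib_left[symmetric] sum.distrib sum_subtractf lessThan_atLeast0)
  have "whomog \<omega> (0 + (\<Sum>i=0..<num_parts l. c * (int (l i) - int i + int (p i))))
     (signof p * (\<Prod>i = 0..<num_parts l. jacobi_mat h (num_parts l) l $$ (i, p i)))"
    using permutes_in_image[OF p]
    by (intro whomog_mult whomog_signof whomog_prod) (auto simp: jacobi_mat_def h)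
  then show "whomog \<omega> (c * int (psize l))
     (signof p * (\<Prod>i = 0..<num_parts l. jacobi_mat h (num_parts l) l $$ (i, p i)))"
    unfolding s by simp
qed

lemma vanishes_below_monom_subst:
  assumes "\<And>v. vanishes_below \<omega>' (\<omega> v) (\<sigma> v)"
  shows "vanishes_below \<omega>' (wdeg \<omega> M) (monom_subst \<sigma> M)"
  unfolding wdeg_def monom_subst_def
  by (rule vanishes_below_prod, subst mult.commute, rule vanishes_below_power, rule assms)

lemma vanishes_below_subst:
  assumes "finsupp f" "whomog \<omega> (int n) f" "\<And>v. vanishes_below \<omega>' (\<omega> v) (\<sigma> v)"
  shows "vanishes_below \<omega>' n (subst f \<sigma>)"
  unfolding subst_finsupp[OF assms(1)]
proof (rule vanishes_below_sum)
  fix M assume "M \<in> {M. mcoeff f M \<noteq> 0}"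
  then have "wdeg \<omega> M = n" using assms(2) by (auto simp: whomog_def)
  then show "vanishes_below \<omega>' n (scalar (mcoeff f M) * monom_subst \<sigma> M)"
    using vanishes_below_mult_left[OF vanishes_below_monom_subst[of \<omega>' \<omega> \<sigma> M, OF assms(3)]] by metis
qed

section \<open>Infinite sums\<close>

lemma msummable_weight:
  assumes "\<And>i. i \<in> A \<Longrightarrow> vanishes_below \<omega> (n i) (f i)" "\<And>K. finite {i \<in> A. n i \<le> K}"
  shows "msummable f A"
  unfolding msummable_def
proof
  fix M
  have "{i \<in> A. mcoeff (f i) M \<noteq> 0} \<subseteq> {i \<in> A. n i \<le> wdeg \<omega> M}"
    using assms(1) by (auto simp: vanishes_below_def intro: leI)
  then show "finite {i \<in> A. mcoeff (f i) M \<noteq> 0}"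
    using assms(2) by (rule finite_subset)
qed

lemma msum_neutral:
  assumes "A \<subseteq> B" "\<And>i. i \<in> B - A \<Longrightarrow> f i = 0"
  shows "msum f A = msum f B"
proof -
  have "{i. i \<in> A \<and> mcoeff (f i) M \<noteq> 0} = {i. i \<in> B \<and> mcoeff (f i) M \<noteq> 0}" for M
  proof (intro Collect_cong iffI)
    fix i assume "i \<in> B \<and> mcoeff (f i) M \<noteq> 0"
    then show "i \<in> A \<and> mcoeff (f i) M \<noteq> 0" using assms(2)[of i] by (cases "i \<in> A") auto
  qed (use assms(1) in auto)
  then show ?thesis by (simp add: msum_def)
qed

lemma msum_cong:
  assumes "\<And>i. i \<in> A \<Longrightarrow> f i = g i"
  shows "msum f A = msum g A"
proof -
  have "{i. i \<in> A \<and> mcoeff (f i) M \<noteq> 0} = {i. i \<in> A \<and> mcoeff (g i) M \<noteq> 0}" for M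
    using assms by auto
  then show ?thesis using assms by (auto simp: msum_def intro!: arg_cong[of _ _ mps] sum.cong)
qed

lemma msum_add:
  assumes "msummable f A" "msummable g A"
  shows "msum (\<lambda>i. f i + g i) A = msum f A + msum g A"
proof (rule mps_eqI)
  fix M
  let ?B = "{i \<in> A. mcoeff (f i) M \<noteq> 0} \<union> {i \<in> A. mcoeff (g i) M \<noteq> 0}"
  have fin: "finite ?B" using assms by (simp add: msummable_def)
  have "mcoeff (msum F A) M = (\<Sum>i\<in>?B. mcoeff (F i) M)" if "F \<in> {f, g, \<lambda>i. f i + g i}" for F
    by (rule mcoeff_msum[OF fin]) (use that in auto)
  then show "mcoeff (msum (\<lambda>i. f i + g i) A) M = mcoeff (msum f A + msum g A) M"
    by (simp add: sum.distrib)
qed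

lemma msum_reindex:
  assumes "inj_on h A"
  shows "msum f (h ` A) = msum (\<lambda>i. f (h i)) A"
proof (rule mps_eqI)
  fix M
  have *: "{i. i \<in> h ` A \<and> mcoeff (f i) M \<noteq> 0} = h ` {i. i \<in> A \<and> mcoeff (f (h i)) M \<noteq> 0}" by auto
  show "mcoeff (msum f (h ` A)) M = mcoeff (msum (\<lambda>i. f (h i)) A) M"
    unfolding msum_def mcoeff_mps *
    by (subst sum.reindex) (use assms in \<open>auto simp: inj_on_def\<close>)
qed

lemma msummable_mult:
  assumes "msummable f A" "msummable g B"
  shows "msummable (\<lambda>(i, j). f i * g j) (A \<times> B)"
  unfolding msummable_def
proof
  fix M
  have "{x \<in> A \<times> B. mcoeff (case x of (i, j) \<Rightarrow> f i * g j) M \<noteq> 0}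
      \<subseteq> (\<Union>(a, b)\<in>splits M. {i \<in> A. mcoeff (f i) a \<noteq> 0} \<times> {j \<in> B. mcoeff (g j) b \<noteq> 0})"
    by (auto elim!: mcoeff_mult_nonzero)
  then show "finite {x \<in> A \<times> B. mcoeff (case x of (i, j) \<Rightarrow> f i * g j) M \<noteq> 0}"
    by (rule finite_subset) (use assms in \<open>auto simp: msummable_def\<close>)
qed

lemma msum_mult_left:
  assumes f: "msummable f A"
  shows "msum (\<lambda>i. c * f i) A = c * msum f A"
proof (rule mps_eqI)
  fix M
  let ?B = "\<Union>(a, b)\<in>splits M. {i \<in> A. mcoeff (f i) b \<noteq> 0}"
  have fin: "finite ?B" using f by (auto simp: msummable_def)
  have "mcoeff (msum (\<lambda>i. c * f i) A) M = (\<Sum>i\<in>?B. mcoeff (c * f i) M)"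
  proof (rule mcoeff_msum[OF fin])
    fix i assume "i \<in> A - ?B"
    then show "mcoeff (c * f i) M = 0"
      by (intro ccontr[of "mcoeff (c * f i) M = 0"]) (auto elim!: mcoeff_mult_nonzero)
  qed auto
  also have "\<dots> = (\<Sum>(a, b)\<in>splits M. mcoeff c a * (\<Sum>i\<in>?B. mcoeff (f i) b))"
    unfolding mcoeff_mult by (subst sum.swap) (simp add: sum_distrib_left case_prod_unfold)
  also have "\<dots> = (\<Sum>(a, b)\<in>splits M. mcoeff c a * mcoeff (msum f A) b)"
  proof (rule sum.cong[OF refl])
    fix x assume x: "x \<in> splits M"
    have "mcoeff (msum f A) (snd x) = (\<Sum>i\<in>?B. mcoeff (f i) (snd x))"
      by (rule mcoeff_msum[OF fin]) (use x in force)+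
    then show "(case x of (a, b) \<Rightarrow> mcoeff c a * (\<Sum>i\<in>?B. mcoeff (f i) b)) = (case x of (a, b) \<Rightarrow> mcoeff c a * mcoeff (msum f A) b)"
      by (simp add: case_prod_unfold)
  qed
  finally show "mcoeff (msum (\<lambda>i. c * f i) A) M = mcoeff (c * msum f A) M"
    unfolding mcoeff_mult .
qed

text \<open>Fubini: the coefficient of M sees only the finite set \<open>S M\<close> of pairs, and
  rows that miss this set contribute 0.\<close>

lemma msum_Sigma:
  assumes f: "msummable (\<lambda>(i, j). f i j) (Sigma A B)"
  shows "msummable (\<lambda>i. msum (f i) (B i)) A"
    "msum (\<lambda>i. msum (f i) (B i)) A = msum (\<lambda>(i, j). f i j) (Sigma A B)"
proof -
  define S where "S = (\<lambda>M. {x \<in> Sigma A B. mcoeff (f (fst x) (snd x)) M \<noteq> 0})"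
  have S: "finite (S M)" for M
    using f by (auto simp: S_def msummable_def case_prod_unfold)
  have inner: "mcoeff (msum (f i) (B i)) M = (\<Sum>j | (i, j) \<in> S M. mcoeff (f i j) M)" if "i \<in> A" for i M
  proof (rule mcoeff_msum)
    have "{j. (i, j) \<in> S M} \<subseteq> snd ` S M" by force
    then show "finite {j. (i, j) \<in> S M}" using S finite_subset by blast
  qed (use that in \<open>auto simp: S_def\<close>)
  have z: "mcoeff (msum (f i) (B i)) M = 0" if "i \<in> A" "i \<notin> fst ` S M" for i M
  proof -
    have "{j. (i, j) \<in> S M} = {}" using that(2) by force
    then show ?thesis using inner[OF that(1)] by simp
  qed
  have sub: "fst ` S M \<subseteq> A" for M by (auto simp: S_def)
  show "msummable (\<lambda>i. msum (f i) (B i)) A"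
    unfolding msummable_def
  proof
    fix M
    have "{i \<in> A. mcoeff (msum (f i) (B i)) M \<noteq> 0} \<subseteq> fst ` S M" using z by blast
    then show "finite {i \<in> A. mcoeff (msum (f i) (B i)) M \<noteq> 0}" using S finite_subset by blast
  qed
  show "msum (\<lambda>i. msum (f i) (B i)) A = msum (\<lambda>(i, j). f i j) (Sigma A B)"
  proof (rule mps_eqI)
    fix M
    have "mcoeff (msum (\<lambda>i. msum (f i) (B i)) A) M = (\<Sum>i\<in>fst ` S M. mcoeff (msum (f i) (B i)) M)"
      by (rule mcoeff_msum) (use S sub z in auto)
    also have "\<dots> = (\<Sum>i\<in>fst ` S M. \<Sum>j | (i, j) \<in> S M. mcoeff (f i j) M)"
      by (rule sum.cong) (use sub inner in auto)
    also have "\<dots> = (\<Sum>(i, j)\<in>Sigma (fst ` S M) (\<lambda>i. {j. (i, j) \<in> S M}). mcoeff (f i j) M)"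
    proof (rule sum.Sigma)
      have "{j. (i, j) \<in> S M} \<subseteq> snd ` S M" for i by force
      then show "\<forall>i\<in>fst ` S M. finite {j. (i, j) \<in> S M}" using S finite_subset by blast
    qed (use S in simp)
    also have "Sigma (fst ` S M) (\<lambda>i. {j. (i, j) \<in> S M}) = S M" by force
    also have "(\<Sum>(i, j)\<in>S M. mcoeff (f i j) M) = (\<Sum>x\<in>S M. mcoeff (case x of (i, j) \<Rightarrow> f i j) M)"
      by (simp add: case_prod_unfold)
    also have "\<dots> = mcoeff (msum (\<lambda>(i, j). f i j) (Sigma A B)) M"
      by (rule mcoeff_msum[symmetric]) (use S in \<open>auto simp: S_def\<close>)
    finally show "mcoeff (msum (\<lambda>i. msum (f i) (B i)) A) M = mcoeff (msum (\<lambda>(i, j). f i j) (Sigma A B)) M" .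
  qed
qed

lemma msum_mult:
  assumes "msummable f A" "msummable g B"
  shows "msum f A * msum g B = msum (\<lambda>(i, j). f i * g j) (A \<times> B)"
proof -
  have "msum (\<lambda>(i, j). f i * g j) (A \<times> B) = msum (\<lambda>i. msum (\<lambda>j. f i * g j) B) A"
    by (rule msum_Sigma(2)[symmetric]) (rule msummable_mult[OF assms])
  also have "\<dots> = msum (\<lambda>i. msum g B * f i) A"
    by (rule msum_cong) (simp add: msum_mult_left[OF assms(2)] mult.commute)
  also have "\<dots> = msum g B * msum f A" by (rule msum_mult_left[OF assms(1)])
  finally show ?thesis by (simp add: mult.commute)
qed

lemma zcoeff_msum:
  assumes f: "msummable f A"
  shows "msummable (\<lambda>i. zcoeff k (f i)) A" "zcoeff k (msum f A) = msum (\<lambda>i. zcoeff k (f i)) A"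
proof -
  have fin: "finite {i \<in> A. mcoeff (f i) M \<noteq> 0}" for M using f by (simp add: msummable_def)
  show "msummable (\<lambda>i. zcoeff k (f i)) A"
    unfolding msummable_def
  proof
    fix M
    show "finite {i \<in> A. mcoeff (zcoeff k (f i)) M \<noteq> 0}"
      by (rule finite_subset[OF _ fin[of M]]) auto
  qed
  show "zcoeff k (msum f A) = msum (\<lambda>i. zcoeff k (f i)) A"
  proof (rule mps_eqI)
    fix M
    have "mcoeff (zcoeff k (msum f A)) M = (\<Sum>i | i \<in> A \<and> mcoeff (f i) M \<noteq> 0. mcoeff (zcoeff k (f i)) M)"
      by (simp add: msum_def lookup_sum')
    also have "\<dots> = mcoeff (msum (\<lambda>i. zcoeff k (f i)) A) M"
      by (rule mcoeff_msum[symmetric]) (use fin in auto)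
    finally show "mcoeff (zcoeff k (msum f A)) M = \<dots>" .
  qed
qed

text \<open>Each product is a power of z times a series free of z, which is what the hypothesis
  \<open>C\<close> expresses. Extracting the coefficient of \<open>z^d\<close> therefore selects the
  pairs with exponent d.\<close>

lemma zcoeff_bilinear:
  assumes F: "msummable F I" and H: "msummable H J"
    and FH: "\<And>x y. x \<in> I \<Longrightarrow> y \<in> J \<Longrightarrow> F x * H y = zpow (e (x, y)) * C (x, y)"
    and C: "\<And>z d. zcoeff d (C z) = (if d = 0 then zcoeff 0 (C z) else 0)"
  shows "zcoeff d (msum F I * msum H J) = msum (\<lambda>z. zcoeff 0 (C z)) {z \<in> I \<times> J. e z = d}"
proof -
  let ?f = "\<lambda>z. zcoeff d (zpow (e z) * C z)"
  have f: "?f z = (if e z = d then zcoeff 0 (C z) else 0)" for z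
    unfolding zcoeff_zpow_mult using C[of "d - e z" z] by auto
  have "zcoeff d (msum F I * msum H J) = msum (\<lambda>z. zcoeff d (case z of (x, y) \<Rightarrow> F x * H y)) (I \<times> J)"
    unfolding msum_mult[OF F H] by (rule zcoeff_msum(2)[OF msummable_mult[OF F H]])
  also have "\<dots> = msum ?f (I \<times> J)"
    by (rule msum_cong) (auto simp: FH)
  also have "\<dots> = msum ?f {z \<in> I \<times> J. e z = d}"
    by (rule msum_neutral[symmetric]) (auto simp: f)
  also have "\<dots> = msum (\<lambda>z. zcoeff 0 (C z)) {z \<in> I \<times> J. e z = d}"
  proof (rule msum_cong)
    fix z assume "z \<in> {z \<in> I \<times> J. e z = d}"
    then show "?f z = zcoeff 0 (C z)" using f[of z] by simp
  qed
  finally show ?thesis .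
qed

text \<open>The hypothesis \<open>fin\<close> bounds index and monomial jointly, so
  \<open>msum_Sigma\<close> applies in both orders: with the monomials outside it gives the
  substituted sum, with the indices outside the sum of the substituted terms.\<close>

lemma subst_msum:
  assumes F: "msummable F A"
    and fin: "\<And>N. finite {(i, M). i \<in> A \<and> mcoeff (subst_term (F i) \<sigma> M) N \<noteq> 0}"
  shows "substitutable (msum F A) \<sigma>" "subst (msum F A) \<sigma> = msum (\<lambda>i. subst (F i) \<sigma>) A"
    "msummable (\<lambda>i. subst (F i) \<sigma>) A"
proof -
  have st: "subst_term (msum F A) \<sigma> M = msum (\<lambda>i. subst_term (F i) \<sigma> M) A" for M
  proof (rule mps_eqI)
    fix N
    let ?S = "{i. i \<in> A \<and> mcoeff (F i) M \<noteq> 0}"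
    have "mcoeff (subst_term (msum F A) \<sigma> M) N = (\<Sum>i\<in>?S. mcoeff (subst_term (F i) \<sigma> M) N)"
      by (simp add: mcoeff_subst_term msum_def single_sum sum_distrib_right)
    also have "\<dots> = mcoeff (msum (\<lambda>i. subst_term (F i) \<sigma> M) A) N"
      by (rule mcoeff_msum[symmetric]) (use F in \<open>auto simp: mcoeff_subst_term msummable_def\<close>)
    finally show "mcoeff (subst_term (msum F A) \<sigma> M) N = mcoeff (msum (\<lambda>i. subst_term (F i) \<sigma> M) A) N" .
  qed
  have *: "{x \<in> A \<times> UNIV. mcoeff (case x of (i, M) \<Rightarrow> subst_term (F i) \<sigma> M) N \<noteq> 0}
      = {(i, M). i \<in> A \<and> mcoeff (subst_term (F i) \<sigma> M) N \<noteq> 0}" for N by auto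
  have s1: "msummable (\<lambda>(i, M). subst_term (F i) \<sigma> M) (A \<times> UNIV)"
    unfolding msummable_def * using fin by simp
  have sw: "{x \<in> UNIV \<times> A. mcoeff (case x of (M, i) \<Rightarrow> subst_term (F i) \<sigma> M) N \<noteq> 0}
      = prod.swap ` {(i, M). i \<in> A \<and> mcoeff (subst_term (F i) \<sigma> M) N \<noteq> 0}" for N by auto
  have s2: "msummable (\<lambda>(M, i). subst_term (F i) \<sigma> M) (UNIV \<times> A)"
    unfolding msummable_def sw using fin by simp
  show "substitutable (msum F A) \<sigma>"
    unfolding substitutable_def st by (rule msum_Sigma(1)[OF s2])
  show "msummable (\<lambda>i. subst (F i) \<sigma>) A"
    unfolding subst_def by (rule msum_Sigma(1)[OF s1])
  have "subst (msum F A) \<sigma> = msum (\<lambda>(M, i). subst_term (F i) \<sigma> M) (UNIV \<times> A)"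
    unfolding subst_def st by (rule msum_Sigma(2)[OF s2])
  also have "UNIV \<times> A = prod.swap ` (A \<times> UNIV)" by auto
  also have "msum (\<lambda>(M, i). subst_term (F i) \<sigma> M) (prod.swap ` (A \<times> UNIV)) = msum (\<lambda>(i, M). subst_term (F i) \<sigma> M) (A \<times> UNIV)"
    by (subst msum_reindex) (auto simp: case_prod_unfold)
  also have "\<dots> = msum (\<lambda>i. subst (F i) \<sigma>) A"
    unfolding subst_def by (rule msum_Sigma(2)[OF s1, symmetric])
  finally show "subst (msum F A) \<sigma> = msum (\<lambda>i. subst (F i) \<sigma>) A" .
qed

section \<open>The Schur measure\<close>

text \<open>The variables \<open>t\<^sub>0\<close> and \<open>t'\<^sub>0\<close>, which occur in no Schur function, get weight \<open>1\<close>: with positive weights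
  there are only finitely many monomials of bounded weight.\<close>

fun wt :: "tvar \<Rightarrow> nat" where
  "wt (T k) = max 1 k"
| "wt (T' k) = 0"

fun wt' :: "tvar \<Rightarrow> nat" where
  "wt' (T k) = 0"
| "wt' (T' k) = max 1 k"

lemma finite_wdeg:
  assumes "\<And>v. \<omega> v > 0" "\<And>K. finite {v. \<omega> v \<le> K}"
  shows "finite {M. wdeg \<omega> M \<le> K}"
proof -
  let ?F = "{f. \<forall>v. (v \<in> {v. \<omega> v \<le> K} \<longrightarrow> f v \<in> {..K}) \<and> (v \<notin> {v. \<omega> v \<le> K} \<longrightarrow> f v = 0)}"
  have "finite ?F" by (rule finite_set_of_finite_funs[OF assms(2) finite_atMost])
  moreover have "Poly_Mapping.lookup ` {M. wdeg \<omega> M \<le> K} \<subseteq> ?F"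
  proof (rule image_subsetI, rule CollectI, rule allI)
    fix M v assume "M \<in> {M. wdeg \<omega> M \<le> K}"
    then have M: "wdeg \<omega> M \<le> K" by simp
    have l: "\<omega> v * Poly_Mapping.lookup M v \<le> K" if "v \<in> Poly_Mapping.keys M"
      using M member_le_sum[OF that, of "\<lambda>v. \<omega> v * Poly_Mapping.lookup M v"]
      by (simp add: wdeg_def)
    show "(v \<in> {v. \<omega> v \<le> K} \<longrightarrow> Poly_Mapping.lookup M v \<in> {..K}) \<and> (v \<notin> {v. \<omega> v \<le> K} \<longrightarrow> Poly_Mapping.lookup M v = 0)"
    proof (cases "v \<in> Poly_Mapping.keys M")
      case True
      have "Poly_Mapping.lookup M v \<le> \<omega> v * Poly_Mapping.lookup M v" using assms(1)[of v] by simp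
      moreover have "\<omega> v * 1 \<le> \<omega> v * Poly_Mapping.lookup M v"
        using True by (intro mult_le_mono2) (simp add: in_keys_iff Suc_le_eq)
      ultimately show ?thesis using order_trans[OF _ l[OF True]] by simp
    qed (simp add: in_keys_iff)
  qed
  ultimately have "finite (Poly_Mapping.lookup ` {M. wdeg \<omega> M \<le> K})" by (rule finite_subset[rotated])
  then show ?thesis by (rule finite_imageD) (auto intro: inj_onI poly_mapping_eqI)
qed

text \<open>Neither weight is positive on all variables, but their sum is, and it is bounded on
  finitely many variables only.\<close>

lemma finite_wdeg_wt: "finite {M. wdeg wt M \<le> K \<and> wdeg wt' M \<le> K}"
proof -
  have "wdeg (\<lambda>v. wt v + wt' v) M = wdeg wt M + wdeg wt' M" for M
    by (simp add: wdeg_def distrib_right sum.distrib)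
  then have "{M. wdeg wt M \<le> K \<and> wdeg wt' M \<le> K} \<subseteq> {M. wdeg (\<lambda>v. wt v + wt' v) M \<le> 2 * K}" by auto
  moreover have "finite {M. wdeg (\<lambda>v. wt v + wt' v) M \<le> 2 * K}"
  proof (rule finite_wdeg)
    show "0 < wt v + wt' v" for v by (cases v) auto
    have "{v. wt v + wt' v \<le> K} \<subseteq> T ` {..K} \<union> T' ` {..K}" for K
    proof
      fix v assume "v \<in> {v. wt v + wt' v \<le> K}"
      then show "v \<in> T ` {..K} \<union> T' ` {..K}" by (cases v) auto
    qed
    then show "finite {v. wt v + wt' v \<le> K}" for K by (rule finite_subset) auto
  qed
  ultimately show ?thesis by (rule finite_subset)
qed

lemma newton_hfun_T: "newton (\<lambda>k. var (T k)) (hfun (\<lambda>k. var (T k)))"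
  using newton_gamma[of 1 wt "\<lambda>k. var (T k)"] by (simp add: hfun_def[abs_def] vanishes_below_var)

lemma newton_hfun_T': "newton (\<lambda>k. var (T' k)) (hfun (\<lambda>k. var (T' k)))"
  using newton_gamma[of 1 wt' "\<lambda>k. var (T' k)"] by (simp add: hfun_def[abs_def] vanishes_below_var)

lemma finsupp_schur: "finsupp (schur_x l)" "finsupp (schur_y l)"
  unfolding schur_jacobi
  by (auto intro!: finsupp_jacobi finsupp_newton[OF newton_hfun_T] finsupp_newton[OF newton_hfun_T'] finsupp_var)

lemma whomog_schur:
  "whomog wt (int (psize l)) (schur_x l)" "whomog wt' 0 (schur_x l)"
  "whomog wt 0 (schur_y l)" "whomog wt' (int (psize l)) (schur_y l)"
  using whomog_jacobi[OF whomog_newton[OF newton_hfun_T], of wt 1]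
    whomog_jacobi[OF whomog_newton[OF newton_hfun_T], of wt' 0]
    whomog_jacobi[OF whomog_newton[OF newton_hfun_T'], of wt 0]
    whomog_jacobi[OF whomog_newton[OF newton_hfun_T'], of wt' 1]
  by (simp_all add: schur_jacobi whomog_var)

lemma wdeg_schur_prod:
  assumes "mcoeff (schur_x l * schur_y l) M \<noteq> 0"
  shows "wdeg wt M = psize l" "wdeg wt' M = psize l"
  using whomog_mult[OF whomog_schur(1,3)] whomog_mult[OF whomog_schur(2,4)] assms
  by (auto simp: whomog_def)

lemma msummable_schur_prod: "A \<subseteq> partitions \<Longrightarrow> msummable (\<lambda>l. schur_x l * schur_y l) A"
  unfolding msummable_def
  by (auto intro!: finite_subset[OF _ finite_partitions] simp: wdeg_schur_prod(1)[symmetric])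

text \<open>Every nonempty partition contributes only monomials of positive weight. Constant term 1
  makes \<open>recip Z\<close> an inverse of Z.\<close>

lemma mcoeff_Z_0: "mcoeff Z 0 = 1"
proof -
  have "mcoeff Z 0 = (\<Sum>l\<in>{\<lambda>_. 0}. mcoeff (schur_x l * schur_y l) 0)"
    unfolding Z_def
  proof (rule mcoeff_msum)
    fix l assume l: "l \<in> partitions - {\<lambda>_. 0}"
    then obtain i where "l i \<noteq> 0" by auto
    then have "psize l \<noteq> 0" using le_psize[of l i] l by auto
    then show "mcoeff (schur_x l * schur_y l) 0 = 0" using wdeg_schur_prod(1)[of l 0] by auto
  qed (auto simp: partitions_def antimono_def)
  then show ?thesis by (simp add: schur_def num_parts_def mcoeff_1)
qed

lemma Z_rho: "Z * rho X = msum (\<lambda>l. schur_x l * schur_y l) {l \<in> partitions. X \<subseteq> maya l}"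
proof -
  let ?A = "{l \<in> partitions. X \<subseteq> maya l}"
  have "Z * rho X = Z * (recip Z * msum (\<lambda>l. schur_x l * schur_y l) ?A)"
    unfolding rho_def schur_measure_def schur_weight_def[abs_def]
    by (subst msum_mult_left) (auto intro: msummable_schur_prod)
  then show ?thesis using recip[OF mcoeff_Z_0] by (simp flip: mult.assoc)
qed

text \<open>Only the weight w of one family of variables is controlled, as the other family may
  receive z. This suffices: in a monomial of \<open>schur_x l * schur_y l\<close> both weights equal
  the size of l, so a bound on one bounds the other and the partition.\<close>

lemma subst_schur_sum:
  assumes A: "A \<subseteq> partitions" and w: "w = wt \<or> w = wt'"
    and \<sigma>: "\<And>v. vanishes_below \<omega> (w v) (\<sigma> v)"
  defines "\<tau> \<equiv> msum (\<lambda>l. schur_x l * schur_y l) A"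
  shows "substitutable \<tau> \<sigma>" "subst \<tau> \<sigma> = msum (\<lambda>l. subst (schur_x l) \<sigma> * subst (schur_y l) \<sigma>) A"
    "msummable (\<lambda>l. subst (schur_x l) \<sigma> * subst (schur_y l) \<sigma>) A"
proof -
  have fin: "finite {(l, M). l \<in> A \<and> mcoeff (subst_term (schur_x l * schur_y l) \<sigma> M) N \<noteq> 0}" for N
  proof (rule finite_subset)
    let ?K = "wdeg \<omega> N"
    show "{(l, M). l \<in> A \<and> mcoeff (subst_term (schur_x l * schur_y l) \<sigma> M) N \<noteq> 0}
      \<subseteq> {l \<in> partitions. psize l \<le> ?K} \<times> {M. wdeg wt M \<le> ?K \<and> wdeg wt' M \<le> ?K}"
    proof (rule subsetI)
      fix x assume "x \<in> {(l, M). l \<in> A \<and> mcoeff (subst_term (schur_x l * schur_y l) \<sigma> M) N \<noteq> 0}"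
      then obtain l M where x: "x = (l, M)" and l: "l \<in> A"
        and "mcoeff (subst_term (schur_x l * schur_y l) \<sigma> M) N \<noteq> 0" by auto
      then have "mcoeff (schur_x l * schur_y l) M \<noteq> 0" "mcoeff (monom_subst \<sigma> M) N \<noteq> 0"
        by (auto simp: mcoeff_subst_term)
      then have "wdeg wt M = psize l" "wdeg wt' M = psize l" "wdeg w M \<le> ?K"
        using wdeg_schur_prod vanishes_below_monom_subst[of \<omega> w \<sigma> M, OF \<sigma>]
        by (auto simp: vanishes_below_def intro: leI)
      then show "x \<in> {l \<in> partitions. psize l \<le> ?K} \<times> {M. wdeg wt M \<le> ?K \<and> wdeg wt' M \<le> ?K}"
        using x l A w by auto
    qed
  qed (simp add: finite_partitions finite_wdeg_wt)
  note s = subst_msum[OF msummable_schur_prod[OF A] fin]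
  show "substitutable \<tau> \<sigma>" unfolding \<tau>_def by (rule s(1))
  show "subst \<tau> \<sigma> = msum (\<lambda>l. subst (schur_x l) \<sigma> * subst (schur_y l) \<sigma>) A"
    unfolding \<tau>_def using s(2) by (simp add: subst_mult finsupp_schur)
  show "msummable (\<lambda>l. subst (schur_x l) \<sigma> * subst (schur_y l) \<sigma>) A"
    using s(3) by (simp add: subst_mult finsupp_schur)
qed

section \<open>Schur functions at arbitrary arguments\<close>

lemma subst_schur_x:
  assumes "newton a h"
  shows "subst (schur_x l) (args a b) = jacobi h l"
proof -
  have "newton a (\<lambda>n. subst (hfun (\<lambda>k. var (T k)) n) (args a b))"
    using subst_newton[OF newton_hfun_T finsupp_var, of "args a b"] by (simp add: subst_var args_def)
  then have "(\<lambda>n. subst (hfun (\<lambda>k. var (T k)) n) (args a b)) = h"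
    using assms by (rule newton_unique)
  then show ?thesis
    unfolding schur_jacobi by (subst subst_jacobi) (simp_all add: finsupp_newton[OF newton_hfun_T finsupp_var])
qed

lemma subst_schur_y:
  assumes "newton b h"
  shows "subst (schur_y l) (args a b) = jacobi h l"
proof -
  have "newton b (\<lambda>n. subst (hfun (\<lambda>k. var (T' k)) n) (args a b))"
    using subst_newton[OF newton_hfun_T' finsupp_var, of "args a b"] by (simp add: subst_var args_def)
  then have "(\<lambda>n. subst (hfun (\<lambda>k. var (T' k)) n) (args a b)) = h"
    using assms by (rule newton_unique)
  then show ?thesis
    unfolding schur_jacobi by (subst subst_jacobi) (simp_all add: finsupp_newton[OF newton_hfun_T' finsupp_var])
qed

lemma subst_schur_args:
  assumes A: "A \<subseteq> partitions" and w: "w = wt \<or> w = wt'"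
    and \<sigma>: "\<And>v. vanishes_below \<omega> (w v) (args a b v)"
    and ab: "newton a ha" "newton b hb"
  defines "\<tau> \<equiv> msum (\<lambda>l. schur_x l * schur_y l) A"
  shows "substitutable \<tau> (args a b)" "subst \<tau> (args a b) = msum (\<lambda>l. jacobi ha l * jacobi hb l) A"
  using subst_schur_sum[OF A w \<sigma>]
  unfolding subst_schur_x[OF ab(1)] subst_schur_y[OF ab(2)] \<tau>_def by blast+

text \<open>The complete functions in the variables \<open>T k\<close> are polynomials, so any
  sequence can be substituted into them.\<close>

lemma newton_exists:
  fixes a :: "nat \<Rightarrow> ('w, laurent) mps"
  obtains h where "newton a h"
  using subst_newton[OF newton_hfun_T finsupp_var, of "args a a"] by (auto simp: subst_var args_def)

text \<open>The Schur function in the variables \<open>T k\<close> is homogeneous of weight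
  \<open>psize l\<close>, and the substitution does not lower the order; \<open>max 1 k\<close> is
  the weight of \<open>T k\<close>.\<close>

lemma vanishes_below_jacobi:
  fixes a :: "nat \<Rightarrow> ('w, laurent) mps"
  assumes "newton a h" "\<And>k. vanishes_below \<omega> (max 1 k) (a k)"
  shows "vanishes_below \<omega> (psize l) (jacobi h l)"
proof -
  have "vanishes_below \<omega> (psize l) (subst (schur_x l) (args a a))"
    by (rule vanishes_below_subst[OF finsupp_schur(1) whomog_schur(1)])
      (use assms(2) in \<open>auto simp: args_def split: tvar.split\<close>)
  then show ?thesis unfolding subst_schur_x[OF assms(1)] .
qed

section \<open>Removing a row\<close>

text \<open>In terms of Maya diagrams, \<open>remove_row l i\<close> deletes the point \<open>l\<^sub>i - i\<close>, lowering the charge by one.\<close>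

definition remove_row :: "(nat \<Rightarrow> nat) \<Rightarrow> nat \<Rightarrow> nat \<Rightarrow> nat" where
  "remove_row l i = (\<lambda>k. if k < i then l k + 1 else l (Suc k))"

lemma partitions_iff: "l \<in> partitions \<longleftrightarrow> (\<forall>k. l (Suc k) \<le> l k) \<and> (\<exists>N. \<forall>k\<ge>N. l k = 0)"
proof
  assume l: "l \<in> partitions"
  then show "(\<forall>k. l (Suc k) \<le> l k) \<and> (\<exists>N. \<forall>k\<ge>N. l k = 0)"
    using partition_zero[OF l] by (auto simp: partitions_def antimono_def)
next
  assume *: "(\<forall>k. l (Suc k) \<le> l k) \<and> (\<exists>N. \<forall>k\<ge>N. l k = 0)"
  then obtain N where N: "\<And>k. k \<ge> N \<Longrightarrow> l k = 0" by blast
  have "{k. l k \<noteq> 0} \<subseteq> {..<N}"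
  proof
    fix k assume "k \<in> {k. l k \<noteq> 0}"
    then show "k \<in> {..<N}" using N[of k] by (cases "k < N") auto
  qed
  moreover have "antimono l" using * by (simp add: antimono_iff_le_Suc)
  ultimately show "l \<in> partitions" using finite_subset by (auto simp: partitions_def)
qed

lemma remove_row_partition:
  assumes "l \<in> partitions"
  shows "remove_row l i \<in> partitions"
proof -
  obtain N where N: "\<forall>k\<ge>N. l k = 0" and d: "\<forall>k. l (Suc k) \<le> l k"
    using assms unfolding partitions_iff by blast
  have "\<forall>k\<ge>max N i. remove_row l i k = 0" using N by (simp add: remove_row_def)
  moreover have "remove_row l i (Suc k) \<le> remove_row l i k" for k
    using d[rule_format, of k] d[rule_format, of "Suc k"] by (auto simp: remove_row_def)
  ultimately show ?thesis unfolding partitions_iff by blast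
qed

lemma num_parts_remove_row:
  assumes "l \<in> partitions" "num_parts l \<le> Suc N" "i \<le> N"
  shows "num_parts (remove_row l i) \<le> N"
  by (rule num_parts_le) (use assms partition_zero[OF assms(1)] in \<open>simp add: remove_row_def\<close>)

text \<open>Row i is lost and each of the i rows above it gains one cell. The additive form avoids
  subtraction of naturals.\<close>

lemma psize_remove_row:
  assumes l: "l \<in> partitions"
  shows "psize (remove_row l i) + l i = psize l + i"
proof -
  let ?N = "i + num_parts l"
  have "(\<Sum>k<N. remove_row l i k) + l i = (\<Sum>k<Suc N. l k) + i" if "i \<le> N" for N
    using that
  proof (induction N rule: dec_induct)
    case base
    have "(\<Sum>k<i. remove_row l i k) = (\<Sum>k<i. l k + 1)"
      by (rule sum.cong) (auto simp: remove_row_def)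
    then show ?case by (simp add: sum_Suc)
  next
    case (step N)
    then show ?case by (simp add: remove_row_def)
  qed
  from this[of ?N] show ?thesis
    using psize_eq[OF l, of "Suc ?N"] psize_eq[OF remove_row_partition[OF l], of i ?N]
      num_parts_remove_row[OF l, of ?N i] by simp
qed

text \<open>The index is bounded as well, since \<open>i \<le> psize (remove_row l i) + l i\<close>
  and \<open>l i \<le> psize l\<close>.\<close>

lemma finite_remove_row: "finite {(l, i). l \<in> partitions \<and> psize l + psize (remove_row l i) \<le> K}"
proof (rule finite_subset)
  show "{(l, i). l \<in> partitions \<and> psize l + psize (remove_row l i) \<le> K} \<subseteq> {l \<in> partitions. psize l \<le> K} \<times> {..K}"
  proof clarsimp
    fix l i assume l: "l \<in> partitions" and K: "psize l + psize (remove_row l i) \<le> K"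
    show "i \<le> K"
      using K psize_remove_row[OF l, of i] le_psize[OF l, of i] by linarith
  qed
qed (simp add: finite_partitions)

text \<open>Any free position n of the Maya diagram of m can be filled by a new point. Read in the
  charge of l, row p of m sits at \<open>m p - p - 1\<close>.\<close>

lemma remove_row_exists:
  fixes n :: int
  assumes m: "m \<in> partitions" and n: "\<And>p. n \<noteq> int (m p) - int p - 1"
  obtains l i where "l \<in> partitions" "remove_row l i = m" "int (l i) - int i = n"
proof -
  have d: "m (Suc k) \<le> m k" for k using m by (simp add: partitions_iff)
  \<comment> \<open>The number of points of m above n, that is, the row in which the new point
    belongs.\<close>
  define i where "i = (LEAST p. int (m p) - int p - 1 < n)"
  have "\<exists>p. int (m p) - int p - 1 < n"
  proof -
    have "m (num_parts m + nat (- n)) = 0" by (rule partition_zero[OF m]) simp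
    then show ?thesis by (intro exI[of _ "num_parts m + nat (- n)"]) auto
  qed
  then have i: "int (m i) - int i - 1 < n" unfolding i_def by (rule LeastI_ex)
  have less: "int (m p) - int p - 1 > n" if "p < i" for p
    using not_less_Least[of p "\<lambda>p. int (m p) - int p - 1 < n"] n[of p] that by (simp add: i_def)
  define l where "l = (\<lambda>p. if p < i then m p - 1 else if p = i then nat (n + int i) else m (p - 1))"
  \<comment> \<open>The rows before i are longer than row i, hence nonempty, so the truncated
    subtraction in the definition of l below loses nothing.\<close>
  have pos: "m p \<ge> 1" if p: "p < i" for p
  proof -
    obtain q where q: "i = Suc q" using p by (cases i) auto
    have "m q \<le> m p" using p q m by (auto simp: partitions_def antimono_def)
    moreover have "int (m q) > int (m i)" using less[of q] i q by simp
    ultimately show ?thesis by simp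
  qed
  have li: "int (l i) = n + int i" using i by (simp add: l_def)
  have rem: "remove_row l i = m"
    by (rule ext) (auto simp: remove_row_def l_def dest: pos)
  have "l (Suc k) \<le> l k" for k
  proof -
    consider "Suc k < i" | "Suc k = i" | "k = i" | "k > i" by linarith
    then show ?thesis
    proof cases
      case 2
      then show ?thesis using less[of k] pos[of k] by (auto simp: l_def)
    next
      case 3
      then show ?thesis using i by (simp add: l_def)
    next
      case 4
      then show ?thesis using d[of "k - 1"] by (simp add: l_def)
    qed (use d[of k] in \<open>simp add: l_def\<close>)
  qed
  moreover have "l k = 0" if "k \<ge> Suc (max i (num_parts m))" for k
    using that partition_zero[OF m, of "k - 1"] by (simp add: l_def)
  ultimately have "l \<in> partitions" unfolding partitions_iff by blast
  then show ?thesis using that rem li by simp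
qed

text \<open>The partition m and the removed point determine l: for i < i' one has
  \<open>l i \<ge> l (Suc i) = l' i + 1 > l' i'\<close>, so the two removed points differ.\<close>

lemma inj_remove_row:
  "inj_on (\<lambda>(l, i). int (l i) - int i) {(l, i). l \<in> partitions \<and> remove_row l i = m}"
proof (rule inj_onI, clarify)
  have *: False if "remove_row l i = remove_row l' i'" "int (l i) - int i = int (l' i') - int i'" "i < i'"
    and l: "l \<in> partitions" and l': "l' \<in> partitions" for l i l' i'
  proof -
    have "l (Suc i) = l' i + 1" using fun_cong[OF that(1), of i] that(3) by (simp add: remove_row_def)
    moreover have "l' i' \<le> l' i" "l (Suc i) \<le> l i" using l l' that(3) by (auto simp: partitions_def antimono_def)
    ultimately show False using that(2,3) by linarith
  qed
  fix l i l' i' assume a: "l \<in> partitions" "l' \<in> partitions" "m = remove_row l i" "remove_row l' i' = remove_row l i"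
    "int (l i) - int i = int (l' i') - int i'"
  then have ii: "i' = i" using *[of l i l' i'] *[of l' i' l i] by (metis linorder_neqE_nat)
  have "l k = l' k" for k
  proof (cases "k = i")
    case False
    then show ?thesis
      using fun_cong[OF a(4), of "if k < i then k else k - 1"] ii by (auto simp: remove_row_def split: if_splits)
  qed (use a ii in simp)
  then show "l = l' \<and> i = i'" using ii by auto
qed

section \<open>Determinants\<close>

text \<open>The column operation is right multiplication by an upper unitriangular matrix.\<close>

lemma det_column_difference:
  fixes A :: "nat \<Rightarrow> nat \<Rightarrow> 'a::comm_ring_1"
  shows "det (mat n n (\<lambda>(i, j). if j = 0 then A i 0 else A i j - w * A i (j - 1))) = det (mat n n (\<lambda>(i, j). A i j))"
proof -
  let ?B = "mat n n (\<lambda>(i, j). A i j)"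
  let ?T = "mat n n (\<lambda>(i, j). if i = j then 1 else if Suc i = j then - w else 0) :: 'a mat"
  have "mat n n (\<lambda>(i, j). if j = 0 then A i 0 else A i j - w * A i (j - 1)) = ?B * ?T"
  proof (rule eq_matI)
    fix i j assume "i < dim_row (?B * ?T)" "j < dim_col (?B * ?T)"
    then have ij: "i < n" "j < n" by simp_all
    have "(?B * ?T) $$ (i, j) = (\<Sum>k\<in>{0..<n}. A i k * (if k = j then 1 else if Suc k = j then - w else 0))"
      using ij by (simp add: scalar_prod_def)
    also have "\<dots> = (\<Sum>k\<in>{0..<n}. (if k = j then A i k else 0) + (if Suc k = j then - w * A i k else 0))"
      by (rule sum.cong) auto
    also have "\<dots> = (\<Sum>k\<in>{0..<n}. if k = j then A i k else 0) + (\<Sum>k\<in>{0..<n}. if Suc k = j then - w * A i k else 0)"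
      by (rule sum.distrib)
    also have "\<dots> = (if j = 0 then A i 0 else A i j - w * A i (j - 1))"
      using ij by (cases j) auto
    finally show "mat n n (\<lambda>(i, j). if j = 0 then A i 0 else A i j - w * A i (j - 1)) $$ (i, j) = (?B * ?T) $$ (i, j)"
      using ij by simp
  qed simp_all
  moreover have "det (?B * ?T) = det ?B * det ?T" by (rule det_mult[of _ n]) auto
  moreover have "det ?T = prod_list (diag_mat ?T)"
    by (rule det_upper_triangular[of _ n]) (auto simp: upper_triangular_def)
  moreover have "diag_mat ?T = map (\<lambda>_. 1) [0..<n]" by (auto simp: diag_mat_def)
  moreover have "prod_list (map (\<lambda>_. 1) xs) = (1 :: 'a)" for xs :: "nat list"
    by (induction xs) auto
  ultimately show ?thesis by simp
qed

text \<open>An array of N rows and N + 1 columns with an extra row r on top. Linearity in r allows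
  generating functions in the top row while the minors stay fixed.\<close>

definition row_det :: "nat \<Rightarrow> (nat \<Rightarrow> nat \<Rightarrow> 'a::comm_ring_1) \<Rightarrow> (nat \<Rightarrow> 'a) \<Rightarrow> 'a" where
  "row_det N A r = det (mat (Suc N) (Suc N) (\<lambda>(i, j). if i = 0 then r j else A (i - 1) j))"

definition minor_det :: "nat \<Rightarrow> (nat \<Rightarrow> nat \<Rightarrow> 'a::comm_ring_1) \<Rightarrow> nat \<Rightarrow> 'a" where
  "minor_det N A j = det (mat N N (\<lambda>(p, q). A p (if q < j then q else Suc q)))"

lemma row_det_expand: "row_det N A r = (\<Sum>j<Suc N. r j * ((- 1) ^ j * minor_det N A j))"
proof -
  let ?B = "mat (Suc N) (Suc N) (\<lambda>(i, j). if i = 0 then r j else A (i - 1) j)"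
  have "row_det N A r = (\<Sum>j<Suc N. ?B $$ (0, j) * cofactor ?B 0 j)"
    unfolding row_det_def by (rule laplace_expansion_row) auto
  also have "\<dots> = (\<Sum>j<Suc N. r j * ((- 1) ^ j * minor_det N A j))"
  proof (rule sum.cong[OF refl])
    fix j assume j: "j \<in> {..<Suc N}"
    have "mat_delete ?B 0 j = mat N N (\<lambda>(p, q). A p (if q < j then q else Suc q))"
      by (rule eq_matI) (use j in \<open>auto simp: mat_delete_def\<close>)
    then show "?B $$ (0, j) * cofactor ?B 0 j = r j * ((- 1) ^ j * minor_det N A j)"
      using j by (simp add: cofactor_def minor_det_def)
  qed
  finally show ?thesis .
qed

text \<open>Subtracting w times the preceding column turns the top row of powers into (1, 0, ...,
  0).\<close>

lemma row_det_powers: "row_det N A (\<lambda>j. w ^ j) = det (mat N N (\<lambda>(i, j). A i (Suc j) - w * A i j))"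
proof -
  let ?C = "\<lambda>i j. if i = 0 then w ^ j else A (i - 1) j"
  let ?B = "mat (Suc N) (Suc N) (\<lambda>(i, j). if j = 0 then ?C i 0 else ?C i j - w * ?C i (j - 1))"
  have "row_det N A (\<lambda>j. w ^ j) = det ?B"
    unfolding row_det_def by (rule det_column_difference[symmetric])
  also have "\<dots> = (\<Sum>j<Suc N. ?B $$ (0, j) * cofactor ?B 0 j)"
    by (rule laplace_expansion_row) auto
  also have "\<dots> = (\<Sum>j<Suc N. if j = 0 then cofactor ?B 0 0 else 0)"
    by (rule sum.cong) (auto simp: power_eq_if)
  also have "\<dots> = det (mat_delete ?B 0 0)" by (simp add: cofactor_def)
  also have "mat_delete ?B 0 0 = mat N N (\<lambda>(i, j). A i (Suc j) - w * A i j)"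
    by (rule eq_matI) (auto simp: mat_delete_def)
  finally show ?thesis .
qed

text \<open>The numbers \<open>m p - p - 1\<close> are the \<open>l k - k\<close> with k = i left
  out, so the lower rows form the Jacobi--Trudi matrix of l without row i. Moving that row to the
  top costs the sign.\<close>

lemma row_det_remove_row:
  assumes h: "newton u h" and l: "l \<in> partitions" "num_parts l \<le> Suc N" "i \<le> N"
  defines "m \<equiv> remove_row l i"
  shows "row_det N (\<lambda>p j. h (int (m p) - int p - 1 + int j)) (\<lambda>j. h (int (l i) - int i + int j)) = (- 1) ^ i * jacobi h l"
proof -
  let ?J = "jacobi_mat h (Suc N) l" and ?A = "\<lambda>p j. h (int (m p) - int p - 1 + int j)"
  have "jacobi h l = det ?J" using det_jacobi_mat[OF h l(1,2)] by simp
  also have "\<dots> = (\<Sum>j<Suc N. ?J $$ (i, j) * cofactor ?J i j)"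
    by (rule laplace_expansion_row) (use l(3) in auto)
  also have "\<dots> = (\<Sum>j<Suc N. (- 1) ^ i * (h (int (l i) - int i + int j) * ((- 1) ^ j * minor_det N ?A j)))"
  proof (rule sum.cong[OF refl])
    fix j assume j: "j \<in> {..<Suc N}"
    have "mat_delete ?J i j = mat N N (\<lambda>(p, q). ?A p (if q < j then q else Suc q))"
      by (rule eq_matI) (use j l(3) in \<open>auto simp: mat_delete_def jacobi_mat_def m_def remove_row_def algebra_simps\<close>)
    then have "cofactor ?J i j = (- 1) ^ i * ((- 1) ^ j * minor_det N ?A j)"
      by (simp add: cofactor_def minor_det_def power_add)
    then show "?J $$ (i, j) * cofactor ?J i j = (- 1) ^ i * (h (int (l i) - int i + int j) * ((- 1) ^ j * minor_det N ?A j))"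
      using j l(3) by (simp add: jacobi_mat_def ac_simps)
  qed
  also have "\<dots> = (- 1) ^ i * row_det N ?A (\<lambda>j. h (int (l i) - int i + int j))"
    unfolding row_det_expand sum_distrib_left ..
  finally show ?thesis by (simp flip: mult.assoc power_mult_distrib)
qed

lemma row_det_eq_0: "p < N \<Longrightarrow> row_det N A (A p) = 0"
  unfolding row_det_def
  by (rule det_identical_rows[of _ "Suc N" 0 "Suc p"]) (auto intro: eq_vecI)

section \<open>Vertex operators\<close>

text \<open>\<open>h n\<close> is the Jacobi--Trudi determinant of the partition with the single
  part n.\<close>

lemma vanishes_below_newton:
  fixes a :: "nat \<Rightarrow> ('w, laurent) mps"
  assumes h: "newton a h" and a: "\<And>k. vanishes_below \<omega> (max 1 k) (a k)"
  shows "vanishes_below \<omega> n (h (int n))"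
proof -
  let ?l = "\<lambda>i. if i = 0 then n else 0"
  have "?l \<in> partitions" unfolding partitions_iff by (auto intro: exI[of _ 1])
  moreover have "num_parts ?l \<le> 1" by (rule num_parts_le) auto
  ultimately have "jacobi h ?l = h (int n)" "psize ?l = n"
    using det_jacobi_mat[OF h, of ?l 1] psize_eq[of ?l 1]
    by (auto simp: det_single jacobi_mat_def)
  then show ?thesis using vanishes_below_jacobi[OF assms, of ?l] by simp
qed

lemma zpow_mult: "zpow a * zpow b = zpow (a + b)"
  by (simp add: zpow_add)

context
  fixes \<omega> :: "'v \<Rightarrow> nat" and v :: "nat \<Rightarrow> ('v, rat) mps" and h
  assumes v: "\<And>k. vanishes_below \<omega> (max 1 k) (v k)"
    and h: "newton (\<lambda>k. embed (v k)) h"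
begin

lemma vanishes_below_embed_param: "vanishes_below \<omega> k (v k)"
  using v vanishes_below_mono by (metis max.cobounded2)

lemma newton_embed_gamma:
  "h k = embed (zcoeff (- k) (gamma (zpow (- 1)) (\<lambda>k. embed (v k))))"
  using newton_unique[OF h newton_embed[OF newton_gamma[of "- 1", OF _ vanishes_below_embed_param]]]
  by (simp add: fun_eq_iff)

lemma newton_embed_below: "vanishes_below \<omega> n (h (int n))"
  by (rule vanishes_below_newton[OF h]) (use v in simp)

lemma jacobi_embed_below: "vanishes_below \<omega> (psize l) (jacobi h l)"
  by (rule vanishes_below_jacobi[OF h]) (use v in simp)

text \<open>By \<open>newton_embed_gamma\<close> the series is the sum of all
  \<open>zpow (- n) * h n\<close>, and the terms with n > K have order at least K + 1.\<close>

lemma gamma_truncate: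
  "vanishes_below \<omega> (nat (K + 1)) (gamma (zpow (- 1)) (\<lambda>k. embed (v k)) - (\<Sum>n=0..K. zpow (- n) * h n))"
  unfolding vanishes_below_def
proof (intro allI impI)
  fix M assume M: "wdeg \<omega> M < nat (K + 1)"
  let ?G = "gamma (zpow (- 1)) (\<lambda>k. embed (v k))"
  have "Poly_Mapping.lookup (mcoeff (\<Sum>n=0..K. zpow (- n) * h n) M) j = Poly_Mapping.lookup (mcoeff ?G M) j" for j
  proof -
    have "Poly_Mapping.lookup (mcoeff (zpow (- n) * h n) M) j
        = (if n = - j then Poly_Mapping.lookup (mcoeff ?G M) j else 0)" for n
      unfolding newton_embed_gamma mcoeff_zcoeff[symmetric] mult.commute[of "zpow (- n)"] zcoeff_embed_zpow
      by auto
    then have "Poly_Mapping.lookup (mcoeff (\<Sum>n=0..K. zpow (- n) * h n) M) j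
      = (if - j \<in> {0..K} then Poly_Mapping.lookup (mcoeff ?G M) j else 0)"
      by (simp add: mcoeff_sum lookup_sum')
    moreover have "Poly_Mapping.lookup (mcoeff ?G M) j = 0" if "- j \<notin> {0..K}"
    proof -
      have "mcoeff (h (- j)) M = 0"
      proof (cases "- j < 0")
        case False
        then have "wdeg \<omega> M < nat (- j)" using that M by auto
        then show ?thesis using newton_embed_below[of "nat (- j)"] False by (simp add: vanishes_below_def)
      qed (use newtonD(1)[OF h] in simp)
      then have "Poly_Mapping.lookup (mcoeff (h (- j)) M) 0 = 0" by simp
      then show ?thesis by (simp add: newton_embed_gamma)
    qed
    ultimately show ?thesis by simp
  qed
  then show "mcoeff (?G - (\<Sum>n=0..K. zpow (- n) * h n)) M = 0"
    by (auto intro: poly_mapping_eqI)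
qed

text \<open>Multiplication by \<open>zpow a\<close> shifts the index. The nonzero terms start at n =
  - a, hence the bound on L; if \<open>K + a + 1\<close> is negative, \<open>nat\<close> makes the
  claim empty.\<close>

lemma gamma_shift_truncate:
  assumes "L \<le> - a"
  shows "vanishes_below \<omega> (nat (K + a + 1))
    (gamma (zpow (- 1)) (\<lambda>k. embed (v k)) * zpow a - (\<Sum>n=L..K. zpow (- n) * h (n + a)))"
proof -
  have "(\<Sum>n=L..K. zpow (- n) * h (n + a)) = (\<Sum>n=- a..K. zpow (- n) * h (n + a))"
    by (rule sum.mono_neutral_right) (use assms newtonD(1)[OF h] in auto)
  also have "\<dots> = (\<Sum>n=0..K + a. zpow (- (n - a)) * h n)"
    by (rule sum.reindex_bij_witness[of _ "\<lambda>n. n - a" "\<lambda>n. n + a"]) auto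
  also have "\<dots> = (\<Sum>n=0..K + a. zpow (- n) * h n) * zpow a"
    unfolding sum_distrib_right
  proof (rule sum.cong[OF refl])
    fix n
    have "zpow (- (n - a)) = (zpow (- n) * zpow a :: ('v, laurent) mps)" by (simp add: zpow_mult)
    then show "zpow (- (n - a)) * h n = zpow (- n) * h n * zpow a" by (simp only: ac_simps)
  qed
  finally show ?thesis
    using vanishes_below_mult_right[OF gamma_truncate[of "K + a"], of "zpow a"]
    by (simp add: left_diff_distrib)
qed

end

section \<open>Additivity of \<open>gamma\<close> in its sequence\<close>

lemma gamma_add:
  assumes u: "\<And>k. vanishes_below \<omega> (max 1 k) (u k)" and u': "\<And>k. vanishes_below \<omega> (max 1 k) (u' k)"
  shows "gamma w (\<lambda>k. u k + u' k) = gamma w u * gamma w u'"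
proof -
  have s: "msummable (\<lambda>k. f k * w ^ k) {1..}" "mcoeff (msum (\<lambda>k. f k * w ^ k) {1..}) 0 = 0"
    if f: "\<And>k. vanishes_below \<omega> (max 1 k) (f k)" for f
  proof -
    have f': "vanishes_below \<omega> k (f k)" for k
      by (rule vanishes_below_mono[OF f]) simp
    show "msummable (\<lambda>k. f k * w ^ k) {1..}"
    proof (rule msummable_weight)
      show "finite {i \<in> {1..}. i \<le> K}" for K :: nat by (rule finite_subset[of _ "{..K}"]) auto
    qed (rule vanishes_below_mult_right[OF f'])
    have "mcoeff (msum (\<lambda>k. f k * w ^ k) {1..}) 0 = (\<Sum>k\<in>{}. mcoeff (f k * w ^ k) 0)"
    proof (rule mcoeff_msum)
      fix k :: nat assume "k \<in> {1..} - {}"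
      then show "mcoeff (f k * w ^ k) 0 = 0"
        using vanishes_below_mult_right[OF f'[of k], of "w ^ k"] by (auto simp: vanishes_below_def)
    qed auto
    then show "mcoeff (msum (\<lambda>k. f k * w ^ k) {1..}) 0 = 0" by simp
  qed
  show ?thesis
    unfolding gamma_def distrib_right msum_add[OF s(1)[OF u] s(1)[OF u']]
    by (rule mexp_add[OF s(2)[OF u] s(2)[OF u']])
qed

lemma gamma_0: "gamma w (\<lambda>k. 0) = 1"
proof -
  have "msum (\<lambda>k. 0 * w ^ k) {1..} = 0" by (rule mps_eqI) (simp add: msum_def)
  then show ?thesis unfolding gamma_def by (metis mexp_unique[of 0 1] euler_1 mcoeff_0 mcoeff_1 mult_zero_left mult_1_right euler_const const_0)
qed

lemma zseq_power: "k > 0 \<Longrightarrow> of_nat k * zseq k = zvar ^ k"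
  by (simp add: zseq_def scalar_of_nat[symmetric] scalar_mult[symmetric] flip: mult.assoc)

section \<open>The two vertex operator identities for Schur functions\<close>

context
  fixes \<omega> :: "'v \<Rightarrow> nat" and v :: "nat \<Rightarrow> ('v, rat) mps" and h
  assumes v: "\<And>k. vanishes_below \<omega> (max 1 k) (v k)"
    and h: "newton (\<lambda>k. embed (v k)) h"
begin

text \<open>As \<open>g n = h n - z h (n - 1)\<close>, the determinant for m equals one with an
  extra top row of powers of z. The factor \<open>?G\<close> turns \<open>z^j\<close> into the sum
  of all \<open>z^(-n) h (n + j)\<close>, so the coefficient of \<open>z^(-n)\<close> is a
  determinant with an extra row at n: zero if n is occupied in m, otherwise a Schur function up to
  sign.\<close>

lemma vertex_add:
  assumes g: "newton (\<lambda>k. embed (v k) - zseq k) g" and m: "m \<in> partitions"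
  shows "gamma (zpow (- 1)) (\<lambda>k. embed (v k)) * jacobi g m
    = msum (\<lambda>(l, i). (- 1) ^ i * zpow (int i - int (l i)) * jacobi h l) {(l, i). l \<in> partitions \<and> remove_row l i = m}"
    (is "?G * _ = msum ?f ?E")
proof (rule mps_eqI)
  fix M
  define N where "N = num_parts m"
  define K where "K = int (wdeg \<omega> M)"
  define A where "A = (\<lambda>p j. h (int (m p) - int p - 1 + int j))"
  let ?cf = "\<lambda>j. (- 1) ^ j * minor_det N A j" and ?pos = "\<lambda>(l :: nat \<Rightarrow> nat, i). int (l i) - int i"
  let ?R = "\<lambda>n. row_det N A (\<lambda>j. h (n + int j))"
  have gh: "g = (\<lambda>n. h n - zvar * h (n - 1))"
    by (rule newton_unique[OF g newton_diff_geo[OF h]]) (rule zseq_power)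
  have "jacobi g m = det (jacobi_mat g N m)" by (simp add: jacobi_def N_def)
  also have "jacobi_mat g N m = mat N N (\<lambda>(i, j). A i (Suc j) - zvar * A i j)"
    by (rule eq_matI) (auto simp: jacobi_mat_def gh A_def algebra_simps)
  also have "det \<dots> = (\<Sum>j<Suc N. zpow (int j) * ?cf j)"
    unfolding row_det_powers[symmetric] row_det_expand zpow_power ..
  finally have jg: "jacobi g m = (\<Sum>j<Suc N. zpow (int j) * ?cf j)" .
  \<comment> \<open>The lower bound - N serves all columns j \<le> N, since \<open>h (n + j)\<close>
    vanishes for n < - j.\<close>
  have "(\<Sum>n=- int N..K. zpow (- n) * ?R n) = (\<Sum>j<Suc N. (\<Sum>n=- int N..K. zpow (- n) * h (n + int j)) * ?cf j)"
    unfolding row_det_expand sum_distrib_left sum_distrib_right by (subst sum.swap) (simp only: mult.assoc)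
  then have "?G * jacobi g m - (\<Sum>n=- int N..K. zpow (- n) * ?R n)
     = (\<Sum>j<Suc N. (?G * zpow (int j) - (\<Sum>n=- int N..K. zpow (- n) * h (n + int j))) * ?cf j)"
    unfolding jg by (simp only: sum_distrib_left sum_subtractf left_diff_distrib mult.assoc)
  moreover have "vanishes_below \<omega> (nat (K + 1)) \<dots>"
  proof (rule vanishes_below_sum)
    fix j assume j: "j \<in> {..<Suc N}"
    have "vanishes_below \<omega> (nat (K + int j + 1)) (?G * zpow (int j) - (\<Sum>n=- int N..K. zpow (- n) * h (n + int j)))"
      using gamma_shift_truncate[OF v h, of "- int N" "int j" K] j by simp
    then show "vanishes_below \<omega> (nat (K + 1)) ((?G * zpow (int j) - (\<Sum>n=- int N..K. zpow (- n) * h (n + int j))) * ?cf j)"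
      by (intro vanishes_below_mult_right, elim vanishes_below_mono) simp
  qed
  ultimately have "vanishes_below \<omega> (nat (K + 1)) (?G * jacobi g m - (\<Sum>n=- int N..K. zpow (- n) * ?R n))"
    by (simp only:)
  then have trunc: "mcoeff (?G * jacobi g m) M = mcoeff (\<Sum>n=- int N..K. zpow (- n) * ?R n) M"
    by (rule vanishes_below_diffD) (simp add: K_def)
  define EK where "EK = {x \<in> ?E. ?pos x \<le> K}"
  \<comment> \<open>If i > N, then entry N of \<open>remove_row l i\<close> would be
    \<open>l N + 1\<close>, whereas \<open>m N = 0\<close>.\<close>
  have E: "i \<le> N" "num_parts l \<le> Suc N" if "l \<in> partitions" "remove_row l i = m" for l i
  proof -
    show "i \<le> N"
      using partition_zero[OF m, of N] fun_cong[OF that(2), of N] by (cases "i \<le> N") (auto simp: N_def remove_row_def)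
    show "num_parts l \<le> Suc N"
    proof (rule num_parts_le)
      fix k assume "Suc N \<le> k"
      then obtain q where q: "k = Suc q" "N \<le> q" by (cases k) auto
      then show "l k = 0"
        using \<open>i \<le> N\<close> partition_zero[OF m, of q] fun_cong[OF that(2), of q]
        by (auto simp: N_def remove_row_def)
    qed
  qed
  have inj: "inj_on ?pos EK" by (rule inj_on_subset[OF inj_remove_row[of m]]) (auto simp: EK_def)
  have sub: "?pos ` EK \<subseteq> {- int N..K}"
    using E(1) by (fastforce simp: EK_def)
  then have fin: "finite EK" using finite_imageD[OF finite_subset inj] by simp
  \<comment> \<open>An exponent n that no pair produces is occupied in m by
    \<open>remove_row_exists\<close>; as n \<ge> - N, the occupying row is one of the N rows of the
    array, and the top row repeats it.\<close>
  have "(\<Sum>n=- int N..K. zpow (- n) * ?R n) = (\<Sum>n\<in>?pos ` EK. zpow (- n) * ?R n)"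
  proof (rule sum.mono_neutral_right[OF _ sub], simp, rule ballI)
    fix n assume n: "n \<in> {- int N..K} - ?pos ` EK"
    have "\<exists>p. n = int (m p) - int p - 1"
    proof (rule ccontr)
      assume "\<nexists>p. n = int (m p) - int p - 1"
      then obtain l i where "l \<in> partitions" "remove_row l i = m" "int (l i) - int i = n"
        using remove_row_exists[OF m, of n] by blast
      then have "n \<in> ?pos ` EK" using n by (intro image_eqI[of _ _ "(l, i)"]) (auto simp: EK_def)
      then show False using n by simp
    qed
    then obtain p where p: "n = int (m p) - int p - 1" by blast
    then have "p < N" using n partition_zero[OF m, of p] by (cases "p < N") (auto simp: N_def)
    then have "row_det N A (A p) = 0" by (rule row_det_eq_0)
    then show "zpow (- n) * ?R n = 0" by (simp add: p A_def)
  qed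
  also have "\<dots> = (\<Sum>x\<in>EK. zpow (- ?pos x) * ?R (?pos x))"
    by (subst sum.reindex[OF inj]) simp
  also have "\<dots> = (\<Sum>x\<in>EK. ?f x)"
  proof (rule sum.cong[OF refl])
    fix x assume "x \<in> EK"
    then obtain l i where x: "x = (l, i)" and l: "l \<in> partitions" "remove_row l i = m"
      by (auto simp: EK_def)
    show "zpow (- ?pos x) * ?R (?pos x) = ?f x"
      using row_det_remove_row[OF h l(1) E(2)[OF l] E(1)[OF l]]
      by (simp add: x A_def l(2) ac_simps)
  qed
  also have "mcoeff \<dots> M = mcoeff (msum ?f ?E) M"
    unfolding mcoeff_sum
  proof (rule mcoeff_msum[symmetric, OF fin])
    fix x assume "x \<in> ?E - EK"
    then obtain l i where x: "x = (l, i)" and l: "l \<in> partitions" "remove_row l i = m" and K: "int (l i) - int i > K"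
      by (auto simp: EK_def)
    \<comment> \<open>The size of l is that of m plus \<open>l i - i\<close>, which exceeds
      K.\<close>
    have "psize l > wdeg \<omega> M" using psize_remove_row[OF l(1), of i] K by (simp add: K_def)
    then show "mcoeff (?f x) M = 0"
      using vanishes_below_mult_left[OF jacobi_embed_below[OF v h, of l], of "(- 1) ^ i * zpow (int i - int (l i))"]
      by (simp add: x vanishes_below_def)
  qed (auto simp: EK_def)
  finally show "mcoeff (?G * jacobi g m) M = mcoeff (msum ?f ?E) M"
    unfolding trunc .
qed

text \<open>Column differences turn \<open>jacobi g l\<close> into a determinant with first column
  \<open>g (a i)\<close> and further columns \<open>h (a i + j)\<close>, whose cofactors along the
  first column are the \<open>c i\<close>. Replacing \<open>g (a i)\<close> by
  \<open>?G * zpow (a i)\<close> changes it only in high order, and \<open>?G'\<close> is the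
  inverse of \<open>?G\<close>.\<close>

lemma vertex_remove:
  assumes g: "newton (\<lambda>k. embed (v k) + zseq k) g" and l: "l \<in> partitions"
  shows "gamma (zpow (- 1)) (\<lambda>k. - embed (v k)) * jacobi g l
    = msum (\<lambda>i. (- 1) ^ i * zpow (int (l i) - int i) * jacobi h (remove_row l i)) UNIV"
    (is "?G' * _ = msum ?f _")
proof (rule mps_eqI)
  fix M
  let ?G = "gamma (zpow (- 1)) (\<lambda>k. embed (v k))"
  \<comment> \<open>Large enough for all parts of l and for the truncation: removing a row beyond N'
    gives a size above the weight of M.\<close>
  define N' where "N' = num_parts l + wdeg \<omega> M"
  define N where "N = Suc N'"
  define a where "a = (\<lambda>i. int (l i) - int i)"
  define c where "c = (\<lambda>i. (- 1) ^ i * jacobi h (remove_row l i))"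
  define D where "D r = det (mat N N (\<lambda>(i, j). if j = 0 then r i else h (a i + int j)))" for r
  have inv: "?G' * ?G = 1"
    using gamma_add[of \<omega> "\<lambda>k. - embed (v k)" "\<lambda>k. embed (v k)" "zpow (- 1)"] v by (simp add: gamma_0)
  have hg: "h = (\<lambda>n. g n - zvar * g (n - 1))"
    using newton_unique[OF _ newton_diff_geo[OF g, of zseq zvar], of h] h by (simp add: zseq_power)
  have D: "D r = (\<Sum>i<N. r i * c i)" for r
  proof -
    let ?B = "mat N N (\<lambda>(i, j). if j = 0 then r i else h (a i + int j))"
    have "D r = (\<Sum>i<N. ?B $$ (i, 0) * cofactor ?B i 0)"
      unfolding D_def by (rule laplace_expansion_column) (auto simp: N_def)
    also have "\<dots> = (\<Sum>i<N. r i * c i)"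
    proof (rule sum.cong[OF refl])
      fix i assume i: "i \<in> {..<N}"
      have "mat_delete ?B i 0 = jacobi_mat h N' (remove_row l i)"
        by (rule eq_matI) (use i in \<open>auto simp: mat_delete_def jacobi_mat_def remove_row_def N_def a_def algebra_simps\<close>)
      moreover have "num_parts (remove_row l i) \<le> N'"
        by (rule num_parts_remove_row[OF l]) (use i in \<open>auto simp: N_def N'_def\<close>)
      ultimately have "det (mat_delete ?B i 0) = jacobi h (remove_row l i)"
        using det_jacobi_mat[OF h remove_row_partition[OF l]] by simp
      then show "?B $$ (i, 0) * cofactor ?B i 0 = r i * c i"
        using i by (simp add: cofactor_def c_def)
    qed
    finally show ?thesis .
  qed
  have "jacobi g l = det (mat N N (\<lambda>(i, j). g (a i + int j)))"
    using det_jacobi_mat[OF g l, of N] by (simp add: N_def N'_def jacobi_mat_def a_def)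
  also have "\<dots> = det (mat N N (\<lambda>(i, j). if j = 0 then g (a i + int 0) else g (a i + int j) - zvar * g (a i + int (j - 1))))"
    by (rule det_column_difference[symmetric])
  also have "mat N N (\<lambda>(i, j). if j = 0 then g (a i + int 0) else g (a i + int j) - zvar * g (a i + int (j - 1)))
      = mat N N (\<lambda>(i, j). if j = 0 then g (a i) else h (a i + int j))"
    by (rule eq_matI) (auto simp: hg of_nat_diff algebra_simps)
  finally have jg: "jacobi g l = (\<Sum>i<N. g (a i) * c i)" unfolding D[symmetric] D_def .
  \<comment> \<open>For these q the first column coincides with column q.\<close>
  have D0: "D (\<lambda>i. h (q + a i)) = 0" if q: "q \<in> {1..<int N}" for q
    unfolding D_def
    by (rule det_identical_columns[of _ N 0 "nat q"]) (use q in \<open>auto simp: N_def algebra_simps intro!: eq_vecI\<close>)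
  have c_below: "vanishes_below \<omega> (psize l + i - l i) (c i)" for i
  proof -
    have "psize l + i - l i = psize (remove_row l i)" using psize_remove_row[OF l, of i] by linarith
    then show ?thesis unfolding c_def by (simp add: vanishes_below_mult_left[OF jacobi_embed_below[OF v h]])
  qed
  \<comment> \<open>As \<open>a i > - N\<close> for i < N, the choice \<open>2 * N\<close> keeps the
    truncation order \<open>?K + a i + 1\<close> at least N.\<close>
  let ?P = "int (psize l)" and ?K = "2 * int N"
  \<comment> \<open>Iteration of \<open>g b = h b + z g (b - 1)\<close>, which stops because
    \<open>b - psize l - 1\<close> is negative.\<close>
  have g_sum: "g b = (\<Sum>n=- ?P..0. zpow (- n) * h (n + b))" if "b \<le> ?P" for b
  proof -
    let ?F = "\<lambda>k. zpow (int k) * g (b - int k)"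
    have "zpow (int k) * h (b - int k) = ?F k - ?F (Suc k)" for k
    proof -
      have "zpow (int (Suc k)) = (zpow (int k) * zvar :: ('v, laurent) mps)"
        by (simp add: zpow_mult add.commute)
      moreover have "b - int (Suc k) = b - int k - 1" by simp
      ultimately show ?thesis by (simp only: hg right_diff_distrib mult.assoc)
    qed
    then have "(\<Sum>k\<le>psize l. zpow (int k) * h (b - int k)) = ?F 0 - ?F (Suc (psize l))"
      using sum_telescope[of ?F "psize l"] by (simp only:)
    then have "g b = (\<Sum>k\<le>psize l. zpow (int k) * h (b - int k))"
      using that newtonD(1)[OF g] by simp
    also have "\<dots> = (\<Sum>n=- ?P..0. zpow (- n) * h (n + b))"
      by (rule sum.reindex_bij_witness[of _ "\<lambda>n. nat (- n)" "\<lambda>k. - int k"]) auto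
    finally show ?thesis .
  qed
  let ?S = "\<lambda>i. \<Sum>n=- ?P..?K. zpow (- n) * h (n + a i)"
  have split: "?G * zpow (a i) - g (a i) = (?G * zpow (a i) - ?S i) + (\<Sum>q=1..?K. zpow (- q) * h (q + a i))" if "i < N" for i
  proof -
    have "a i \<le> ?P" using le_psize[OF l, of i] by (simp add: a_def)
    moreover have "?S i = (\<Sum>n=- ?P..0. zpow (- n) * h (n + a i)) + (\<Sum>q=1..?K. zpow (- q) * h (q + a i))"
      by (subst sum.union_disjoint[symmetric]) (auto intro!: sum.cong)
    ultimately show ?thesis by (simp add: g_sum)
  qed
  have "(\<Sum>i<N. (?G * zpow (a i) - g (a i)) * c i)
      = (\<Sum>i<N. (?G * zpow (a i) - ?S i) * c i + (\<Sum>q=1..?K. zpow (- q) * h (q + a i) * c i))"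
    by (rule sum.cong[OF refl]) (simp only: lessThan_iff split distrib_right sum_distrib_right)
  also have "\<dots> = (\<Sum>i<N. (?G * zpow (a i) - ?S i) * c i) + (\<Sum>i<N. \<Sum>q=1..?K. zpow (- q) * h (q + a i) * c i)"
    by (rule sum.distrib)
  also have "(\<Sum>i<N. \<Sum>q=1..?K. zpow (- q) * h (q + a i) * c i) = (\<Sum>q=1..?K. zpow (- q) * (\<Sum>i<N. h (q + a i) * c i))"
    by (subst sum.swap) (simp add: sum_distrib_left mult.assoc)
  finally have X: "(\<Sum>i<N. (?G * zpow (a i) - g (a i)) * c i)
      = (\<Sum>i<N. (?G * zpow (a i) - ?S i) * c i) + (\<Sum>q=1..?K. zpow (- q) * (\<Sum>i<N. h (q + a i) * c i))" .
  have "vanishes_below \<omega> N (\<Sum>i<N. (?G * zpow (a i) - g (a i)) * c i)"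
    unfolding X
  proof (rule vanishes_below_add; rule vanishes_below_sum)
    fix i assume i: "i \<in> {..<N}"
    have "vanishes_below \<omega> (nat (?K + a i + 1)) (?G * zpow (a i) - ?S i)"
      using le_psize[OF l, of i] by (intro gamma_shift_truncate[OF v h]) (simp add: a_def)
    then show "vanishes_below \<omega> N ((?G * zpow (a i) - ?S i) * c i)"
      using i by (intro vanishes_below_mult_right, elim vanishes_below_mono) (simp add: a_def)
  next
    fix q assume q: "q \<in> {1..?K}"
    have "vanishes_below \<omega> N (\<Sum>i<N. h (q + a i) * c i)"
    proof (cases "q < int N")
      case True
      then show ?thesis using D0[of q] q D by simp
    next
      \<comment> \<open>Here the orders of \<open>h (q + a i)\<close> and \<open>c i\<close> add up
        to \<open>q + psize l\<close>, which is at least N.\<close>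
      case False
      show ?thesis
      proof (rule vanishes_below_sum)
        fix i assume "i \<in> {..<N}"
        show "vanishes_below \<omega> N (h (q + a i) * c i)"
        proof (cases "q + a i < 0")
          case True
          then show ?thesis using newtonD(1)[OF h] by simp
        next
          case nn: False
          have "vanishes_below \<omega> (nat (q + a i) + (psize l + i - l i)) (h (q + a i) * c i)"
            using vanishes_below_mult[OF newton_embed_below[OF v h, of "nat (q + a i)"] c_below[of i]] nn by simp
          then show ?thesis
            by (rule vanishes_below_mono)
              (use nn False le_psize[OF l, of i] in \<open>simp add: a_def nat_add_distrib[symmetric]\<close>)
        qed
      qed
    qed
    then show "vanishes_below \<omega> N (zpow (- q) * (\<Sum>i<N. h (q + a i) * c i))"
      by (rule vanishes_below_mult_left)
  qed
  then have "vanishes_below \<omega> N (?G' * (\<Sum>i<N. (?G * zpow (a i) - g (a i)) * c i))"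
    by (rule vanishes_below_mult_left)
  also have "?G' * (\<Sum>i<N. (?G * zpow (a i) - g (a i)) * c i)
      = (?G' * ?G) * (\<Sum>i<N. zpow (a i) * c i) - ?G' * jacobi g l"
    unfolding jg by (simp add: sum_subtractf left_diff_distrib right_diff_distrib sum_distrib_left mult.assoc)
  finally have "vanishes_below \<omega> N ((\<Sum>i<N. zpow (a i) * c i) - ?G' * jacobi g l)"
    unfolding inv mult_1_left .
  from vanishes_below_diffD[OF this, symmetric]
  have "mcoeff (?G' * jacobi g l) M = mcoeff (\<Sum>i<N. zpow (a i) * c i) M"
    by (simp add: N_def N'_def del: sum.lessThan_Suc)
  also have "\<dots> = (\<Sum>i<N. mcoeff (?f i) M)"
    by (simp add: mcoeff_sum a_def c_def ac_simps)
  also have "\<dots> = mcoeff (msum ?f UNIV) M"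
  proof (rule mcoeff_msum[symmetric])
    fix i assume "i \<in> UNIV - {..<N}"
    then have "wdeg \<omega> M < psize (remove_row l i)"
      using psize_remove_row[OF l, of i] partition_zero[OF l, of i] by (simp add: N_def N'_def)
    then show "mcoeff (?f i) M = 0"
      using vanishes_below_mult_left[OF jacobi_embed_below[OF v h, of "remove_row l i"], of "(- 1) ^ i * zpow (int (l i) - int i)"]
      by (simp add: vanishes_below_def)
  qed auto
  finally show "mcoeff (?G' * jacobi g l) M = mcoeff (msum ?f UNIV) M" .
qed

end

section \<open>Maya diagrams\<close>

text \<open>The Maya diagram translated by n + 1/2, hence made of integers: r stands for the
  half-integer \<open>r - 1/2\<close>.\<close>

definition maya_points :: "int \<Rightarrow> (nat \<Rightarrow> nat) \<Rightarrow> int set" where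
  "maya_points n l = range (\<lambda>k. int (l k) - int k + n)"

text \<open>Rows before i gain a cell and later rows move up by one place; either way
  \<open>l k - k\<close> grows by 1. The points of l are distinct, so only the point of row i
  disappears.\<close>

lemma maya_points_remove_row:
  assumes l: "l \<in> partitions"
  shows "maya_points n (remove_row l i) = maya_points (n + 1) l - {int (l i) - int i + n + 1}"
proof -
  let ?f = "\<lambda>k. int (l k) - int k + (n + 1)"
  have anti: "?f k' < ?f k" if "k < k'" for k k'
    using antimonoD[of l k k'] l that by (auto simp: partitions_def)
  have inj: "k = i" if "?f k = ?f i" for k
    using anti[of k i] anti[of i k] that by (metis less_irrefl linorder_neqE_nat)
  have "maya_points n (remove_row l i) = ?f ` (- {i})"
  proof (intro equalityI subsetI)
    fix x assume "x \<in> maya_points n (remove_row l i)"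
    then obtain k where "x = int (remove_row l i k) - int k + n" by (auto simp: maya_points_def)
    then show "x \<in> ?f ` (- {i})"
      by (intro image_eqI[of _ _ "if k < i then k else Suc k"]) (auto simp: remove_row_def)
  next
    fix x assume "x \<in> ?f ` (- {i})"
    then obtain k where k: "x = ?f k" "k \<noteq> i" by auto
    then show "x \<in> maya_points n (remove_row l i)"
      unfolding maya_points_def
      by (intro range_eqI[of _ _ "if k < i then k else k - 1"]) (auto simp: remove_row_def)
  qed
  also have "\<dots> = maya_points (n + 1) l - {?f i}"
    using inj by (auto simp: maya_points_def)
  finally show ?thesis by (simp add: algebra_simps)
qed

lemma shift_subset_maya:
  assumes "X \<subseteq> half_ints"
  shows "shift X n \<subseteq> maya l \<longleftrightarrow> {r. of_int r - 1 / 2 \<in> X} \<subseteq> maya_points n l"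
proof -
  have *: "of_int r - 1 / 2 - of_int n \<in> maya l \<longleftrightarrow> r \<in> maya_points n l" for r
  proof -
    have "of_int r - 1 / 2 - of_int n = of_nat (l k) - of_nat (k + 1) + (1 / 2 :: rat) \<longleftrightarrow> r = int (l k) - int k + n" for k
    proof -
      have "of_int r - 1 / 2 - of_int n = of_nat (l k) - of_nat (k + 1) + (1 / 2 :: rat)
        \<longleftrightarrow> (of_int r :: rat) = of_int (int (l k) - int k + n)" by auto
      then show ?thesis by (simp only: of_int_eq_iff)
    qed
    then show ?thesis unfolding maya_def maya_points_def by auto
  qed
  show ?thesis
  proof
    assume L: "shift X n \<subseteq> maya l"
    show "{r. of_int r - 1 / 2 \<in> X} \<subseteq> maya_points n l"
      using L unfolding shift_def by (auto simp flip: *)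
  next
    assume R: "{r. of_int r - 1 / 2 \<in> X} \<subseteq> maya_points n l"
    show "shift X n \<subseteq> maya l"
      unfolding shift_def
    proof (rule image_subsetI)
      fix x assume x: "x \<in> X"
      \<comment> \<open>As X consists of half-integers, each of its points is \<open>r - 1/2\<close>
        with r = k + 1.\<close>
      then obtain k :: int where "x = of_int k + 1 / 2" using assms by (auto simp: half_ints_def)
      then have k: "x = of_int (k + 1) - 1 / 2" by simp
      then have "k + 1 \<in> maya_points n l" using R x by auto
      then show "x - of_int n \<in> maya l" unfolding k * .
    qed
  qed
qed

section \<open>Bilinear sums\<close>

text \<open>The entries are embedded coefficients of a series in 1/z, so the determinants are free
  of z, as needed for \<open>zcoeff_bilinear\<close>.\<close>

lemma jacobi_embed:
  assumes v: "\<And>k. vanishes_below \<omega> (max 1 k) (v k)" and h: "newton (\<lambda>k. embed (v k)) h"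
  obtains f where "jacobi h = (\<lambda>l. embed (f l))"
proof -
  have "h = (\<lambda>n. embed (zcoeff (- n) (gamma (zpow (- 1)) (\<lambda>k. embed (v k)))))"
    using newton_embed_gamma[OF v h] by blast
  then have "jacobi h l = embed (jacobi (\<lambda>n. zcoeff (- n) (gamma (zpow (- 1)) (\<lambda>k. embed (v k)))) l)" for l
    by (metis embed.hom_jacobi)
  then show ?thesis by (intro that ext)
qed

context
  fixes \<omega> :: "'v \<Rightarrow> nat" and v :: "nat \<Rightarrow> ('v, rat) mps" and h and p :: "(nat \<Rightarrow> nat) \<Rightarrow> ('v, laurent) mps" and A
  assumes v: "\<And>k. vanishes_below \<omega> (max 1 k) (v k)"
    and h: "newton (\<lambda>k. embed (v k)) h"
    and p: "\<And>l. vanishes_below \<omega> (psize l) (p l)"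
    and A: "A \<subseteq> partitions"
begin

lemma msummable_jacobi: "msummable (\<lambda>l. p l * f l) A"
proof (rule msummable_weight[where n = psize])
  show "finite {l \<in> A. psize l \<le> K}" for K
    by (rule finite_subset[OF _ finite_partitions[of K]]) (use A in auto)
qed (rule vanishes_below_mult_right[OF p])

text \<open>\<open>vertex_remove\<close> under the sum; \<open>p l\<close> stands for the Schur
  function in the other variables. With it the term of (l, i) has order at least
  \<open>psize l + psize (remove_row l i)\<close>, which makes the family summable.\<close>

lemma gamma_sum_remove:
  assumes g: "newton (\<lambda>k. embed (v k) + zseq k) g"
  defines "F \<equiv> \<lambda>(l, i). p l * ((- 1) ^ i * zpow (int (l i) - int i) * jacobi h (remove_row l i))"
  shows "gamma (zpow (- 1)) (\<lambda>k. - embed (v k)) * msum (\<lambda>l. p l * jacobi g l) A = msum F (A \<times> UNIV)" (is ?eq)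
    and "msummable F (A \<times> UNIV)" (is ?sum)
proof -
  let ?G = "gamma (zpow (- 1)) (\<lambda>k. - embed (v k))" and ?c = "\<lambda>l i. (- 1) ^ i * zpow (int (l i) - int i) * jacobi h (remove_row l i)"
  have below: "vanishes_below \<omega> (psize l + psize (remove_row l i)) (p l * ?c l i)" for l i
    by (intro vanishes_below_mult p vanishes_below_mult_left jacobi_embed_below[OF v h])
  show sum: ?sum
  proof (rule msummable_weight[where n = "\<lambda>(l, i). psize l + psize (remove_row l i)"])
    show "vanishes_below \<omega> (case x of (l, i) \<Rightarrow> psize l + psize (remove_row l i)) (F x)" for x
      unfolding F_def case_prod_unfold by (rule below)
    show "finite {x \<in> A \<times> UNIV. (case x of (l, i) \<Rightarrow> psize l + psize (remove_row l i)) \<le> K}" for K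
      by (rule finite_subset[OF _ finite_remove_row[of K]]) (use A in auto)
  qed
  have row: "msummable (\<lambda>i. ?c l i) UNIV" if l: "l \<in> partitions" for l
  proof (rule msummable_weight)
    show "vanishes_below \<omega> (psize (remove_row l i)) (?c l i)" for i
      by (intro vanishes_below_mult_left jacobi_embed_below[OF v h])
    show "finite {i \<in> UNIV. psize (remove_row l i) \<le> K}" for K
    proof (rule finite_subset)
      show "{i \<in> UNIV. psize (remove_row l i) \<le> K} \<subseteq> {..K + psize l}"
      proof
        fix i assume "i \<in> {i \<in> UNIV. psize (remove_row l i) \<le> K}"
        then show "i \<in> {..K + psize l}"
          using psize_remove_row[OF l, of i] le_psize[OF l, of i] by simp
      qed
    qed simp
  qed
  have "?G * msum (\<lambda>l. p l * jacobi g l) A = msum (\<lambda>l. ?G * (p l * jacobi g l)) A"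
    by (rule msum_mult_left[symmetric]) (rule msummable_jacobi)
  also have "\<dots> = msum (\<lambda>l. msum (\<lambda>i. p l * ?c l i) UNIV) A"
  proof (rule msum_cong)
    fix l assume "l \<in> A"
    then have l: "l \<in> partitions" using A by auto
    have "?G * (p l * jacobi g l) = p l * (?G * jacobi g l)" by (simp only: ac_simps)
    then show "?G * (p l * jacobi g l) = msum (\<lambda>i. p l * ?c l i) UNIV"
      unfolding vertex_remove[OF v h g l] by (simp add: msum_mult_left[OF row[OF l]])
  qed
  also have "\<dots> = msum F (A \<times> UNIV)"
    unfolding F_def by (rule msum_Sigma(2)) (use sum in \<open>simp add: F_def\<close>)
  finally show ?eq .
qed

text \<open>\<open>vertex_add\<close> under the sum. A pair (l, i) determines m, so the sum over m
  and the sums over the pairs lying above m combine into one sum over pairs.\<close>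

lemma gamma_sum_add:
  assumes g: "newton (\<lambda>k. embed (v k) - zseq k) g"
  defines "F \<equiv> \<lambda>(l, i). p (remove_row l i) * ((- 1) ^ i * zpow (int i - int (l i)) * jacobi h l)"
    and "E \<equiv> {(l, i). l \<in> partitions \<and> remove_row l i \<in> A}"
  shows "gamma (zpow (- 1)) (\<lambda>k. embed (v k)) * msum (\<lambda>m. p m * jacobi g m) A = msum F E" (is ?eq)
    and "msummable F E" (is ?sum)
proof -
  let ?G = "gamma (zpow (- 1)) (\<lambda>k. embed (v k))" and ?E = "\<lambda>m. {(l, i). l \<in> partitions \<and> remove_row l i = m}"
  let ?c = "\<lambda>(l, i). (- 1) ^ i * zpow (int i - int (l i)) * jacobi h l"
  have below: "vanishes_below \<omega> (psize l + psize (remove_row l i)) (p (remove_row l i) * ?c (l, i))" for l i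
    unfolding add.commute[of "psize l"] prod.case
    by (intro vanishes_below_mult p vanishes_below_mult_left jacobi_embed_below[OF v h])
  show sum: ?sum
  proof (rule msummable_weight[where n = "\<lambda>(l, i). psize l + psize (remove_row l i)"])
    show "vanishes_below \<omega> (case x of (l, i) \<Rightarrow> psize l + psize (remove_row l i)) (F x)" for x
      unfolding F_def case_prod_unfold using below[of "fst x" "snd x"] by (simp only: prod.case)
    show "finite {x \<in> E. (case x of (l, i) \<Rightarrow> psize l + psize (remove_row l i)) \<le> K}" for K
      by (rule finite_subset[OF _ finite_remove_row[of K]]) (auto simp: E_def)
  qed
  have col: "msummable ?c (?E m)" for m
  proof (rule msummable_weight[where n = "\<lambda>(l, i). psize l"])
    show "vanishes_below \<omega> (case x of (l, i) \<Rightarrow> psize l) (?c x)" for x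
      unfolding case_prod_unfold by (intro vanishes_below_mult_left jacobi_embed_below[OF v h])
    show "finite {x \<in> ?E m. (case x of (l, i) \<Rightarrow> psize l) \<le> K}" for K
      by (rule finite_subset[OF _ finite_remove_row[of "K + psize m"]]) auto
  qed
  let ?h = "\<lambda>(l, i). (remove_row l i, (l, i))"
  have img: "Sigma A ?E = ?h ` E" by (auto simp: E_def)
  have inj: "inj_on ?h E" by (auto simp: inj_on_def)
  have sg: "msummable (\<lambda>(m, x). p m * ?c x) (Sigma A ?E)"
    unfolding msummable_def
  proof
    fix M
    have "{x \<in> Sigma A ?E. mcoeff (case x of (m, x) \<Rightarrow> p m * ?c x) M \<noteq> 0}
      \<subseteq> ?h ` {x \<in> E. mcoeff (F x) M \<noteq> 0}"
      by (auto simp: E_def F_def)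
    then show "finite {x \<in> Sigma A ?E. mcoeff (case x of (m, x) \<Rightarrow> p m * ?c x) M \<noteq> 0}"
      by (rule finite_subset) (use sum in \<open>simp add: msummable_def\<close>)
  qed
  have "?G * msum (\<lambda>m. p m * jacobi g m) A = msum (\<lambda>m. ?G * (p m * jacobi g m)) A"
    by (rule msum_mult_left[symmetric]) (rule msummable_jacobi)
  also have "\<dots> = msum (\<lambda>m. msum (\<lambda>x. p m * ?c x) (?E m)) A"
  proof (rule msum_cong)
    fix m assume "m \<in> A"
    then have m: "m \<in> partitions" using A by auto
    have "?G * (p m * jacobi g m) = p m * (?G * jacobi g m)" by (simp only: ac_simps)
    then show "?G * (p m * jacobi g m) = msum (\<lambda>x. p m * ?c x) (?E m)"
      unfolding vertex_add[OF v h g m] by (simp only: msum_mult_left[OF col])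
  qed
  also have "\<dots> = msum (\<lambda>(m, x). p m * ?c x) (Sigma A ?E)"
    by (rule msum_Sigma(2)[OF sg])
  also have "\<dots> = msum (\<lambda>x. case ?h x of (m, x) \<Rightarrow> p m * ?c x) E"
    unfolding img by (rule msum_reindex[OF inj])
  also have "\<dots> = msum F E"
    by (rule msum_cong) (auto simp: F_def)
  finally show ?eq .
qed

end

section \<open>The Hirota equation\<close>

fun hwt :: "hvar \<Rightarrow> nat" where
  "hwt (Base (T k)) = max 1 k"
| "hwt (Base (T' k)) = max 1 k"
| "hwt (Shift (T k)) = max 1 k"
| "hwt (Shift (T' k)) = max 1 k"

theorem theorem3:
  fixes X :: "rat set"
  assumes "X \<subseteq> half_ints"
  shows "toda_tau (\<lambda>n. Z * rho (shift X n))"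
proof -
  define A where "A n = {l \<in> partitions. shift X n \<subseteq> maya l}" for n
  have \<tau>: "Z * rho (shift X n) = msum (\<lambda>l. schur_x l * schur_y l) (A n)" for n
    unfolding A_def by (rule Z_rho)
  have A: "A n \<subseteq> partitions" for n by (auto simp: A_def)
  define P Q U V :: "nat \<Rightarrow> (hvar, rat) mps" where
    "P k = var (Base (T k)) + var (Shift (T k))" and
    "Q k = var (Base (T k)) - var (Shift (T k))" and
    "U k = var (Base (T' k)) + var (Shift (T' k))" and
    "V k = var (Base (T' k)) - var (Shift (T' k))" for k
  have below: "vanishes_below hwt (max 1 k) (P k)" "vanishes_below hwt (max 1 k) (Q k)"
    "vanishes_below hwt (max 1 k) (U k)" "vanishes_below hwt (max 1 k) (V k)" for k
    unfolding P_def Q_def U_def V_def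
    by (intro vanishes_below_add vanishes_below_diff vanishes_below_var; simp)+
  obtain hP where hP: "newton (\<lambda>k. embed (P k)) hP" by (rule newton_exists)
  obtain hQ where hQ: "newton (\<lambda>k. embed (Q k)) hQ" by (rule newton_exists)
  obtain hU where hU: "newton (\<lambda>k. embed (U k)) hU" by (rule newton_exists)
  obtain hV where hV: "newton (\<lambda>k. embed (V k)) hV" by (rule newton_exists)
  obtain gP where gP: "newton (\<lambda>k. embed (P k) - zseq k) gP" by (rule newton_exists)
  obtain gQ where gQ: "newton (\<lambda>k. embed (Q k) + zseq k) gQ" by (rule newton_exists)
  obtain gU where gU: "newton (\<lambda>k. embed (U k) + zseq k) gU" by (rule newton_exists)
  obtain gV where gV: "newton (\<lambda>k. embed (V k) - zseq k) gV" by (rule newton_exists)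
  let ?G = "\<lambda>u. gamma (zpow (- 1)) (\<lambda>k. embed (u k))" and ?G' = "\<lambda>u. gamma (zpow (- 1)) (\<lambda>k. - embed (u k))"
  let ?L1 = "args (\<lambda>k. embed (P k)) (\<lambda>k. embed (U k) + zseq k)"
    and ?L2 = "args (\<lambda>k. embed (Q k)) (\<lambda>k. embed (V k) - zseq k)"
    and ?R1 = "args (\<lambda>k. embed (P k) - zseq k) (\<lambda>k. embed (U k))"
    and ?R2 = "args (\<lambda>k. embed (Q k) + zseq k) (\<lambda>k. embed (V k))"
  \<comment> \<open>\<open>zseq\<close> has order 0, so the variables whose arguments contain z must
    get weight 0: these are the \<open>T'\<close> on the left and the \<open>T\<close> on the
    right.\<close>
  have wL: "vanishes_below hwt (wt w) (?L1 w)" "vanishes_below hwt (wt w) (?L2 w)"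
    and wR: "vanishes_below hwt (wt' w) (?R1 w)" "vanishes_below hwt (wt' w) (?R2 w)" for w
    using below by (cases w; simp add: args_def)+
  note L1 = subst_schur_args[OF A disjI1[OF refl] wL(1) hP gU, folded \<tau>]
    and L2 = subst_schur_args[OF A disjI1[OF refl] wL(2) hQ gV, folded \<tau>]
    and R1 = subst_schur_args[OF A disjI2[OF refl] wR(1) gP hU, folded \<tau>]
    and R2 = subst_schur_args[OF A disjI2[OF refl] wR(2) gQ hV, folded \<tau>]
  have pos: "l \<in> A n \<longleftrightarrow> {r. of_int r - 1 / 2 \<in> X} \<subseteq> maya_points n l" if "l \<in> partitions" for n l
    using that shift_subset_maya[OF assms] by (simp add: A_def)
  \<comment> \<open>The common term of both sides, free of z. It carries the power \<open>e\<close>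
    of z on the left and \<open>- e\<close> on the right.\<close>
  define C :: "((nat \<Rightarrow> nat) \<times> nat) \<times> ((nat \<Rightarrow> nat) \<times> nat) \<Rightarrow> (hvar, laurent) mps"
    where "C = (\<lambda>((l, i), (k, j)). (- 1) ^ i * (- 1) ^ j *
      (jacobi hP l * jacobi hU (remove_row l i) * jacobi hQ (remove_row k j) * jacobi hV k))"
  define e :: "((nat \<Rightarrow> nat) \<times> nat) \<times> ((nat \<Rightarrow> nat) \<times> nat) \<Rightarrow> int"
    where "e = (\<lambda>((l, i), (k, j)). (int (l i) - int i) - (int (k j) - int j))"
  obtain fP where fP: "jacobi hP = (\<lambda>l. embed (fP l))" by (rule jacobi_embed[OF below(1) hP])
  obtain fQ where fQ: "jacobi hQ = (\<lambda>l. embed (fQ l))" by (rule jacobi_embed[OF below(2) hQ])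
  obtain fU where fU: "jacobi hU = (\<lambda>l. embed (fU l))" by (rule jacobi_embed[OF below(3) hU])
  obtain fV where fV: "jacobi hV = (\<lambda>l. embed (fV l))" by (rule jacobi_embed[OF below(4) hV])
  have C: "zcoeff d (C x) = (if d = 0 then zcoeff 0 (C x) else 0)" for d x
  proof -
    obtain l i k j where x: "x = ((l, i), (k, j))" by (metis surj_pair)
    have "C x = embed ((- 1) ^ i * (- 1) ^ j * (fP l * fU (remove_row l i) * fQ (remove_row k j) * fV k))"
      by (simp add: x C_def fP fQ fU fV embed.hom_mult embed.hom_power embed.hom_uminus)
    then show ?thesis by (simp add: zcoeff_embed)
  qed
  define E where "E n = {(l, i). l \<in> partitions \<and> remove_row l i \<in> A n}" for n
  \<comment> \<open>As -2s' = V - U and 2s = P - Q, each prefactor splits into one factor for each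
    of the two functions.\<close>
  have gam1: "gamma (zpow (- 1)) (\<lambda>k. - 2 * var (Shift (T' k))) = ?G V * ?G' U"
  proof -
    have "(\<lambda>k. - 2 * var (Shift (T' k))) = (\<lambda>k. embed (V k) + - embed (U k))"
      by (simp add: U_def V_def embed.hom_add embed.hom_minus)
    then show ?thesis using gamma_add[of hwt "\<lambda>k. embed (V k)" "\<lambda>k. - embed (U k)"] below by simp
  qed
  have gam2: "gamma (zpow (- 1)) (\<lambda>k. 2 * var (Shift (T k))) = ?G P * ?G' Q"
  proof -
    have "(\<lambda>k. 2 * var (Shift (T k))) = (\<lambda>k. embed (P k) + - embed (Q k))"
      by (simp add: P_def Q_def embed.hom_add embed.hom_minus)
    then show ?thesis using gamma_add[of hwt "\<lambda>k. embed (P k)" "\<lambda>k. - embed (Q k)"] below by simp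
  qed
  have main: "zcoeff (n - m) (?G V * ?G' U * subst (Z * rho (shift X (m + 1))) ?L1 * subst (Z * rho (shift X n)) ?L2)
      = zcoeff (m - n) (?G P * ?G' Q * subst (Z * rho (shift X m)) ?R1 * subst (Z * rho (shift X (n + 1))) ?R2)" for m n
  proof -
    note rU = gamma_sum_remove[OF below(3) hU jacobi_embed_below[OF below(1) hP] A gU, of "m + 1"]
    note aV = gamma_sum_add[OF below(4) hV jacobi_embed_below[OF below(2) hQ] A gV, of n, folded E_def]
    note aP = gamma_sum_add[OF below(1) hP jacobi_embed_below[OF below(3) hU] A gP, of m, folded E_def]
    note rQ = gamma_sum_remove[OF below(2) hQ jacobi_embed_below[OF below(4) hV] A gQ, of "n + 1"]
    have "?G V * ?G' U * subst (Z * rho (shift X (m + 1))) ?L1 * subst (Z * rho (shift X n)) ?L2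
      = (?G' U * msum (\<lambda>l. jacobi hP l * jacobi gU l) (A (m + 1))) * (?G V * msum (\<lambda>l. jacobi hQ l * jacobi gV l) (A n))"
      unfolding L1(2) L2(2) by (simp only: ac_simps)
    also have "zcoeff (n - m) \<dots> = msum (\<lambda>z. zcoeff 0 (C z)) {z \<in> (A (m + 1) \<times> UNIV) \<times> E n. e z = n - m}"
      unfolding rU(1) aV(1)
    proof (rule zcoeff_bilinear[OF rU(2) aV(2) _ C])
      fix x y :: "(nat \<Rightarrow> nat) \<times> nat"
      obtain l i k j where [simp]: "x = (l, i)" "y = (k, j)" by (metis surj_pair)
      have "e (x, y) = (int (l i) - int i) + (int j - int (k j))" by (simp add: e_def)
      then have "zpow (e (x, y)) = (zpow (int (l i) - int i) * zpow (int j - int (k j)) :: (hvar, laurent) mps)"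
        by (simp only: zpow_mult)
      then show "(case x of (l, i) \<Rightarrow> jacobi hP l * ((- 1) ^ i * zpow (int (l i) - int i) * jacobi hU (remove_row l i))) *
          (case y of (l, i) \<Rightarrow> jacobi hQ (remove_row l i) * ((- 1) ^ i * zpow (int i - int (l i)) * jacobi hV l))
        = zpow (e (x, y)) * C (x, y)"
        by (simp only: \<open>x = (l, i)\<close> \<open>y = (k, j)\<close> C_def prod.case ac_simps)
    qed
    finally have L: "zcoeff (n - m) (?G V * ?G' U * subst (Z * rho (shift X (m + 1))) ?L1 * subst (Z * rho (shift X n)) ?L2)
      = msum (\<lambda>z. zcoeff 0 (C z)) {z \<in> (A (m + 1) \<times> UNIV) \<times> E n. e z = n - m}" .
    have "?G P * ?G' Q * subst (Z * rho (shift X m)) ?R1 * subst (Z * rho (shift X (n + 1))) ?R2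
      = (?G P * msum (\<lambda>l. jacobi hU l * jacobi gP l) (A m)) * (?G' Q * msum (\<lambda>l. jacobi hV l * jacobi gQ l) (A (n + 1)))"
      unfolding R1(2) R2(2) mult.commute[of "jacobi hU _"] mult.commute[of "jacobi hV _"] by (simp only: ac_simps)
    also have "zcoeff (m - n) \<dots> = msum (\<lambda>z. zcoeff 0 (C z)) {z \<in> E m \<times> (A (n + 1) \<times> UNIV). - e z = m - n}"
      unfolding rQ(1) aP(1)
    proof (rule zcoeff_bilinear[OF aP(2) rQ(2) _ C, where e = "\<lambda>z. - e z"])
      fix x y :: "(nat \<Rightarrow> nat) \<times> nat"
      obtain l i k j where [simp]: "x = (l, i)" "y = (k, j)" by (metis surj_pair)
      have "- e (x, y) = (int i - int (l i)) + (int (k j) - int j)" by (simp add: e_def)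
      then have "zpow (- e (x, y)) = (zpow (int i - int (l i)) * zpow (int (k j) - int j) :: (hvar, laurent) mps)"
        by (simp only: zpow_mult)
      then show "(case x of (l, i) \<Rightarrow> jacobi hU (remove_row l i) * ((- 1) ^ i * zpow (int i - int (l i)) * jacobi hP l)) *
          (case y of (l, i) \<Rightarrow> jacobi hV l * ((- 1) ^ i * zpow (int (l i) - int i) * jacobi hQ (remove_row l i)))
        = zpow (- e (x, y)) * C (x, y)"
        by (simp only: \<open>x = (l, i)\<close> \<open>y = (k, j)\<close> C_def prod.case ac_simps)
    qed
    \<comment> \<open>The exponent condition says that the points removed from l, in charge m + 1,
      and from k, in charge n + 1, coincide. By \<open>maya_points_remove_row\<close> it is then
      irrelevant from which of the two diagrams this point is taken out.\<close>
    also have "{z \<in> E m \<times> (A (n + 1) \<times> UNIV). - e z = m - n} = {z \<in> (A (m + 1) \<times> UNIV) \<times> E n. e z = n - m}"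
    proof (rule Collect_cong)
      fix z :: "((nat \<Rightarrow> nat) \<times> nat) \<times> ((nat \<Rightarrow> nat) \<times> nat)"
      obtain l i k j where z: "z = ((l, i), (k, j))" by (metis surj_pair)
      show "z \<in> E m \<times> (A (n + 1) \<times> UNIV) \<and> - e z = m - n \<longleftrightarrow> z \<in> (A (m + 1) \<times> UNIV) \<times> E n \<and> e z = n - m"
      proof (cases "l \<in> partitions \<and> k \<in> partitions \<and> e z = n - m")
        case True
        then have l: "l \<in> partitions" and k: "k \<in> partitions"
          and "int (l i) - int i + m + 1 = int (k j) - int j + n + 1" by (auto simp: z e_def)
        then show ?thesis
          using True unfolding z E_def
          by (auto simp: pos[OF l] pos[OF k] pos[OF remove_row_partition[OF l]] pos[OF remove_row_partition[OF k]]
            maya_points_remove_row[OF l] maya_points_remove_row[OF k])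
      next
        case False
        then show ?thesis using A unfolding z E_def by auto
      qed
    qed
    finally show ?thesis unfolding L by simp
  qed
  have emb: "embed (P k) = var (Base (T k)) + var (Shift (T k))" "embed (Q k) = var (Base (T k)) - var (Shift (T k))"
    "embed (U k) = var (Base (T' k)) + var (Shift (T' k))" "embed (V k) = var (Base (T' k)) - var (Shift (T' k))" for k
    by (simp_all add: P_def Q_def U_def V_def embed.hom_add embed.hom_minus)
  show ?thesis
    unfolding toda_tau_def Let_def emb[symmetric] gam1 gam2
    using L1(1) L2(1) R1(1) R2(1) main by blast
qed

end
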